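(* Let $a\in B_1^1$ be such that $\log a\in B_1^1$. Assume that $a=a_-a_0$ is the factorization with $a_-,a_-^{-1}\in B_1^1$ having $[a_-]_n=[a_-^{-1}]_n=0$ for all $n>0$, with $a_0,a_0^{-1}\in B_1^1$ satisfying $a_0=\tilde a_0$ and $a_0^{-1}=\widetilde{a_0^{-1}}$, and with $[a_-]_0=1$. 1. Suppose that $k$ is a negative even integer, $k=-2l$, $l\ge1$. Then, as $N\to\infty$ (for each choice of sign), $$\det P_N(T(a)\pm H(at^k))P_N\sim G[a]^{N+l}\,E_{1,\pm}[a]\,\det P_l\big(T(a_0^{-1})\pm H(a_0^{-1})\big)P_l,$$ $$E_{1,\pm}[a]=\exp\Big(\pm\sum_{n=0}^\infty[\log a]_{2n+1}-\frac12\sum_{n=1}^\infty n[\log a]_n^2+\sum_{n=1}^\infty n[\log a]_{-n}[\log a]_n\Big).$$ 2. Suppose that $k$ is a negative odd integer less than $-1$, $k=-1-2l$, $l\ge1$. Then, as $N\to\infty$, $$\det P_N(T(a)-H(at^k))P_N\sim G[a]^{N+l}\,E_2[a]\,\det P_l\big(T(a_0^{-1})-H(a_0^{-1}t^{-1})\big)P_l,$$ $$E_2[a]=\exp\Big(-\sum_{n=1}^\infty[\log a]_{2n}-\frac12\sum_{n=1}^\infty n[\log a]_n^2+\sum_{n=1}^\infty n[\log a]_{-n}[\log a]_n\Big).$$ 3. Suppose that $k$ is a negative odd integer, $k=1-2l$, $l\ge1$. Then, as $N\to\infty$, $$\det P_N(T(a)+H(at^k))P_N\sim G[a]^{N+l}\,E_3[a]\,\det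 P_l\big(T(a_0^{-1})+H(a_0^{-1}t)\big)P_l,$$ $$E_3[a]=\exp\Big(-\log2+\sum_{n=1}^\infty[\log a]_{2n}-\frac12\sum_{n=1}^\infty n[\log a]_n^2+\sum_{n=1}^\infty n[\log a]_{-n}[\log a]_n\Big).$$ 4. One has $$\det P_N(T(a)+H(at^k))P_N=0\quad\text{if }N\ge k\ge2,$$ $$\det P_N(T(a)-H(at^k))P_N=0\quad\text{if }N\ge k\ge1.$$
   Context: $\mathbb T$ is the unit circle with variable $t=e^{i\theta}$; for $a\in L^1(\mathbb T)$ the Fourier coefficients are $a_n=[a]_n=\frac1{2\pi}\int_{-\pi}^{\pi}a(e^{i\theta})e^{-in\theta}\,d\theta$, $n\in\mathbb Z$; $\tilde a(t)=a(t^{-1})$. $\ell^2$ is the space of complex square-summable sequences $\{x_n\}_{n=0}^\infty$. $T(a)=(a_{j-k})_{j,k\ge0}$ and $H(a)=(a_{j+k+1})_{j,k\ge0}$ are the Toeplitz and Hankel operators on $\ell^2$; thus $P_N(T(a)\pm H(at^k))P_N$ corresponds to the $N\times N$ matrix $(a_{i-j}\pm a_{i+j+1-k})_{i,j=0}^{N-1}$. $P_N$ is the projection on $\ell^2$ keeping the entries $x_0,\dots,x_{N-1}$ and replacing the others by $0$, and $\det P_NAP_N$ is the determinant of the upper-left $N\times N$ section of $A$. $B_1^1$ is the Besov class of functions $a$ on $\mathbb T$ with $$\int_{-\pi}^{\pi}\frac1{y^2}\int_{-\pi}^{\pi}|a(e^{ix+iy})+a(e^{ix-iy})-2a(e^{ix})|\,dx\,dy<\infty;$$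 equivalently, $H(a)$ and $H(\tilde a)$ are both trace class. It is a Banach algebra with a norm equivalent to $|a_0|+\|H(a)\|_{\mathcal C_1}+\|H(\tilde a)\|_{\mathcal C_1}$, where $\mathcal C_1$ denotes the trace class. "$\log a\in B_1^1$" means that a logarithm of $a$ in $B_1^1$ exists and is fixed. $G[a]=\exp\big(\frac1{2\pi}\int_{-\pi}^\pi\log a(e^{i\theta})\,d\theta\big)$. The relation $x_N\sim G[a]^{N+l}c$ with $c$ independent of $N$ is understood as $x_N/G[a]^{N+l}\to c$ as $N\to\infty$. *)

theory Defs
  imports
    "HOL-Analysis.Analysis"
    "HOL-Library.Function_Algebras"
    "Jordan_Normal_Form.Determinant"
begin

text \<open>
  A function on the unit circle is represented by a function on the complex plane of which
  only the values at \<open>cis \<theta>\<close> matter. As for elements of \<open>L\<^sup>1\<close>, equality of functions on the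
  circle is equality almost everywhere.
\<close>

definition circle_eq :: "(complex \<Rightarrow> complex) \<Rightarrow> (complex \<Rightarrow> complex) \<Rightarrow> bool"
    (infix \<open>=\<^sub>T\<close> 50) where
  "a =\<^sub>T b \<longleftrightarrow> (AE \<theta> in lebesgue_on {-pi..pi}. a (cis \<theta>) = b (cis \<theta>))"

definition fourier :: "(complex \<Rightarrow> complex) \<Rightarrow> int \<Rightarrow> complex" where
  "fourier a n =
     complex_of_real (1 / (2 * pi)) * (LINT \<theta>:{-pi..pi}|lebesgue. a (cis \<theta>) * exp (- \<i> * of_int n * complex_of_real \<theta>))"

definition tilde :: "(complex \<Rightarrow> complex) \<Rightarrow> complex \<Rightarrow> complex" where
  "tilde a = (\<lambda>t. a (inverse t))"

text \<open>The point \<open>y = 0\<close>, where the quotient is \<open>0\<close> by convention, is a null set.\<close>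

definition besov_1_1 :: "(complex \<Rightarrow> complex) set" where
  "besov_1_1 = {a. (\<lambda>\<theta>. a (cis \<theta>)) absolutely_integrable_on {-pi..pi} \<and>
     (\<integral>\<^sup>+ y\<in>{-pi..pi}. ennreal (1 / y\<^sup>2) *
        (\<integral>\<^sup>+ x\<in>{-pi..pi}.
           ennreal (norm (a (cis (x + y)) + a (cis (x - y)) - 2 * a (cis x))) \<partial>lebesgue)
      \<partial>lebesgue) < \<infinity>}"

text \<open>
  Operators on \<open>\<ell>\<^sup>2\<close> are given by their infinite matrices; sums and differences of matrices are
  the pointwise ones on functions.
\<close>

type_synonym inf_mat = "nat \<Rightarrow> nat \<Rightarrow> complex"

definition toeplitz :: "(complex \<Rightarrow> complex) \<Rightarrow> inf_mat" where
  "toeplitz a = (\<lambda>j k. fourier a (int j - int k))"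

definition hankel :: "(complex \<Rightarrow> complex) \<Rightarrow> inf_mat" where
  "hankel a = (\<lambda>j k. fourier a (int j + int k + 1))"

text \<open>The determinant of \<open>P\<^sub>N A P\<^sub>N\<close>, i.e. of the upper-left section of \<open>A\<close> of size \<open>N\<close>.\<close>

definition det_P :: "nat \<Rightarrow> inf_mat \<Rightarrow> complex" where
  "det_P N A = Determinant.det (Matrix.mat N N (\<lambda>(i, j). A i j))"

text \<open>
  The constants depend on the fixed logarithm of the symbol \<open>a\<close>; their argument \<open>b\<close> is that
  logarithm, not \<open>a\<close> itself.
\<close>

definition G_const :: "(complex \<Rightarrow> complex) \<Rightarrow> complex" where
  "G_const b = exp (complex_of_real (1 / (2 * pi)) * (LINT \<theta>:{-pi..pi}|lebesgue. b (cis \<theta>)))"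

definition E1_plus :: "(complex \<Rightarrow> complex) \<Rightarrow> complex" where
  "E1_plus b = exp ((\<Sum>n. fourier b (2 * int n + 1))
     - 1 / 2 * (\<Sum>n. of_nat (Suc n) * (fourier b (int (Suc n)))\<^sup>2)
     + (\<Sum>n. of_nat (Suc n) * fourier b (- int (Suc n)) * fourier b (int (Suc n))))"

definition E1_minus :: "(complex \<Rightarrow> complex) \<Rightarrow> complex" where
  "E1_minus b = exp (- (\<Sum>n. fourier b (2 * int n + 1))
     - 1 / 2 * (\<Sum>n. of_nat (Suc n) * (fourier b (int (Suc n)))\<^sup>2)
     + (\<Sum>n. of_nat (Suc n) * fourier b (- int (Suc n)) * fourier b (int (Suc n))))"

definition E2 :: "(complex \<Rightarrow> complex) \<Rightarrow> complex" where
  "E2 b = exp (- (\<Sum>n. fourier b (2 * int (Suc n)))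
     - 1 / 2 * (\<Sum>n. of_nat (Suc n) * (fourier b (int (Suc n)))\<^sup>2)
     + (\<Sum>n. of_nat (Suc n) * fourier b (- int (Suc n)) * fourier b (int (Suc n))))"

definition E3 :: "(complex \<Rightarrow> complex) \<Rightarrow> complex" where
  "E3 b = exp (- complex_of_real (ln 2) + (\<Sum>n. fourier b (2 * int (Suc n)))
     - 1 / 2 * (\<Sum>n. of_nat (Suc n) * (fourier b (int (Suc n)))\<^sup>2)
     + (\<Sum>n. of_nat (Suc n) * fourier b (- int (Suc n)) * fourier b (int (Suc n))))"

end

theory Submission
  imports Defs "HOL-Computational_Algebra.Formal_Power_Series"
begin

text \<open>
  With \<open>b\<^sub>n = [log a]\<^sub>n\<close>, split \<open>log a = b\<^sub>0 + \<mu> + \<beta>\<close>, where \<open>\<beta>\<close> is even with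
  \<open>[\<beta>]\<^sub>n = b\<^sub>n\<close> for \<open>n > 0\<close>, and \<open>\<mu>\<close> has only negative frequencies. Uniqueness
  of the factorization gives \<open>a\<^sub>-\<close> \<open>= exp \<mu>\<close> and \<open>a\<^sub>0 = G[a] exp \<beta>\<close>. Write \<open>M(f) = T(f) \<plusminus> H(f t\<^sup>\<kappa>)\<close>
  with \<open>\<kappa> \<in> {-1, 0, 1}\<close>. Then \<open>M(f g) = T(f) M(g)\<close> if \<open>f\<close> has no positive frequencies and
  \<open>M(f g) = M(f) M(g)\<close> if \<open>g\<close> is even, so that \<open>V = M(exp (-\<beta>)) T(exp (-\<mu>))\<close> inverts
  \<open>A = M(exp (\<mu> + \<beta>))\<close>.

  Up to the factor \<open>G[a]\<close>, the matrix \<open>T(a) \<plusminus> H(a t\<^sup>\<kappa>\<^sup>-\<^sup>2\<^sup>l)\<close> is \<open>A\<close> with its first \<open>l\<close> rows and columns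
  removed. By Jacobi's identity for complementary minors its section of size \<open>N\<close> has the determinant
  of the section of \<open>A\<close> of size \<open>N + l\<close> times the upper-left \<open>l \<times> l\<close> minor of the inverse of that section.
  The latter minor tends to that of \<open>V\<close>, which is the one of \<open>M(exp (-\<beta>))\<close> because
  \<open>T(exp (-\<mu>))\<close> is unit upper triangular.

  For the determinants of the sections of \<open>A\<close> one deforms \<open>\<beta>\<close> to \<open>s \<beta>\<close>. The logarithmic derivative in \<open>s\<close>
  is the trace of the section of \<open>M(\<beta>)\<close> plus a correction from the truncation; the
  factorization \<open>A = T(exp (s b)) B T(exp (\<mu> + s b~))\<close> with triangular outer factors, where \<open>b\<close> is the part
  of \<open>\<beta>\<close> with positive frequencies, \<open>b~\<close> its reflection and \<open>B - 1\<close> is Hilbert-Schmidt,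
  shows that the correction converges uniformly in \<open>s\<close> to an affine function of \<open>s\<close>.
\<close>

section \<open>The Wiener algebra\<close>

text \<open>Trace class operators never appear. Besides integrability, the Besov condition enters
  only through two properties of the coefficients: they are absolutely summable, and n times the
  n-th one stays bounded. Together these make Hankel matrices Hilbert-Schmidt. Only traces of
  products of two Hilbert-Schmidt matrices have to be estimated, since the trace of the section of
  \<open>M \<beta>\<close> is an explicit partial sum. The obstacle is that the sections of
  \<open>A\<close> are not close to the identity and must be controlled for all \<open>s\<close> at
  once. Triangular factors can be cut off exactly, so only the middle factor is inverted
  approximately; entrywise majorants free of \<open>s\<close> give the uniformity. The affine limit
  \<open>g0 + s g1\<close> integrates to \<open>g0 + g1 / 2\<close>. As the coefficients of
  \<open>\<mu>\<close> are [log a]_{-n} - [log a]_n, the squares get the weight -1 + 1/2, which is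
  the -1/2 in the constants. The term - log 2 stems from the first column for
  \<open>\<kappa> = 1\<close>, which is twice as large in T + H as in \<open>M\<close>.\<close>

typedef wiener = "{f :: int \<Rightarrow> complex. (\<lambda>n. norm (f n)) summable_on UNIV}"
  morphisms coef Abs_wiener
  by (rule exI[of _ "\<lambda>_. 0"]) simp

setup_lifting type_definition_wiener

lemma wiener_eqI: "(\<And>n. coef f n = coef g n) \<Longrightarrow> f = g"
  by (metis coef_inject ext)

lemma coef_summable: "(\<lambda>n. norm (coef f n)) summable_on UNIV"
  using coef[of f] by simp

text \<open>The shear \<open>(k, n) \<mapsto> (n + k, k)\<close> turns the double series of a
  convolution into the product of two absolutely convergent series.\<close>

lemma conv_summable2:
  fixes f g :: "int \<Rightarrow> complex"
  assumes "(\<lambda>n. norm (f n)) summable_on UNIV" "(\<lambda>n. norm (g n)) summable_on UNIV"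
  shows "(\<lambda>(n, k). norm (f (n - k) * g k)) summable_on UNIV"
    and "(\<Sum>\<^sub>\<infinity>(n, k). norm (f (n - k) * g k)) = (\<Sum>\<^sub>\<infinity>n. norm (f n)) * (\<Sum>\<^sub>\<infinity>n. norm (g n))"
proof -
  let ?h = "\<lambda>(k, n). norm (f n) * norm (g k)"
  have hs: "((\<lambda>n. norm (f n) * norm (g k)) has_sum ((\<Sum>\<^sub>\<infinity>n. norm (f n)) * norm (g k))) UNIV" for k
    by (intro has_sum_cmult_left has_sum_infsum assms)
  have gs: "((\<lambda>k. (\<Sum>\<^sub>\<infinity>n. norm (f n)) * norm (g k)) has_sum
      ((\<Sum>\<^sub>\<infinity>n. norm (f n)) * (\<Sum>\<^sub>\<infinity>n. norm (g n)))) UNIV"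
    by (intro has_sum_cmult_right has_sum_infsum assms)
  have sm: "?h summable_on UNIV \<times> UNIV"
    by (rule summable_on_SigmaI[where g = "\<lambda>k. (\<Sum>\<^sub>\<infinity>n. norm (f n)) * norm (g k)"])
       (use hs gs in \<open>auto simp: summable_on_def\<close>)
  have "(?h has_sum ((\<Sum>\<^sub>\<infinity>n. norm (f n)) * (\<Sum>\<^sub>\<infinity>n. norm (g n)))) (UNIV \<times> UNIV)"
    by (rule has_sum_SigmaI[OF _ gs sm]) (use hs in auto)
  moreover have "(?h has_sum s) (UNIV \<times> UNIV) \<longleftrightarrow>
      ((\<lambda>(n, k). norm (f (n - k) * g k)) has_sum s) UNIV" for s
    by (rule has_sum_reindex_bij_witness[where j = "\<lambda>(k, n). (n + k, k)" and i = "\<lambda>(n, k). (k, n - k)"])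
       (auto simp: norm_mult)
  ultimately have "((\<lambda>(n, k). norm (f (n - k) * g k)) has_sum
      ((\<Sum>\<^sub>\<infinity>n. norm (f n)) * (\<Sum>\<^sub>\<infinity>n. norm (g n)))) UNIV" by blast
  then show "(\<lambda>(n, k). norm (f (n - k) * g k)) summable_on UNIV"
    and "(\<Sum>\<^sub>\<infinity>(n, k). norm (f (n - k) * g k)) = (\<Sum>\<^sub>\<infinity>n. norm (f n)) * (\<Sum>\<^sub>\<infinity>n. norm (g n))"
    by (auto simp: summable_on_def intro: infsumI)
qed

lemma conv_summable1:
  fixes f g :: "int \<Rightarrow> complex"
  assumes "(\<lambda>n. norm (f n)) summable_on UNIV" "(\<lambda>n. norm (g n)) summable_on UNIV"
  shows "(\<lambda>k. norm (f (n - k) * g k)) summable_on UNIV"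
  using summable_on_SigmaD1[of "\<lambda>n k. norm (f (n - k) * g k)" UNIV "\<lambda>_. UNIV" n]
    conv_summable2(1)[OF assms] by simp

lemma conv_norm:
  fixes f g :: "int \<Rightarrow> complex"
  assumes "(\<lambda>n. norm (f n)) summable_on UNIV" "(\<lambda>n. norm (g n)) summable_on UNIV"
  shows "(\<lambda>n. norm (\<Sum>\<^sub>\<infinity>k. f (n - k) * g k)) summable_on UNIV"
    and "(\<Sum>\<^sub>\<infinity>n. norm (\<Sum>\<^sub>\<infinity>k. f (n - k) * g k)) \<le> (\<Sum>\<^sub>\<infinity>n. norm (f n)) * (\<Sum>\<^sub>\<infinity>n. norm (g n))"
proof -
  let ?h = "\<lambda>n k. norm (f (n - k) * g k)"
  have le: "norm (\<Sum>\<^sub>\<infinity>k. f (n - k) * g k) \<le> (\<Sum>\<^sub>\<infinity>k. ?h n k)" for n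
    by (rule norm_infsum_bound, rule conv_summable1[OF assms])
  have s: "(\<lambda>n. \<Sum>\<^sub>\<infinity>k. ?h n k) summable_on UNIV"
    using summable_on_Sigma_banach[of ?h UNIV "\<lambda>_. UNIV"] conv_summable2(1)[OF assms] by simp
  show 1: "(\<lambda>n. norm (\<Sum>\<^sub>\<infinity>k. f (n - k) * g k)) summable_on UNIV"
    by (rule Infinite_Sum.abs_summable_on_comparison_test'[OF s]) (rule le)
  have "(\<Sum>\<^sub>\<infinity>n. norm (\<Sum>\<^sub>\<infinity>k. f (n - k) * g k)) \<le> (\<Sum>\<^sub>\<infinity>n. \<Sum>\<^sub>\<infinity>k. ?h n k)"
    by (rule infsum_mono[OF 1 s le])
  also have "\<dots> = (\<Sum>\<^sub>\<infinity>(n, k). ?h n k)"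
    using infsum_Sigma'_banach[of ?h UNIV "\<lambda>_. UNIV"] conv_summable2(1)[OF assms] by simp
  finally show "(\<Sum>\<^sub>\<infinity>n. norm (\<Sum>\<^sub>\<infinity>k. f (n - k) * g k)) \<le> (\<Sum>\<^sub>\<infinity>n. norm (f n)) * (\<Sum>\<^sub>\<infinity>n. norm (g n))"
    by (simp add: conv_summable2(2)[OF assms])
qed

instantiation wiener :: real_normed_vector
begin

lift_definition zero_wiener :: wiener is "\<lambda>_. 0" by simp

lift_definition plus_wiener :: "wiener \<Rightarrow> wiener \<Rightarrow> wiener" is "\<lambda>f g n. f n + g n"
proof -
  fix f g :: "int \<Rightarrow> complex"
  assume *: "(\<lambda>n. norm (f n)) summable_on UNIV" "(\<lambda>n. norm (g n)) summable_on UNIV"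
  show "(\<lambda>n. norm (f n + g n)) summable_on UNIV"
    by (rule Infinite_Sum.abs_summable_on_comparison_test'[OF summable_on_add[OF *]])
       (rule norm_triangle_ineq)
qed

lift_definition uminus_wiener :: "wiener \<Rightarrow> wiener" is "\<lambda>f n. - f n" by simp

lift_definition minus_wiener :: "wiener \<Rightarrow> wiener \<Rightarrow> wiener" is "\<lambda>f g n. f n - g n"
proof -
  fix f g :: "int \<Rightarrow> complex"
  assume *: "(\<lambda>n. norm (f n)) summable_on UNIV" "(\<lambda>n. norm (g n)) summable_on UNIV"
  show "(\<lambda>n. norm (f n - g n)) summable_on UNIV"
    by (rule Infinite_Sum.abs_summable_on_comparison_test'[OF summable_on_add[OF *]])
       (rule norm_triangle_ineq4)
qed

lift_definition scaleR_wiener :: "real \<Rightarrow> wiener \<Rightarrow> wiener" is "\<lambda>r f n. r *\<^sub>R f n"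
  by (auto intro: summable_on_cmult_right)

lift_definition norm_wiener :: "wiener \<Rightarrow> real" is "\<lambda>f. \<Sum>\<^sub>\<infinity>n. norm (f n)" .

definition dist_wiener :: "wiener \<Rightarrow> wiener \<Rightarrow> real" where
  "dist_wiener f g = norm (f - g)"

definition sgn_wiener :: "wiener \<Rightarrow> wiener" where
  "sgn_wiener f = inverse (norm f) *\<^sub>R f"

definition uniformity_wiener :: "(wiener \<times> wiener) filter" where
  "uniformity_wiener = (INF e\<in>{0<..}. principal {(x, y). dist x y < e})"

definition open_wiener :: "wiener set \<Rightarrow> bool" where
  "open_wiener U \<longleftrightarrow> (\<forall>x\<in>U. \<forall>\<^sub>F (x', y) in uniformity. x' = x \<longrightarrow> y \<in> U)"

instance
proof
  fix f g h :: wiener and r s :: real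
  show "f + g + h = f + (g + h)" "f + g = g + f" "0 + f = f" "- f + f = 0" "f - g = f + - g"
    "r *\<^sub>R (f + g) = r *\<^sub>R f + r *\<^sub>R g" "(r + s) *\<^sub>R f = r *\<^sub>R f + s *\<^sub>R f"
    "r *\<^sub>R s *\<^sub>R f = (r * s) *\<^sub>R f" "1 *\<^sub>R f = f"
    by (transfer, simp add: algebra_simps)+
  show "dist f g = norm (f - g)" by (fact dist_wiener_def)
  show "sgn f = inverse (norm f) *\<^sub>R f" by (fact sgn_wiener_def)
  show "uniformity = (INF e\<in>{0<..}. principal {(x::wiener, y). dist x y < e})"
    by (fact uniformity_wiener_def)
  show "open U \<longleftrightarrow> (\<forall>x\<in>U. \<forall>\<^sub>F (x', y) in uniformity. x' = x \<longrightarrow> y \<in> U)" for U :: "wiener set"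
    by (fact open_wiener_def)
  show "norm f = 0 \<longleftrightarrow> f = 0"
  proof transfer
    fix f :: "int \<Rightarrow> complex" assume *: "(\<lambda>n. norm (f n)) summable_on UNIV"
    have "norm (f n) = 0" if "(\<Sum>\<^sub>\<infinity>n. norm (f n)) = 0" for n
      by (rule nonneg_infsum_le_0D[OF _ *]) (use that in auto)
    then show "(\<Sum>\<^sub>\<infinity>n. norm (f n)) = 0 \<longleftrightarrow> f = (\<lambda>_. 0)"
      by (metis (no_types, lifting) ext infsum_0 norm_eq_zero)
  qed
  show "norm (f + g) \<le> norm f + norm g"
  proof transfer
    fix f g :: "int \<Rightarrow> complex"
    assume *: "(\<lambda>n. norm (f n)) summable_on UNIV" "(\<lambda>n. norm (g n)) summable_on UNIV"
    have "(\<Sum>\<^sub>\<infinity>n. norm (f n + g n)) \<le> (\<Sum>\<^sub>\<infinity>n. norm (f n) + norm (g n))"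
      by (rule infsum_mono[OF Infinite_Sum.abs_summable_on_comparison_test'[OF summable_on_add[OF *]]
            summable_on_add[OF *]]) (rule norm_triangle_ineq)+
    also have "\<dots> = (\<Sum>\<^sub>\<infinity>n. norm (f n)) + (\<Sum>\<^sub>\<infinity>n. norm (g n))"
      by (rule infsum_add[OF *])
    finally show "(\<Sum>\<^sub>\<infinity>n. norm (f n + g n)) \<le> (\<Sum>\<^sub>\<infinity>n. norm (f n)) + (\<Sum>\<^sub>\<infinity>n. norm (g n))" .
  qed
  show "norm (r *\<^sub>R f) = \<bar>r\<bar> * norm f"
    by transfer (simp only: norm_scaleR infsum_cmult_right')
qed

end

instantiation wiener :: comm_ring_1
begin

lift_definition one_wiener :: wiener is "\<lambda>n. if n = 0 then 1 else 0"
  by (rule finite_nonzero_values_imp_summable_on, rule finite_subset[of _ "{0}"]) auto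

lift_definition times_wiener :: "wiener \<Rightarrow> wiener \<Rightarrow> wiener" is
  "\<lambda>f g n. \<Sum>\<^sub>\<infinity>k. f (n - k) * g k"
  by (rule conv_norm(1))

instance
proof
  fix f g h :: wiener
  show "f * g * h = f * (g * h)"
  proof (transfer, rule ext)
    fix f g h :: "int \<Rightarrow> complex" and n :: int
    assume f: "(\<lambda>n. norm (f n)) summable_on UNIV" and g: "(\<lambda>n. norm (g n)) summable_on UNIV"
      and h: "(\<lambda>n. norm (h n)) summable_on UNIV"
    \<comment> \<open>Boundedness of \<open>f\<close> reduces the summability of the threefold
      product to that of \<open>g\<close> and \<open>h\<close>, which permits the exchange of the
      two sums.\<close>
    have bd: "norm (f m) \<le> (\<Sum>\<^sub>\<infinity>n. norm (f n))" for m
      using finite_sum_le_infsum[of "\<lambda>n. norm (f n)" UNIV "{m}"] f by simp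
    have "(\<lambda>p. (\<Sum>\<^sub>\<infinity>n. norm (f n)) * (case p of (k, j) \<Rightarrow> norm (g (k - j) * h j))) summable_on UNIV"
      by (rule summable_on_cmult_right[OF conv_summable2(1)[OF g h]])
    then have "(\<lambda>p. norm (case p of (k, j) \<Rightarrow> f (n - k) * (g (k - j) * h j))) summable_on UNIV"
    proof (rule Infinite_Sum.abs_summable_on_comparison_test')
      fix p :: "int \<times> int"
      obtain k j where p: "p = (k, j)" by (cases p)
      show "norm (case p of (k, j) \<Rightarrow> f (n - k) * (g (k - j) * h j))
          \<le> (\<Sum>\<^sub>\<infinity>n. norm (f n)) * (case p of (k, j) \<Rightarrow> norm (g (k - j) * h j))"
        unfolding p prod.case norm_mult[of "f _"] by (rule mult_right_mono[OF bd norm_ge_zero])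
    qed
    then have s: "(\<lambda>(k, j). f (n - k) * (g (k - j) * h j)) summable_on UNIV \<times> UNIV"
      using abs_summable_summable by auto
    have "(\<Sum>\<^sub>\<infinity>k. f (n - k) * (\<Sum>\<^sub>\<infinity>j. g (k - j) * h j)) = (\<Sum>\<^sub>\<infinity>k. \<Sum>\<^sub>\<infinity>j. f (n - k) * (g (k - j) * h j))"
      by (simp add: infsum_cmult_right')
    also have "\<dots> = (\<Sum>\<^sub>\<infinity>j. \<Sum>\<^sub>\<infinity>k. f (n - k) * (g (k - j) * h j))"
      by (rule infsum_swap_banach[OF s])
    also have "\<dots> = (\<Sum>\<^sub>\<infinity>j. \<Sum>\<^sub>\<infinity>k. f (n - j - k) * g k * h j)"
    proof (rule infsum_cong)
      fix j :: int
      show "(\<Sum>\<^sub>\<infinity>k. f (n - k) * (g (k - j) * h j)) = (\<Sum>\<^sub>\<infinity>k. f (n - j - k) * g k * h j)"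
        by (rule infsum_reindex_bij_witness[where j = "\<lambda>k. k - j" and i = "\<lambda>k. k + j"])
           (auto simp: algebra_simps)
    qed
    also have "\<dots> = (\<Sum>\<^sub>\<infinity>j. (\<Sum>\<^sub>\<infinity>k. f (n - j - k) * g k) * h j)"
      by (simp add: infsum_cmult_left')
    finally show "(\<Sum>\<^sub>\<infinity>j. (\<Sum>\<^sub>\<infinity>k. f (n - j - k) * g k) * h j) = (\<Sum>\<^sub>\<infinity>k. f (n - k) * (\<Sum>\<^sub>\<infinity>j. g (k - j) * h j))"
      by simp
  qed
  show "f * g = g * f"
  proof (transfer, rule ext)
    fix f g :: "int \<Rightarrow> complex" and n :: int
    show "(\<Sum>\<^sub>\<infinity>k. f (n - k) * g k) = (\<Sum>\<^sub>\<infinity>k. g (n - k) * f k)"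
      by (rule infsum_reindex_bij_witness[where j = "\<lambda>k. n - k" and i = "\<lambda>k. n - k"]) auto
  qed
  show "1 * f = f"
  proof (transfer, rule ext)
    fix f :: "int \<Rightarrow> complex" and n :: int
    have "(\<Sum>\<^sub>\<infinity>k. (if n - k = 0 then 1 else 0) * f k) = (\<Sum>\<^sub>\<infinity>k\<in>{n}. f k)"
      by (rule infsum_cong_neutral) auto
    then show "(\<Sum>\<^sub>\<infinity>k. (if n - k = 0 then 1 else 0) * f k) = f n" by simp
  qed
  show "(f + g) * h = f * h + g * h"
  proof (transfer, rule ext)
    fix f g h :: "int \<Rightarrow> complex" and n :: int
    assume f: "(\<lambda>n. norm (f n)) summable_on UNIV" and g: "(\<lambda>n. norm (g n)) summable_on UNIV"
      and h: "(\<lambda>n. norm (h n)) summable_on UNIV"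
    show "(\<Sum>\<^sub>\<infinity>k. (f (n - k) + g (n - k)) * h k) = (\<Sum>\<^sub>\<infinity>k. f (n - k) * h k) + (\<Sum>\<^sub>\<infinity>k. g (n - k) * h k)"
      unfolding distrib_right
      by (rule infsum_add[OF abs_summable_summable[OF conv_summable1[OF f h]]
            abs_summable_summable[OF conv_summable1[OF g h]]])
  qed
  show "(0::wiener) \<noteq> 1" by transfer (auto dest: fun_cong[of _ _ 0])
qed

end

lemma coef_simps [simp]:
  "coef 0 n = 0" "coef (f + g) n = coef f n + coef g n" "coef (f - g) n = coef f n - coef g n"
  "coef (- f) n = - coef f n" "coef (r *\<^sub>R f) n = r *\<^sub>R coef f n"
  "coef 1 n = (if n = 0 then 1 else 0)"
  by (simp_all add: zero_wiener.rep_eq plus_wiener.rep_eq minus_wiener.rep_eq uminus_wiener.rep_eq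
      scaleR_wiener.rep_eq one_wiener.rep_eq)

lemma coef_mult: "coef (f * g) n = (\<Sum>\<^sub>\<infinity>k. coef f (n - k) * coef g k)"
  by transfer simp

lemma coef_mult_summable: "(\<lambda>k. norm (coef f (n - k) * coef g k)) summable_on UNIV"
  by (rule conv_summable1[OF coef_summable coef_summable])

lemma norm_wiener: "norm f = (\<Sum>\<^sub>\<infinity>n. norm (coef f n))"
  by transfer simp

instance wiener :: real_normed_algebra_1
proof
  fix f g :: wiener and r :: real
  show "r *\<^sub>R f * g = r *\<^sub>R (f * g)"
    by (rule wiener_eqI) (simp add: coef_mult infsum_scaleR_right)
  show "f * r *\<^sub>R g = r *\<^sub>R (f * g)"
    by (rule wiener_eqI) (simp add: coef_mult infsum_scaleR_right)
  show "norm (f * g) \<le> norm f * norm g"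
    by transfer (rule conv_norm(2))
  have "(\<Sum>\<^sub>\<infinity>n. norm (coef 1 n)) = (\<Sum>\<^sub>\<infinity>n\<in>{0::int}. 1 :: real)"
    by (rule infsum_cong_neutral) auto
  then show "norm (1::wiener) = 1"
    by (simp add: norm_wiener)
qed

lemma norm_wiener_leI:
  assumes "\<And>S. finite S \<Longrightarrow> (\<Sum>n\<in>S. norm (f n)) \<le> e"
  shows "(\<lambda>n. norm (f n)) summable_on (UNIV :: int set)" "(\<Sum>\<^sub>\<infinity>n. norm (f n)) \<le> e"
proof -
  show "(\<lambda>n. norm (f n)) summable_on (UNIV :: int set)"
    using assms by (intro nonneg_bdd_above_summable_on bdd_aboveI2[where M = e]) auto
  then show "(\<Sum>\<^sub>\<infinity>n. norm (f n)) \<le> e"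
    by (rule infsum_le_finite_sums) (use assms in auto)
qed

lemma norm_coef_le: "norm (coef f n) \<le> norm f"
  using finite_sum_le_infsum[of "\<lambda>n. norm (coef f n)" UNIV "{n}"] coef_summable
  by (simp add: norm_wiener)

lemma sum_norm_coef_le: "finite S \<Longrightarrow> (\<Sum>n\<in>S. norm (coef f n)) \<le> norm f"
  using finite_sum_le_infsum[of "\<lambda>n. norm (coef f n)" UNIV S] coef_summable
  by (simp add: norm_wiener)

lemma bounded_linear_coef: "bounded_linear (\<lambda>f. coef f n)"
  by (rule bounded_linear_intro[where K = 1]) (auto intro: norm_coef_le)

text \<open>Completeness is what makes the exponential of a symbol available inside the
  algebra.\<close>

instance wiener :: banach
proof
  fix X :: "nat \<Rightarrow> wiener" assume X: "Cauchy X"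
  have "Cauchy (\<lambda>m. coef (X m) n)" for n
    by (rule bounded_linear.Cauchy[OF bounded_linear_coef X])
  then have "\<exists>l. (\<lambda>m. coef (X m) n) \<longlonglongrightarrow> l" for n
    unfolding Cauchy_convergent_iff convergent_def .
  then obtain L where L: "\<And>n. (\<lambda>m. coef (X m) n) \<longlonglongrightarrow> L n" by metis
  \<comment> \<open>The Cauchy estimate restricted to a finite set of frequencies survives the
    coefficientwise limit; as the set is arbitrary, it is an estimate of the norm.\<close>
  have key: "(\<Sum>n\<in>S. norm (L n - coef (X m) n)) \<le> e"
    if M: "\<And>m k. m \<ge> M \<Longrightarrow> k \<ge> M \<Longrightarrow> norm (X m - X k) < e" and "m \<ge> M" "finite S" for M m e S
  proof (rule LIMSEQ_le_const2)
    show "(\<lambda>k. \<Sum>n\<in>S. norm (coef (X k) n - coef (X m) n)) \<longlonglongrightarrow> (\<Sum>n\<in>S. norm (L n - coef (X m) n))"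
      by (intro tendsto_intros L)
    have "(\<Sum>n\<in>S. norm (coef (X k) n - coef (X m) n)) \<le> e" if "k \<ge> M" for k
      using sum_norm_coef_le[OF \<open>finite S\<close>, of "X k - X m"] M[of k m] that \<open>m \<ge> M\<close> by simp
    then show "\<exists>N. \<forall>k\<ge>N. (\<Sum>n\<in>S. norm (coef (X k) n - coef (X m) n)) \<le> e" by blast
  qed
  obtain M where M: "\<And>m k. m \<ge> M \<Longrightarrow> k \<ge> M \<Longrightarrow> norm (X m - X k) < 1"
    using CauchyD[OF X, of 1] by auto
  have "(\<lambda>n. norm (L n - coef (X M) n)) summable_on UNIV"
    by (rule norm_wiener_leI(1)[of _ 1]) (rule key[OF M order_refl])
  from summable_on_add[OF this coef_summable[of "X M"]]
  have "(\<lambda>n. norm ((L n - coef (X M) n) + coef (X M) n)) summable_on UNIV"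
    by (rule Infinite_Sum.abs_summable_on_comparison_test') (rule norm_triangle_ineq)
  then have Ls: "L \<in> {f. (\<lambda>n. norm (f n)) summable_on UNIV}" by simp
  have cL: "coef (Abs_wiener L) = L" by (rule Abs_wiener_inverse[OF Ls])
  have "X \<longlonglongrightarrow> Abs_wiener L"
  proof (rule LIMSEQ_I)
    fix e :: real assume "e > 0"
    then obtain M where M: "\<And>m k. m \<ge> M \<Longrightarrow> k \<ge> M \<Longrightarrow> norm (X m - X k) < e / 2"
      using CauchyD[OF X, of "e / 2"] by auto
    have "norm (X m - Abs_wiener L) < e" if "m \<ge> M" for m
    proof -
      have "norm (X m - Abs_wiener L) \<le> e / 2"
        unfolding norm_wiener coef_simps cL norm_minus_commute[of "coef (X m) _"]
        by (rule norm_wiener_leI) (use key[OF M that] in auto)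
      then show ?thesis using \<open>e > 0\<close> by simp
    qed
    then show "\<exists>no. \<forall>n\<ge>no. norm (X n - Abs_wiener L) < e" by blast
  qed
  then show "convergent X" by (rule convergentI)
qed

text \<open>A continuous unital homomorphism acts termwise on the exponential series. It is applied
  to the reflection \<open>wtilde\<close> and to the evaluation \<open>wev\<close> at a point of the
  circle.\<close>

lemma exp_hom:
  fixes h :: "'a :: {real_normed_algebra_1, banach} \<Rightarrow> 'b :: {real_normed_algebra_1, banach}"
  assumes "bounded_linear h" and one: "h 1 = 1" and mult: "\<And>x y. h (x * y) = h x * h y"
  shows "h (exp x) = exp (h x)"
proof -
  interpret bounded_linear h by fact
  have pow: "h (x ^ n) = h x ^ n" for n
    by (induction n) (simp_all add: one mult)
  have "(\<lambda>n. h (x ^ n /\<^sub>R fact n)) sums h (exp x)"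
    by (rule sums, rule exp_converges)
  then have "(\<lambda>n. h x ^ n /\<^sub>R fact n) sums h (exp x)"
    by (simp add: scaleR pow)
  then show ?thesis using exp_converges[of "h x"] sums_unique2 by blast
qed

lemma exp_minus_mult [simp]: "exp (- x) * exp x = 1"
  for x :: "'a :: {real_normed_algebra_1, banach, comm_ring_1}"
  using exp_add_commuting[of "-x" x] by simp

lemma exp_mult_minus [simp]: "exp x * exp (- x) = 1"
  for x :: "'a :: {real_normed_algebra_1, banach, comm_ring_1}"
  using exp_add_commuting[of x "-x"] by simp

lemma exp_add': "exp (x + y) = exp x * exp y"
  for x y :: "'a :: {real_normed_algebra_1, banach, comm_ring_1}"
  by (rule exp_add_commuting) (rule mult.commute)

section \<open>Reflection, majorants and decay of coefficients\<close>

lift_definition wtilde :: "wiener \<Rightarrow> wiener" is "\<lambda>f n. f (- n)"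
proof -
  fix f :: "int \<Rightarrow> complex" assume "(\<lambda>n. norm (f n)) summable_on UNIV"
  moreover have "(\<lambda>n. norm (f n)) summable_on UNIV \<longleftrightarrow> (\<lambda>n. norm (f (- n))) summable_on UNIV"
    by (rule summable_on_reindex_bij_witness[where i = uminus and j = uminus]) auto
  ultimately show "(\<lambda>n. norm (f (- n))) summable_on UNIV" by blast
qed

lift_definition wabs :: "wiener \<Rightarrow> wiener" is "\<lambda>f n. complex_of_real (norm (f n))"
  by simp

lift_definition wrestrict :: "int set \<Rightarrow> wiener \<Rightarrow> wiener" is "\<lambda>A f n. if n \<in> A then f n else 0"
proof -
  fix A and f :: "int \<Rightarrow> complex" assume *: "(\<lambda>n. norm (f n)) summable_on UNIV"
  show "(\<lambda>n. norm (if n \<in> A then f n else 0)) summable_on UNIV"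
    by (rule Infinite_Sum.abs_summable_on_comparison_test'[OF *]) auto
qed

lemma coef_wtilde [simp]: "coef (wtilde f) n = coef f (- n)"
  and coef_wabs [simp]: "coef (wabs f) n = complex_of_real (norm (coef f n))"
  and coef_wrestrict [simp]: "coef (wrestrict A f) n = (if n \<in> A then coef f n else 0)"
  by (simp_all add: wtilde.rep_eq wabs.rep_eq wrestrict.rep_eq)

lemma wtilde_simps [simp]:
  "wtilde 1 = 1" "wtilde (f + g) = wtilde f + wtilde g" "wtilde (- f) = - wtilde f"
  "wtilde (wtilde f) = f" "wtilde (r *\<^sub>R f) = r *\<^sub>R wtilde f"
  by (rule wiener_eqI; simp)+

lemma wtilde_mult [simp]: "wtilde (f * g) = wtilde f * wtilde g"
proof (rule wiener_eqI)
  fix n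
  show "coef (wtilde (f * g)) n = coef (wtilde f * wtilde g) n"
    unfolding coef_mult coef_wtilde
    by (rule infsum_reindex_bij_witness[where i = uminus and j = uminus]) auto
qed

lemma norm_wtilde [simp]: "norm (wtilde f) = norm f"
  unfolding norm_wiener coef_wtilde
  by (rule infsum_reindex_bij_witness[where i = uminus and j = uminus]) auto

lemma wtilde_exp [simp]: "wtilde (exp f) = exp (wtilde f)"
  by (rule exp_hom) (auto intro!: bounded_linear_intro[where K = 1])

lemma coef_exp_sums: "(\<lambda>m. coef (f ^ m) n /\<^sub>R fact m) sums coef (exp f) n"
  using bounded_linear.sums[OF bounded_linear_coef[of n] exp_converges[of f]] by simp

text \<open>Majorants provide the bounds that are uniform along the deformation.\<close>

definition wdom :: "wiener \<Rightarrow> wiener \<Rightarrow> bool" where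
  "wdom f g \<longleftrightarrow> (\<forall>n. coef g n = complex_of_real (Re (coef g n)) \<and> norm (coef f n) \<le> Re (coef g n))"

lemma wdomD: "wdom f g \<Longrightarrow> norm (coef f n) \<le> Re (coef g n)"
  "wdom f g \<Longrightarrow> coef g n = complex_of_real (Re (coef g n))"
  by (auto simp: wdom_def)

lemma wdom_one: "wdom 1 1"
  by (simp add: wdom_def)

lemma wdom_mult:
  assumes "wdom f f'" "wdom g g'"
  shows "wdom (f * g) (f' * g')"
  unfolding wdom_def
proof (intro allI conjI)
  fix n
  let ?a = "\<lambda>k. Re (coef f' (n - k)) * Re (coef g' k)"
  have eq: "coef f' (n - k) * coef g' k = complex_of_real (?a k)" for k
    using assms by (metis of_real_mult wdomD(2))
  have nn: "0 \<le> Re (coef f' k)" "0 \<le> Re (coef g' k)" for k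
    using assms by (meson norm_ge_zero order_trans wdomD(1))+
  have "(\<lambda>k. norm (complex_of_real (?a k))) summable_on UNIV"
    unfolding eq[symmetric] by (rule coef_mult_summable)
  then have s: "?a summable_on UNIV"
    using nn by (simp add: abs_mult del: of_real_mult)
  have "((\<lambda>k. complex_of_real (?a k)) has_sum complex_of_real (infsum ?a UNIV)) UNIV"
    by (rule has_sum_of_real[OF has_sum_infsum[OF s]])
  then have c: "coef (f' * g') n = complex_of_real (infsum ?a UNIV)"
    unfolding coef_mult eq by (rule infsumI)
  then show "coef (f' * g') n = complex_of_real (Re (coef (f' * g') n))" by simp
  have "norm (coef (f * g) n) \<le> (\<Sum>\<^sub>\<infinity>k. norm (coef f (n - k) * coef g k))"
    unfolding coef_mult by (rule norm_infsum_bound[OF coef_mult_summable])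
  also have "\<dots> \<le> infsum ?a UNIV"
    by (rule infsum_mono[OF coef_mult_summable s])
       (auto simp: norm_mult intro!: mult_mono wdomD assms nn)
  finally show "norm (coef (f * g) n) \<le> Re (coef (f' * g') n)" by (simp add: c)
qed

lemma wdom_power: "wdom f f' \<Longrightarrow> wdom (f ^ m) (f' ^ m)"
  by (induction m) (auto intro: wdom_one wdom_mult)

text \<open>The exponential series has positive coefficients, so domination passes from the powers
  to the sum, with the same majorant for every dominated exponent.\<close>

lemma wdom_exp:
  assumes "wdom f f'"
  shows "wdom (exp f) (exp f')"
  unfolding wdom_def
proof (intro allI conjI)
  fix n
  let ?a = "\<lambda>m. Re (coef (f' ^ m) n) / fact m"
  have eq: "coef (f' ^ m) n /\<^sub>R fact m = complex_of_real (?a m)" for m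
    using wdomD(2)[OF wdom_power[OF assms], of m n]
    by (simp add: complex_eq_iff divide_inverse mult.commute
        del: of_real_divide of_real_mult of_real_inverse)
  have Re: "?a sums Re (coef (exp f') n)"
    using sums_Re[OF coef_exp_sums[of f' n]] unfolding eq Re_complex_of_real .
  then have "(\<lambda>m. complex_of_real (?a m)) sums complex_of_real (Re (coef (exp f') n))"
    by (rule sums_of_real)
  then show "coef (exp f') n = complex_of_real (Re (coef (exp f') n))"
    using coef_exp_sums[of f' n] sums_unique2 unfolding eq by blast
  have le: "norm (coef (f ^ m) n /\<^sub>R fact m) \<le> ?a m" for m
    using wdomD(1)[OF wdom_power[OF assms], of m n]
    by (simp add: divide_inverse mult.commute mult_left_mono)
  have s: "summable (\<lambda>m. norm (coef (f ^ m) n /\<^sub>R fact m))"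
    by (rule summable_comparison_test[OF _ sums_summable[OF Re]]) (use le in auto)
  have "norm (coef (exp f) n) \<le> (\<Sum>m. norm (coef (f ^ m) n /\<^sub>R fact m))"
    using summable_norm[OF s] coef_exp_sums[of f n] by (simp add: sums_iff)
  also have "\<dots> \<le> (\<Sum>m. ?a m)"
    by (rule suminf_le[OF le s sums_summable[OF Re]])
  finally show "norm (coef (exp f) n) \<le> Re (coef (exp f') n)"
    using Re by (simp add: sums_iff)
qed

text \<open>The trace of Besov smoothness that is kept: coefficients of size O(1/|n|). With absolute
  summability it makes the sum of |n| times the squared moduli finite, which is the Hilbert-Schmidt
  condition for Hankel matrices, and unlike that sum it is easily propagated through
  products.\<close>

definition wlip :: "wiener \<Rightarrow> bool" where
  "wlip f \<longleftrightarrow> (\<exists>C. \<forall>n. real_of_int \<bar>n\<bar> * norm (coef f n) \<le> C)"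

text \<open>A Leibniz rule for coefficients, from |n| \<le> |n - k| + |k|.\<close>

lemma wlip_mult_bound:
  assumes "\<And>n. real_of_int \<bar>n\<bar> * norm (coef f n) \<le> C" "\<And>n. real_of_int \<bar>n\<bar> * norm (coef g n) \<le> D"
  shows "real_of_int \<bar>n\<bar> * norm (coef (f * g) n) \<le> C * norm g + norm f * D"
proof -
  have s1: "(\<lambda>k. C * norm (coef g k)) summable_on UNIV" 
    by (rule summable_on_cmult_right[OF coef_summable])
  have sh: "(\<lambda>k. norm (coef f (n - k))) summable_on UNIV \<longleftrightarrow> (\<lambda>k. norm (coef f k)) summable_on UNIV"
    by (rule summable_on_reindex_bij_witness[where i = "\<lambda>k. n - k" and j = "\<lambda>k. n - k"]) auto
  have sh': "(\<Sum>\<^sub>\<infinity>k. norm (coef f (n - k))) = (\<Sum>\<^sub>\<infinity>k. norm (coef f k))"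
    by (rule infsum_reindex_bij_witness[where i = "\<lambda>k. n - k" and j = "\<lambda>k. n - k"]) auto
  have s2: "(\<lambda>k. norm (coef f (n - k)) * D) summable_on UNIV" 
    using summable_on_cmult_left sh coef_summable by blast
  have le: "real_of_int \<bar>n\<bar> * norm (coef f (n - k) * coef g k)
      \<le> C * norm (coef g k) + norm (coef f (n - k)) * D" for k
  proof -
    have "real_of_int \<bar>n\<bar> * norm (coef f (n - k) * coef g k)
        \<le> (real_of_int \<bar>n - k\<bar> + real_of_int \<bar>k\<bar>) * norm (coef f (n - k) * coef g k)"
      by (rule mult_right_mono) auto
    also have "\<dots> = (real_of_int \<bar>n - k\<bar> * norm (coef f (n - k))) * norm (coef g k) +
        norm (coef f (n - k)) * (real_of_int \<bar>k\<bar> * norm (coef g k))"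
      by (simp add: norm_mult algebra_simps)
    also have "\<dots> \<le> C * norm (coef g k) + norm (coef f (n - k)) * D"
      by (intro add_mono mult_right_mono mult_left_mono assms) auto
    finally show ?thesis .
  qed
  have "real_of_int \<bar>n\<bar> * norm (coef (f * g) n) \<le> real_of_int \<bar>n\<bar> * (\<Sum>\<^sub>\<infinity>k. norm (coef f (n - k) * coef g k))"
    unfolding coef_mult by (intro mult_left_mono norm_infsum_bound[OF coef_mult_summable]) auto
  also have "\<dots> = (\<Sum>\<^sub>\<infinity>k. real_of_int \<bar>n\<bar> * norm (coef f (n - k) * coef g k))"
    by (rule infsum_cmult_right'[symmetric])
  also have "\<dots> \<le> (\<Sum>\<^sub>\<infinity>k. C * norm (coef g k) + norm (coef f (n - k)) * D)"
    by (rule infsum_mono[OF summable_on_cmult_right[OF coef_mult_summable] summable_on_add[OF s1 s2] le])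
  also have "\<dots> = C * norm g + norm f * D"
    unfolding infsum_add[OF s1 s2] norm_wiener
    by (simp add: infsum_cmult_right' infsum_cmult_left' sh')
  finally show ?thesis .
qed

lemma wlip_add: "wlip f \<Longrightarrow> wlip g \<Longrightarrow> wlip (f + g)"
  unfolding wlip_def
proof (elim exE)
  fix C D
  assume *: "\<forall>n. real_of_int \<bar>n\<bar> * norm (coef f n) \<le> C" "\<forall>n. real_of_int \<bar>n\<bar> * norm (coef g n) \<le> D"
  have "real_of_int \<bar>n\<bar> * norm (coef (f + g) n) \<le> C + D" for n
    using mult_left_mono[OF norm_triangle_ineq[of "coef f n" "coef g n"], of "real_of_int \<bar>n\<bar>"] *[THEN spec, of n]
    by (simp add: distrib_left)
  then show "\<exists>C. \<forall>n. real_of_int \<bar>n\<bar> * norm (coef (f + g) n) \<le> C" by blast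
qed

lemma wlip_simps:
  "wlip f \<Longrightarrow> wlip (- f)" "wlip f \<Longrightarrow> wlip (wtilde f)" "wlip f \<Longrightarrow> wlip (wabs f)"
proof -
  show "wlip f \<Longrightarrow> wlip (- f)" "wlip f \<Longrightarrow> wlip (wabs f)" by (simp_all add: wlip_def)
  show "wlip f \<Longrightarrow> wlip (wtilde f)" unfolding wlip_def coef_wtilde by (metis abs_minus_cancel)
qed

lemma wlip_wrestrict: "wlip f \<Longrightarrow> wlip (wrestrict A f)"
  unfolding wlip_def
proof (elim exE)
  fix C assume *: "\<forall>n. real_of_int \<bar>n\<bar> * norm (coef f n) \<le> C"
  from *[THEN spec, of 0] have "0 \<le> C" by simp
  with * have "\<forall>n. real_of_int \<bar>n\<bar> * norm (coef (wrestrict A f) n) \<le> C" by auto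
  then show "\<exists>C. \<forall>n. real_of_int \<bar>n\<bar> * norm (coef (wrestrict A f) n) \<le> C" by blast
qed

lemma wlip_exp:
  assumes "wlip f" shows "wlip (exp f)"
proof -
  obtain C where C: "\<And>n. real_of_int \<bar>n\<bar> * norm (coef f n) \<le> C"
    using assms unfolding wlip_def by blast
  from C[of 0] have C0: "0 \<le> C" by simp
  \<comment> \<open>The Leibniz rule iterated, as for the derivative of a power; division by
    \<open>fact (Suc m)\<close> leaves the terms of \<open>C * exp (norm f)\<close>.\<close>
  have pow: "real_of_int \<bar>n\<bar> * norm (coef (f ^ Suc m) n) \<le> C * real (Suc m) * norm f ^ m" for m n
  proof (induction m arbitrary: n)
    case 0
    then show ?case using C by simp
  next
    case (Suc m)
    have "real_of_int \<bar>n\<bar> * norm (coef (f * f ^ Suc m) n)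
        \<le> C * norm (f ^ Suc m) + norm f * (C * real (Suc m) * norm f ^ m)"
      by (rule wlip_mult_bound[OF C Suc])
    also have "\<dots> \<le> C * norm f ^ Suc m + norm f * (C * real (Suc m) * norm f ^ m)"
      by (intro add_right_mono mult_left_mono norm_power_ineq C0)
    also have "\<dots> = C * real (Suc (Suc m)) * norm f ^ Suc m"
      by (simp add: algebra_simps)
    finally show ?case by simp
  qed
  have "real_of_int \<bar>n\<bar> * norm (coef (exp f) n) \<le> C * exp (norm f)" for n
  proof (cases "n = 0")
    case True
    then show ?thesis using C0 by simp
  next
    case False
    have "(\<lambda>m. coef (f ^ Suc m) n /\<^sub>R fact (Suc m)) sums coef (exp f) n"
      using coef_exp_sums[of f n] False by (subst sums_Suc_iff) simp
    then have S: "(\<lambda>m. real_of_int \<bar>n\<bar> *\<^sub>R (coef (f ^ Suc m) n /\<^sub>R fact (Suc m))) sums (real_of_int \<bar>n\<bar> *\<^sub>R coef (exp f) n)"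
      by (rule sums_scaleR_right)
    have E: "(\<lambda>m. C * (norm f ^ m /\<^sub>R fact m)) sums (C * exp (norm f))"
      by (rule sums_mult[OF exp_converges])
    have le: "norm (real_of_int \<bar>n\<bar> *\<^sub>R (coef (f ^ Suc m) n /\<^sub>R fact (Suc m))) \<le> C * (norm f ^ m /\<^sub>R fact m)" for m
    proof -
      have "norm (real_of_int \<bar>n\<bar> *\<^sub>R (coef (f ^ Suc m) n /\<^sub>R fact (Suc m)))
          = (real_of_int \<bar>n\<bar> * norm (coef (f ^ Suc m) n)) / fact (Suc m)"
        by (simp add: divide_inverse)
      also have "\<dots> \<le> (C * real (Suc m) * norm f ^ m) / fact (Suc m)"
        by (intro divide_right_mono pow) simp
      also have "\<dots> = C * (norm f ^ m /\<^sub>R fact m)"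
        by (simp add: divide_simps)
      finally show ?thesis .
    qed
    have s: "summable (\<lambda>m. norm (real_of_int \<bar>n\<bar> *\<^sub>R (coef (f ^ Suc m) n /\<^sub>R fact (Suc m))))"
      by (rule summable_comparison_test[OF _ sums_summable[OF E]]) (use le in auto)
    have "norm (real_of_int \<bar>n\<bar> *\<^sub>R coef (exp f) n) \<le> C * exp (norm f)"
      using summable_norm[OF s] suminf_le[OF le s sums_summable[OF E]] S E
      by (simp only: sums_iff)
    then show ?thesis by simp
  qed
  then show ?thesis unfolding wlip_def by blast
qed

section \<open>Symbols with one-sided frequencies\<close>

definition wnonpos :: "wiener \<Rightarrow> bool" where "wnonpos f \<longleftrightarrow> (\<forall>n>0. coef f n = 0)"
definition wnonneg :: "wiener \<Rightarrow> bool" where "wnonneg f \<longleftrightarrow> (\<forall>n<0. coef f n = 0)"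

lemma wnonpos_wtilde [simp]: "wnonpos (wtilde f) = wnonneg f" "wnonneg (wtilde f) = wnonpos f"
  unfolding wnonpos_def wnonneg_def coef_wtilde
  by (metis add.inverse_inverse neg_0_less_iff_less neg_less_0_iff_less)+

lemma wnonpos_mult: "wnonpos f \<Longrightarrow> wnonpos g \<Longrightarrow> wnonpos (f * g)"
  unfolding wnonpos_def
proof (intro allI impI)
  fix n :: int assume *: "\<forall>n>0. coef f n = 0" "\<forall>n>0. coef g n = 0" "n > 0"
  have "coef f (n - k) * coef g k = 0" for k
    using * by (cases "k > 0") auto
  then show "coef (f * g) n = 0" unfolding coef_mult by (rule infsum_0)
qed

lemma wnonpos_power: "wnonpos f \<Longrightarrow> wnonpos (f ^ m)"
  by (induction m) (auto simp: wnonpos_mult wnonpos_def[of 1])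

lemma wnonpos_exp: "wnonpos f \<Longrightarrow> wnonpos (exp f)"
  unfolding wnonpos_def[of "exp f"]
proof (intro allI impI)
  fix n :: int assume "wnonpos f" "n > 0"
  then have "coef (f ^ m) n = 0" for m using wnonpos_power[of f m] by (simp add: wnonpos_def)
  then show "coef (exp f) n = 0" using coef_exp_sums[of f n] by (simp add: sums_iff)
qed

lemma wnonneg_exp: "wnonneg f \<Longrightarrow> wnonneg (exp f)"
  using wnonpos_exp[of "wtilde f"] by (simp flip: wtilde_exp)

lemma coef_mult_nonpos:
  assumes "wnonpos f" "wnonpos g"
  shows "coef (f * g) (- int m) = (\<Sum>r\<le>m. coef f (- int r) * coef g (- int (m - r)))"
proof -
  have "coef (f * g) (- int m) = (\<Sum>\<^sub>\<infinity>k. coef f (- int m - k) * coef g k)"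
    by (rule coef_mult)
  also have "\<dots> = (\<Sum>\<^sub>\<infinity>k\<in>{- int m..0}. coef f (- int m - k) * coef g k)"
    using assms by (intro infsum_cong_neutral) (auto simp: wnonpos_def not_le)
  also have "\<dots> = (\<Sum>k\<in>{- int m..0}. coef f (- int m - k) * coef g k)"
    by simp
  also have "\<dots> = (\<Sum>r\<le>m. coef f (- int r) * coef g (- int (m - r)))"
    by (rule sum.reindex_bij_witness[where j = "\<lambda>k. nat (int m + k)" and i = "\<lambda>r. int r - int m"]) auto
  finally show ?thesis .
qed

text \<open>Reads a symbol without positive frequencies as a formal power series in 1/t. On such
  symbols the map is multiplicative, and the formal derivative becomes available for coefficient
  identities.\<close>

definition wfps :: "wiener \<Rightarrow> complex fps" where
  "wfps f = Abs_fps (\<lambda>m. coef f (- int m))"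

lemma wfps_nth [simp]: "fps_nth (wfps f) m = coef f (- int m)"
  by (simp add: wfps_def)

lemma wfps_mult: "wnonpos f \<Longrightarrow> wnonpos g \<Longrightarrow> wfps (f * g) = wfps f * wfps g"
  by (rule fps_ext) (simp add: coef_mult_nonpos fps_mult_nth atLeast0AtMost)

lemma wfps_power: "wnonpos f \<Longrightarrow> wfps (f ^ m) = wfps f ^ m"
proof (induction m)
  case 0
  then show ?case by (auto simp: fps_eq_iff)
qed (simp add: wfps_mult wnonpos_power)

text \<open>On symbols without positive frequencies the constant coefficient is multiplicative. This
  puts ones on the diagonal of triangular Toeplitz matrices.\<close>

lemma coef_exp_nonpos_0:
  assumes "wnonpos \<mu>" "coef \<mu> 0 = 0"
  shows "coef (exp \<mu>) 0 = 1"
proof -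
  have "coef (\<mu> ^ m) 0 = (if m = 0 then 1 else 0)" for m
  proof -
    have "fps_nth (wfps (\<mu> ^ m)) 0 = fps_nth (wfps \<mu>) 0 ^ m"
      unfolding wfps_power[OF assms(1)] by (induction m) auto
    then show ?thesis using assms(2) by (cases m) auto
  qed
  then have "(\<lambda>m. coef (\<mu> ^ m) 0 /\<^sub>R fact m) = (\<lambda>m. if m = 0 then 1 else 0)" by auto
  then have "(\<lambda>m. if m = 0 then 1 else 0) sums coef (exp \<mu>) 0"
    using coef_exp_sums[of \<mu> 0] by simp
  then show ?thesis
    using sums_unique2 sums_single[of 0 "\<lambda>_. 1 :: complex"] by blast
qed

text \<open>The exponential is that of the Banach algebra, so the chain rule is obtained termwise:
  the derivative of the term of degree \<open>j + 1\<close> is the derivative of \<open>f\<close>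
  times the term of degree \<open>j\<close>, and each coefficient is continuous.\<close>

lemma wfps_deriv_exp:
  assumes "wnonpos f"
  shows "fps_deriv (wfps (exp f)) = fps_deriv (wfps f) * wfps (exp f)"
proof (rule fps_ext)
  fix m
  have pow: "fps_deriv (wfps (f ^ Suc j)) = fps_const (of_nat (Suc j)) * (fps_deriv (wfps f) * wfps (f ^ j))" for j
    unfolding wfps_power[OF assms] fps_deriv_power' fps_of_nat[symmetric]
    by (simp add: mult_ac del: of_nat_Suc)
  have "(\<lambda>j. of_nat (m + 1) * (coef (f ^ j) (- int (m + 1)) /\<^sub>R fact j)) sums
      (of_nat (m + 1) * coef (exp f) (- int (m + 1)))"
    by (rule sums_mult[OF coef_exp_sums])
  then have "(\<lambda>j. fps_nth (fps_deriv (wfps (f ^ j))) m /\<^sub>R fact j) sums fps_nth (fps_deriv (wfps (exp f))) m"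
    by (simp add: fps_deriv_nth)
  moreover have "fps_nth (fps_deriv (wfps (f ^ 0))) m = 0" by simp
  ultimately have L: "(\<lambda>j. fps_nth (fps_deriv (wfps (f ^ Suc j))) m /\<^sub>R fact (Suc j)) sums fps_nth (fps_deriv (wfps (exp f))) m"
    by (subst sums_Suc_iff) simp
  have eq: "fps_nth (fps_deriv (wfps (f ^ Suc j))) m /\<^sub>R fact (Suc j) =
      (\<Sum>i\<le>m. fps_nth (fps_deriv (wfps f)) i * (coef (f ^ j) (- int (m - i)) /\<^sub>R fact j))" for j
    unfolding pow fps_mult_left_const_nth
    by (simp add: fps_mult_nth atLeast0AtMost scaleR_sum_right scaleR_conv_of_real sum_distrib_left
        divide_simps del: fps_deriv_nth of_nat_Suc power_Suc)
  have "(\<lambda>j. \<Sum>i\<le>m. fps_nth (fps_deriv (wfps f)) i * (coef (f ^ j) (- int (m - i)) /\<^sub>R fact j)) sums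
      (\<Sum>i\<le>m. fps_nth (fps_deriv (wfps f)) i * coef (exp f) (- int (m - i)))"
    by (intro sums_sum sums_mult coef_exp_sums)
  then have "fps_nth (fps_deriv (wfps (exp f))) m = (\<Sum>i\<le>m. fps_nth (fps_deriv (wfps f)) i * coef (exp f) (- int (m - i)))"
    using L unfolding eq using sums_unique2 by blast
  then show "fps_nth (fps_deriv (wfps (exp f))) m = fps_nth (fps_deriv (wfps f) * wfps (exp f)) m"
    by (simp add: fps_mult_nth atLeast0AtMost)
qed

text \<open>The coefficient of X^m in \<open>exp (- f)\<close> times X (\<open>exp f\<close>)' = X
  f', where X = 1/t. This logarithmic derivative is what the antidiagonals of \<open>Xs\<close> add
  up to.\<close>

lemma exp_log_derivative:
  assumes "wnonpos f"
  shows "(\<Sum>r\<le>m. coef (exp (- f)) (- int r) * (of_nat (m - r) * coef (exp f) (- int (m - r)))) = of_nat m * coef f (- int m)"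
proof -
  have np: "wnonpos (exp f)" "wnonpos (exp (- f))"
    using assms by (intro wnonpos_exp; simp add: wnonpos_def)+
  have 1: "wfps (1 :: wiener) = 1"
    using wfps_power[OF assms, of 0] by simp
  have X: "fps_nth (fps_X * fps_deriv g) j = of_nat j * fps_nth g j" for g :: "complex fps" and j
    by (cases j) auto
  have "wfps (exp (- f)) * (fps_X * fps_deriv (wfps (exp f))) =
      fps_X * fps_deriv (wfps f) * (wfps (exp (- f)) * wfps (exp f))"
    by (simp only: wfps_deriv_exp[OF assms] mult_ac)
  also have "wfps (exp (- f)) * wfps (exp f) = 1"
    by (subst wfps_mult[symmetric]) (auto simp: np 1)
  finally have "fps_nth (wfps (exp (- f)) * (fps_X * fps_deriv (wfps (exp f)))) m = of_nat m * coef f (- int m)"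
    by (simp only: mult_1_right X wfps_nth)
  then show ?thesis
    by (simp only: fps_mult_nth[of "wfps (exp (- f))"] X wfps_nth atLeast0AtMost)
qed

section \<open>Infinite matrices with absolutely bounded rows and columns\<close>

text \<open>The condition of Schur's test. The bound behaves like an operator norm on l^2 and is
  submultiplicative, yet it is read off from the entries alone.\<close>

definition schur :: "inf_mat \<Rightarrow> real \<Rightarrow> bool" where
  "schur A R \<longleftrightarrow> (\<forall>S i. finite S \<longrightarrow> (\<Sum>j\<in>S. norm (A i j)) \<le> R) \<and>
     (\<forall>S j. finite S \<longrightarrow> (\<Sum>i\<in>S. norm (A i j)) \<le> R)"

lemma schur_nonneg: "schur A R \<Longrightarrow> 0 \<le> R"
  unfolding schur_def by (metis finite.emptyI sum.empty)

lemma schur_row: "schur A R \<Longrightarrow> finite S \<Longrightarrow> (\<Sum>j\<in>S. norm (A i j)) \<le> R"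
  and schur_col: "schur A R \<Longrightarrow> finite S \<Longrightarrow> (\<Sum>i\<in>S. norm (A i j)) \<le> R"
  unfolding schur_def by blast+

lemma schurI:
  assumes "\<And>S i. finite S \<Longrightarrow> (\<Sum>j\<in>S. norm (A i j)) \<le> R"
    and "\<And>S j. finite S \<Longrightarrow> (\<Sum>i\<in>S. norm (A i j)) \<le> R"
  shows "schur A R"
  unfolding schur_def using assms by simp

lemma schur_transpose: "schur A R \<Longrightarrow> schur (\<lambda>i j. A j i) R"
  unfolding schur_def by simp

lemma schur_mono: "schur A R \<Longrightarrow> R \<le> R' \<Longrightarrow> schur A R'"
  by (rule schurI) (rule order_trans[OF schur_row], assumption+, rule order_trans[OF schur_col])

lemma schur_le:
  assumes "schur A R" "\<And>i j. norm (B i j) \<le> norm (A i j)"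
  shows "schur B R"
proof (rule schurI)
  fix S :: "nat set" and i assume "finite S"
  then show "(\<Sum>j\<in>S. norm (B i j)) \<le> R" "(\<Sum>j\<in>S. norm (B j i)) \<le> R"
    by (rule order_trans[OF sum_mono[OF assms(2)] schur_row[OF assms(1)]],
        rule order_trans[OF sum_mono[OF assms(2)] schur_col[OF assms(1)]])
qed

lemma schur_add:
  assumes "schur A R" "schur B R'"
  shows "schur (\<lambda>i j. A i j + B i j) (R + R')"
proof (rule schurI)
  fix S :: "nat set" and i assume S: "finite S"
  have "(\<Sum>j\<in>S. norm (A i j + B i j)) \<le> (\<Sum>j\<in>S. norm (A i j)) + (\<Sum>j\<in>S. norm (B i j))"
    unfolding sum.distrib[symmetric] by (rule sum_mono) (rule norm_triangle_ineq)
  also have "\<dots> \<le> R + R'" by (intro add_mono schur_row[OF assms(1) S] schur_row[OF assms(2) S])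
  finally show "(\<Sum>j\<in>S. norm (A i j + B i j)) \<le> R + R'" .
  have "(\<Sum>j\<in>S. norm (A j i + B j i)) \<le> (\<Sum>j\<in>S. norm (A j i)) + (\<Sum>j\<in>S. norm (B j i))"
    unfolding sum.distrib[symmetric] by (rule sum_mono) (rule norm_triangle_ineq)
  also have "\<dots> \<le> R + R'" by (intro add_mono schur_col[OF assms(1) S] schur_col[OF assms(2) S])
  finally show "(\<Sum>j\<in>S. norm (A j i + B j i)) \<le> R + R'" .
qed

lemma schur_row_summable: "schur A R \<Longrightarrow> (\<lambda>j. norm (A i j)) summable_on UNIV"
  by (intro nonneg_bdd_above_summable_on bdd_aboveI2[where M = R]) (simp_all add: schur_row)

lemma schur_row_infsum: "schur A R \<Longrightarrow> (\<Sum>\<^sub>\<infinity>j. norm (A i j)) \<le> R"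
  by (rule infsum_le_finite_sums[OF schur_row_summable]) (simp_all add: schur_row)

lemma schur_entry: "schur A R \<Longrightarrow> norm (A i j) \<le> R"
  using schur_row[of A R "{j}" i] by simp

lemma schur_mult_summable:
  assumes "schur A R" "schur B R'"
  shows "(\<lambda>k. norm (A i k * B k j)) summable_on UNIV"
proof (rule Infinite_Sum.abs_summable_on_comparison_test')
  show "(\<lambda>k. norm (A i k) * R') summable_on UNIV"
    by (rule summable_on_cmult_left[OF schur_row_summable[OF assms(1)]])
  show "norm (A i k * B k j) \<le> norm (A i k) * R'" for k
    unfolding norm_mult by (rule mult_left_mono[OF schur_entry[OF assms(2)] norm_ge_zero])
qed

lemma infsum_sum_swap:
  fixes f :: "'a \<Rightarrow> 'b \<Rightarrow> 'c :: real_normed_vector"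
  assumes "\<And>i. i \<in> S \<Longrightarrow> f i summable_on A"
  shows "(\<Sum>i\<in>S. infsum (f i) A) = (\<Sum>\<^sub>\<infinity>k\<in>A. \<Sum>i\<in>S. f i k)"
    and "(\<lambda>k. \<Sum>i\<in>S. f i k) summable_on A"
proof -
  have "((\<lambda>k. \<Sum>i\<in>S. f i k) has_sum (\<Sum>i\<in>S. infsum (f i) A)) A"
    using assms
  proof (induction S rule: infinite_finite_induct)
    case (insert x F)
    then show ?case by (simp add: has_sum_add)
  qed auto
  then show "(\<Sum>i\<in>S. infsum (f i) A) = (\<Sum>\<^sub>\<infinity>k\<in>A. \<Sum>i\<in>S. f i k)"
    and "(\<lambda>k. \<Sum>i\<in>S. f i k) summable_on A"
    by (auto simp: infsumI summable_on_def)
qed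

lemma schur_mult_row:
  assumes "schur A R" "schur B R'" "finite S"
  shows "(\<Sum>j\<in>S. norm (\<Sum>\<^sub>\<infinity>k. A i k * B k j)) \<le> R * R'"
proof -
  note s = schur_mult_summable[OF assms(1,2)]
  have "(\<Sum>j\<in>S. norm (\<Sum>\<^sub>\<infinity>k. A i k * B k j)) \<le> (\<Sum>j\<in>S. \<Sum>\<^sub>\<infinity>k. norm (A i k * B k j))"
    by (rule sum_mono) (rule norm_infsum_bound[OF s])
  also have "\<dots> = (\<Sum>\<^sub>\<infinity>k. \<Sum>j\<in>S. norm (A i k * B k j))"
    by (rule infsum_sum_swap(1)[OF s])
  also have "\<dots> \<le> (\<Sum>\<^sub>\<infinity>k. norm (A i k) * R')"
    by (rule infsum_mono[OF infsum_sum_swap(2)[OF s] summable_on_cmult_left[OF schur_row_summable[OF assms(1)]]])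
       (auto simp: norm_mult sum_distrib_left[symmetric] intro!: mult_left_mono schur_row[OF assms(2,3)])
  also have "\<dots> = (\<Sum>\<^sub>\<infinity>k. norm (A i k)) * R'"
    by (rule infsum_cmult_left')
  also have "\<dots> \<le> R * R'"
    by (rule mult_right_mono[OF schur_row_infsum[OF assms(1)] schur_nonneg[OF assms(2)]])
  finally show ?thesis .
qed

text \<open>Columns of a product are rows of the product of the transposes in reverse order, so the
  estimate of rows is enough.\<close>

lemma schur_mult:
  assumes "schur A R" "schur B R'"
  shows "schur (\<lambda>i j. \<Sum>\<^sub>\<infinity>k. A i k * B k j) (R * R')"
proof (rule schurI)
  fix S :: "nat set" and i assume S: "finite S"
  show "(\<Sum>j\<in>S. norm (\<Sum>\<^sub>\<infinity>k. A i k * B k j)) \<le> R * R'"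
    by (rule schur_mult_row[OF assms S])
  show "(\<Sum>j\<in>S. norm (\<Sum>\<^sub>\<infinity>k. A j k * B k i)) \<le> R * R'"
    using schur_mult_row[OF schur_transpose[OF assms(2)] schur_transpose[OF assms(1)] S, of i]
    by (simp add: mult.commute)
qed

section \<open>The ring of Schur bounded matrices\<close>

typedef smat = "{A :: inf_mat. \<exists>R. schur A R}"
  morphisms ent Abs_smat
  by (rule exI[of _ "\<lambda>_ _. 0"]) (auto simp: schur_def intro!: exI[of _ 0])

setup_lifting type_definition_smat

definition sbd :: "smat \<Rightarrow> real \<Rightarrow> bool" where "sbd X R \<longleftrightarrow> schur (ent X) R"

lemma sbd_ex: "\<exists>R. sbd X R"
  using ent[of X] by (simp add: sbd_def)

lemma smat_eqI: "(\<And>i j. ent X i j = ent Y i j) \<Longrightarrow> X = Y"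
  by (metis ent_inject ext)

instantiation smat :: ring_1
begin

lift_definition zero_smat :: smat is "\<lambda>_ _. 0"
  by (auto simp: schur_def intro!: exI[of _ 0])

lift_definition one_smat :: smat is "\<lambda>i j. if i = j then 1 else 0"
  by (intro exI[of _ 1] schurI) (simp_all add: if_distrib[of norm] cong: if_cong)

lift_definition plus_smat :: "smat \<Rightarrow> smat \<Rightarrow> smat" is "\<lambda>A B i j. A i j + B i j"
  using schur_add by blast

lift_definition uminus_smat :: "smat \<Rightarrow> smat" is "\<lambda>A i j. - A i j"
  by (auto simp: schur_def)

lift_definition minus_smat :: "smat \<Rightarrow> smat \<Rightarrow> smat" is "\<lambda>A B i j. A i j - B i j"
proof -
  fix A B assume "\<exists>R. schur A R" "\<exists>R. schur B R"
  then obtain R R' where "schur A R" "schur (\<lambda>i j. - B i j) R'" by (auto simp: schur_def)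
  from schur_add[OF this] show "\<exists>R. schur (\<lambda>i j. A i j - B i j) R" by auto
qed

lift_definition times_smat :: "smat \<Rightarrow> smat \<Rightarrow> smat" is "\<lambda>A B i j. \<Sum>\<^sub>\<infinity>k. A i k * B k j"
  using schur_mult by blast

instance
proof
  fix X Y Z :: smat
  show "X + Y + Z = X + (Y + Z)" "X + Y = Y + X" "0 + X = X" "- X + X = 0" "X - Y = X + - Y"
    by (transfer, simp add: algebra_simps)+
  show "(0::smat) \<noteq> 1"
  proof
    assume "(0::smat) = 1"
    then have "ent 0 0 0 = ent 1 0 0" by simp
    then show False by (simp add: zero_smat.rep_eq one_smat.rep_eq)
  qed
  show "1 * X = X"
  proof (transfer, intro ext)
    fix A :: inf_mat and i j
    have "(\<Sum>\<^sub>\<infinity>k. (if i = k then 1 else 0) * A k j) = (\<Sum>\<^sub>\<infinity>k\<in>{i}. A k j)"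
      by (rule infsum_cong_neutral) auto
    then show "(\<Sum>\<^sub>\<infinity>k. (if i = k then 1 else 0) * A k j) = A i j" by simp
  qed
  show "X * 1 = X"
  proof (transfer, intro ext)
    fix A :: inf_mat and i j
    have "(\<Sum>\<^sub>\<infinity>k. A i k * (if k = j then 1 else 0)) = (\<Sum>\<^sub>\<infinity>k\<in>{j}. A i k)"
      by (rule infsum_cong_neutral) auto
    then show "(\<Sum>\<^sub>\<infinity>k. A i k * (if k = j then 1 else 0)) = A i j" by simp
  qed
  show "(X + Y) * Z = X * Z + Y * Z"
  proof (transfer, intro ext)
    fix A B C :: inf_mat and i j
    assume "\<exists>R. schur A R" "\<exists>R. schur B R" "\<exists>R. schur C R"
    then obtain a b c where *: "schur A a" "schur B b" "schur C c" by blast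
    show "(\<Sum>\<^sub>\<infinity>k. (A i k + B i k) * C k j) = (\<Sum>\<^sub>\<infinity>k. A i k * C k j) + (\<Sum>\<^sub>\<infinity>k. B i k * C k j)"
      unfolding distrib_right
      by (rule infsum_add[OF abs_summable_summable[OF schur_mult_summable[OF *(1,3)]]
            abs_summable_summable[OF schur_mult_summable[OF *(2,3)]]])
  qed
  show "X * (Y + Z) = X * Y + X * Z"
  proof (transfer, intro ext)
    fix A B C :: inf_mat and i j
    assume "\<exists>R. schur A R" "\<exists>R. schur B R" "\<exists>R. schur C R"
    then obtain a b c where *: "schur A a" "schur B b" "schur C c" by blast
    show "(\<Sum>\<^sub>\<infinity>k. A i k * (B k j + C k j)) = (\<Sum>\<^sub>\<infinity>k. A i k * B k j) + (\<Sum>\<^sub>\<infinity>k. A i k * C k j)"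
      unfolding distrib_left
      by (rule infsum_add[OF abs_summable_summable[OF schur_mult_summable[OF *(1,2)]]
            abs_summable_summable[OF schur_mult_summable[OF *(1,3)]]])
  qed
  show "X * Y * Z = X * (Y * Z)"
  proof (transfer, intro ext)
    fix A B C :: inf_mat and i l
    assume "\<exists>R. schur A R" "\<exists>R. schur B R" "\<exists>R. schur C R"
    then obtain a b c where *: "schur A a" "schur B b" "schur C c" by blast
    have hs: "((\<lambda>j. norm (A i k) * norm (B k j) * c) has_sum (norm (A i k) * (\<Sum>\<^sub>\<infinity>j. norm (B k j)) * c)) UNIV" for k
      by (intro has_sum_cmult_left has_sum_cmult_right has_sum_infsum schur_row_summable[OF *(2)])
    have bnn: "0 \<le> (\<Sum>\<^sub>\<infinity>j. norm (B k j))" for k by (rule infsum_nonneg) simp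
    have "(\<lambda>k. norm (norm (A i k) * (\<Sum>\<^sub>\<infinity>j. norm (B k j)) * c)) summable_on UNIV"
    proof (rule Infinite_Sum.abs_summable_on_comparison_test')
      show "(\<lambda>k. norm (A i k) * (b * c)) summable_on UNIV"
        by (rule summable_on_cmult_left[OF schur_row_summable[OF *(1)]])
      show "norm (norm (A i k) * (\<Sum>\<^sub>\<infinity>j. norm (B k j)) * c) \<le> norm (A i k) * (b * c)" for k
        using schur_row_infsum[OF *(2), of k] bnn[of k] schur_nonneg[OF *(3)]
        by (simp add: abs_mult mult.assoc mult_left_mono mult_right_mono)
    qed
    then have g: "(\<lambda>k. norm (A i k) * (\<Sum>\<^sub>\<infinity>j. norm (B k j)) * c) summable_on UNIV"
      by (rule abs_summable_summable)
    have "(\<lambda>(k, j). norm (A i k) * norm (B k j) * c) summable_on UNIV \<times> UNIV"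
      by (rule summable_on_SigmaI[OF _ g]) (use hs schur_nonneg[OF *(3)] in auto)
    then have "(\<lambda>p. norm (case p of (k, j) \<Rightarrow> A i k * (B k j * C j l))) summable_on UNIV \<times> UNIV"
    proof (rule Infinite_Sum.abs_summable_on_comparison_test')
      fix p :: "nat \<times> nat"
      obtain k j where p: "p = (k, j)" by (cases p)
      show "norm (case p of (k, j) \<Rightarrow> A i k * (B k j * C j l)) \<le> (case p of (k, j) \<Rightarrow> norm (A i k) * norm (B k j) * c)"
        unfolding p prod.case norm_mult mult.assoc[symmetric]
        by (intro mult_left_mono schur_entry[OF *(3)]) simp
    qed
    then have s: "(\<lambda>(k, j). A i k * (B k j * C j l)) summable_on UNIV \<times> UNIV"
      by (rule abs_summable_summable)
    have "(\<Sum>\<^sub>\<infinity>k. A i k * (\<Sum>\<^sub>\<infinity>j. B k j * C j l)) = (\<Sum>\<^sub>\<infinity>k. \<Sum>\<^sub>\<infinity>j. A i k * (B k j * C j l))"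
      by (simp add: infsum_cmult_right')
    also have "\<dots> = (\<Sum>\<^sub>\<infinity>j. \<Sum>\<^sub>\<infinity>k. A i k * (B k j * C j l))"
      by (rule infsum_swap_banach[OF s])
    also have "\<dots> = (\<Sum>\<^sub>\<infinity>j. (\<Sum>\<^sub>\<infinity>k. A i k * B k j) * C j l)"
      by (simp add: infsum_cmult_left' flip: mult.assoc)
    finally show "(\<Sum>\<^sub>\<infinity>j. (\<Sum>\<^sub>\<infinity>k. A i k * B k j) * C j l) = (\<Sum>\<^sub>\<infinity>k. A i k * (\<Sum>\<^sub>\<infinity>j. B k j * C j l))"
      by simp
  qed
qed

end

lemma ent_simps [simp]:
  "ent 0 i j = 0" "ent 1 i j = (if i = j then 1 else 0)" "ent (X + Y) i j = ent X i j + ent Y i j"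
  "ent (X - Y) i j = ent X i j - ent Y i j" "ent (- X) i j = - ent X i j"
  by (simp_all add: zero_smat.rep_eq one_smat.rep_eq plus_smat.rep_eq minus_smat.rep_eq uminus_smat.rep_eq)

lemma ent_mult: "ent (X * Y) i j = (\<Sum>\<^sub>\<infinity>k. ent X i k * ent Y k j)"
  by (simp add: times_smat.rep_eq)

lemma ent_mult_summable: "(\<lambda>k. ent X i k * ent Y k j) summable_on UNIV"
  using sbd_ex[of X] sbd_ex[of Y] abs_summable_summable[OF schur_mult_summable]
  unfolding sbd_def by blast

lemma ent_mult_has_sum: "((\<lambda>k. ent X i k * ent Y k j) has_sum ent (X * Y) i j) UNIV"
  unfolding ent_mult by (rule has_sum_infsum[OF ent_mult_summable])

lemma sbd_mult: "sbd X R \<Longrightarrow> sbd Y R' \<Longrightarrow> sbd (X * Y) (R * R')"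
  unfolding sbd_def times_smat.rep_eq by (rule schur_mult)

lemma sbd_add: "sbd X R \<Longrightarrow> sbd Y R' \<Longrightarrow> sbd (X + Y) (R + R')"
  unfolding sbd_def plus_smat.rep_eq by (rule schur_add)

lemma sbd_nonneg: "sbd X R \<Longrightarrow> 0 \<le> R"
  unfolding sbd_def by (rule schur_nonneg)

lemma sbd_mono: "sbd X R \<Longrightarrow> R \<le> R' \<Longrightarrow> sbd X R'"
  unfolding sbd_def by (rule schur_mono)

section \<open>Transposition and Hilbert-Schmidt bounds\<close>

lift_definition strans :: "smat \<Rightarrow> smat" is "\<lambda>A i j. A j i"
  using schur_transpose by blast

lemma ent_strans [simp]: "ent (strans X) i j = ent X j i"
  by (simp add: strans.rep_eq)

lemma strans_mult: "strans (X * Y) = strans Y * strans X"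
  by (rule smat_eqI) (simp add: ent_mult mult.commute)

lemma sbd_strans [simp]: "sbd (strans X) R = sbd X R"
  unfolding sbd_def schur_def by auto

text \<open>An upper bound of the Hilbert-Schmidt norm, tested on finite blocks. As a relation it
  assigns no value to matrices with infinite norm, and bounds can be weakened freely.\<close>

definition fro :: "smat \<Rightarrow> real \<Rightarrow> bool" where
  "fro X R \<longleftrightarrow> 0 \<le> R \<and> (\<forall>I J. finite I \<longrightarrow> finite J \<longrightarrow> (\<Sum>i\<in>I. \<Sum>j\<in>J. (norm (ent X i j))\<^sup>2) \<le> R\<^sup>2)"

lemma froI: "0 \<le> R \<Longrightarrow> (\<And>I J. finite I \<Longrightarrow> finite J \<Longrightarrow> (\<Sum>i\<in>I. \<Sum>j\<in>J. (norm (ent X i j))\<^sup>2) \<le> R\<^sup>2) \<Longrightarrow> fro X R"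
  unfolding fro_def by blast

lemma froD: "fro X R \<Longrightarrow> finite I \<Longrightarrow> finite J \<Longrightarrow> (\<Sum>i\<in>I. \<Sum>j\<in>J. (norm (ent X i j))\<^sup>2) \<le> R\<^sup>2"
  and fro_nonneg: "fro X R \<Longrightarrow> 0 \<le> R"
  unfolding fro_def by blast+

lemma fro_strans [simp]: "fro (strans X) R = fro X R"
proof -
  have "(\<Sum>i\<in>I. \<Sum>j\<in>J. (norm (ent X j i))\<^sup>2) = (\<Sum>j\<in>J. \<Sum>i\<in>I. (norm (ent X j i))\<^sup>2)" for I J
    by (rule sum.swap)
  then show ?thesis unfolding fro_def ent_strans by auto
qed

lemma fro_mono: "fro X R \<Longrightarrow> R \<le> R' \<Longrightarrow> fro X R'"
  by (rule froI) (auto dest: fro_nonneg intro!: order_trans[OF froD] power_mono)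

lemma fro_le:
  assumes "fro X R" "\<And>i j. norm (ent Y i j) \<le> norm (ent X i j)"
  shows "fro Y R"
proof (rule froI)
  show "0 \<le> R" by (rule fro_nonneg[OF assms(1)])
  fix I J :: "nat set" assume fin: "finite I" "finite J"
  have "(\<Sum>i\<in>I. \<Sum>j\<in>J. (norm (ent Y i j))\<^sup>2) \<le> (\<Sum>i\<in>I. \<Sum>j\<in>J. (norm (ent X i j))\<^sup>2)"
    by (intro sum_mono power_mono assms(2) norm_ge_zero)
  also have "\<dots> \<le> R\<^sup>2" by (rule froD[OF assms(1) fin])
  finally show "(\<Sum>i\<in>I. \<Sum>j\<in>J. (norm (ent Y i j))\<^sup>2) \<le> R\<^sup>2" .
qed

lemma fro_uminus [simp]: "fro (- X) R = fro X R"
  by (simp add: fro_def)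

lemma L2_set_le_iff: "0 \<le> R \<Longrightarrow> L2_set f A \<le> R \<longleftrightarrow> (\<Sum>i\<in>A. (f i)\<^sup>2) \<le> R\<^sup>2"
  unfolding L2_set_def by (metis real_sqrt_le_iff real_sqrt_unique)

lemma fro_L2: "fro X R \<longleftrightarrow> 0 \<le> R \<and> (\<forall>I J. finite I \<longrightarrow> finite J \<longrightarrow> L2_set (\<lambda>(i, j). norm (ent X i j)) (I \<times> J) \<le> R)"
proof (cases "0 \<le> R")
  case True
  have "(case p of (i, j) \<Rightarrow> norm (ent X i j))\<^sup>2 = (case p of (i, j) \<Rightarrow> (norm (ent X i j))\<^sup>2)" for p
    by (cases p) simp
  then show ?thesis
    unfolding fro_def L2_set_le_iff[OF True] sum.cartesian_product by simp
qed (simp add: fro_def)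

lemma fro_add:
  assumes "fro X a" "fro Y b"
  shows "fro (X + Y) (a + b)"
  unfolding fro_L2
proof (intro conjI allI impI)
  show "0 \<le> a + b" using assms by (simp add: fro_nonneg)
  fix I J :: "nat set" assume fin: "finite I" "finite J"
  have "L2_set (\<lambda>(i, j). norm (ent (X + Y) i j)) (I \<times> J)
      \<le> L2_set (\<lambda>p. (case p of (i, j) \<Rightarrow> norm (ent X i j)) + (case p of (i, j) \<Rightarrow> norm (ent Y i j))) (I \<times> J)"
    by (rule L2_set_mono) (auto intro: norm_triangle_ineq)
  also have "\<dots> \<le> L2_set (\<lambda>(i, j). norm (ent X i j)) (I \<times> J) + L2_set (\<lambda>(i, j). norm (ent Y i j)) (I \<times> J)"
    by (rule L2_set_triangle_ineq)
  also have "\<dots> \<le> a + b"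
    using assms fin by (intro add_mono) (auto simp: fro_L2)
  finally show "L2_set (\<lambda>(i, j). norm (ent (X + Y) i j)) (I \<times> J) \<le> a + b" .
qed

lemma fro_diff: "fro X a \<Longrightarrow> fro Y b \<Longrightarrow> fro (X - Y) (a + b)"
  using fro_add[of X a "- Y" b] by simp

text \<open>A finite block of a product is the limit, along finite sets \<open>K\<close> of inner
  indices, of blocks with finite inner sums; so the estimates of products only concern finite
  sums.\<close>

lemma fro_mult_limit:
  assumes "0 \<le> R"
    and "\<And>I J K. finite I \<Longrightarrow> finite J \<Longrightarrow> finite K \<Longrightarrow> (\<Sum>i\<in>I. \<Sum>j\<in>J. (norm (\<Sum>k\<in>K. ent X i k * ent Y k j))\<^sup>2) \<le> R\<^sup>2"
  shows "fro (X * Y) R"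
proof (rule froI[OF assms(1)])
  fix I J :: "nat set" assume fin: "finite I" "finite J"
  show "(\<Sum>i\<in>I. \<Sum>j\<in>J. (norm (ent (X * Y) i j))\<^sup>2) \<le> R\<^sup>2"
  proof (rule tendsto_le[OF _ tendsto_const])
    show "((\<lambda>K. \<Sum>i\<in>I. \<Sum>j\<in>J. (norm (\<Sum>k\<in>K. ent X i k * ent Y k j))\<^sup>2) \<longlongrightarrow>
        (\<Sum>i\<in>I. \<Sum>j\<in>J. (norm (ent (X * Y) i j))\<^sup>2)) (finite_subsets_at_top UNIV)"
      using ent_mult_has_sum unfolding has_sum_def by (intro tendsto_intros) blast
    show "\<forall>\<^sub>F K in finite_subsets_at_top UNIV. (\<Sum>i\<in>I. \<Sum>j\<in>J. (norm (\<Sum>k\<in>K. ent X i k * ent Y k j))\<^sup>2) \<le> R\<^sup>2"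
      by (rule eventually_finite_subsets_at_top_weakI) (rule assms(2)[OF fin])
  qed simp
qed

lemma fro_mult:
  assumes X: "fro X a" and Y: "fro Y b"
  shows "fro (X * Y) (a * b)"
proof (rule fro_mult_limit)
  show "0 \<le> a * b" using assms by (simp add: fro_nonneg)
  fix I J K :: "nat set" assume fin: "finite I" "finite J" "finite K"
  have "(norm (\<Sum>k\<in>K. ent X i k * ent Y k j))\<^sup>2 \<le> (\<Sum>k\<in>K. (norm (ent X i k))\<^sup>2) * (\<Sum>k\<in>K. (norm (ent Y k j))\<^sup>2)" for i j
  proof -
    have "norm (\<Sum>k\<in>K. ent X i k * ent Y k j) \<le> (\<Sum>k\<in>K. norm (ent X i k) * norm (ent Y k j))"
      by (rule order_trans[OF norm_sum]) (simp add: norm_mult)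
    then have "(norm (\<Sum>k\<in>K. ent X i k * ent Y k j))\<^sup>2 \<le> (\<Sum>k\<in>K. norm (ent X i k) * norm (ent Y k j))\<^sup>2"
      by (rule power_mono) simp
    also have "\<dots> \<le> (\<Sum>k\<in>K. (norm (ent X i k))\<^sup>2) * (\<Sum>k\<in>K. (norm (ent Y k j))\<^sup>2)"
      by (rule Cauchy_Schwarz_ineq_sum)
    finally show ?thesis .
  qed
  then have "(\<Sum>i\<in>I. \<Sum>j\<in>J. (norm (\<Sum>k\<in>K. ent X i k * ent Y k j))\<^sup>2)
      \<le> (\<Sum>i\<in>I. \<Sum>j\<in>J. (\<Sum>k\<in>K. (norm (ent X i k))\<^sup>2) * (\<Sum>k\<in>K. (norm (ent Y k j))\<^sup>2))"
    by (intro sum_mono)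
  also have "\<dots> = (\<Sum>i\<in>I. \<Sum>k\<in>K. (norm (ent X i k))\<^sup>2) * (\<Sum>j\<in>J. \<Sum>k\<in>K. (norm (ent Y k j))\<^sup>2)"
    by (simp add: sum_product)
  also have "\<dots> \<le> a\<^sup>2 * b\<^sup>2"
    using froD[OF X fin(1,3)] froD[OF Y fin(3,2)]
    by (intro mult_mono) (auto intro!: sum_nonneg simp: sum.swap[of _ K J])
  finally show "(\<Sum>i\<in>I. \<Sum>j\<in>J. (norm (\<Sum>k\<in>K. ent X i k * ent Y k j))\<^sup>2) \<le> (a * b)\<^sup>2"
    by (simp add: power_mult_distrib)
qed

text \<open>Schur's test: one writes the modulus of an entry of \<open>X\<close> as a product of two
  square roots and applies the Cauchy-Schwarz inequality; the row sums bound the first factor, the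
  column sums the remaining sum over \<open>I\<close>.\<close>

lemma fro_mult_left:
  assumes X: "sbd X a" and Y: "fro Y b"
  shows "fro (X * Y) (a * b)"
proof (rule fro_mult_limit)
  have a: "0 \<le> a" by (rule sbd_nonneg[OF X])
  show "0 \<le> a * b" using a fro_nonneg[OF Y] by simp
  fix I J K :: "nat set" assume fin: "finite I" "finite J" "finite K"
  have "(norm (\<Sum>k\<in>K. ent X i k * ent Y k j))\<^sup>2 \<le> a * (\<Sum>k\<in>K. norm (ent X i k) * (norm (ent Y k j))\<^sup>2)" for i j
  proof -
    have "norm (\<Sum>k\<in>K. ent X i k * ent Y k j) \<le> (\<Sum>k\<in>K. sqrt (norm (ent X i k)) * (sqrt (norm (ent X i k)) * norm (ent Y k j)))"
      by (rule order_trans[OF norm_sum]) (simp add: norm_mult flip: mult.assoc)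
    then have "(norm (\<Sum>k\<in>K. ent X i k * ent Y k j))\<^sup>2 \<le> (\<Sum>k\<in>K. sqrt (norm (ent X i k)) * (sqrt (norm (ent X i k)) * norm (ent Y k j)))\<^sup>2"
      by (rule power_mono) simp
    also have "\<dots> \<le> (\<Sum>k\<in>K. (sqrt (norm (ent X i k)))\<^sup>2) * (\<Sum>k\<in>K. (sqrt (norm (ent X i k)) * norm (ent Y k j))\<^sup>2)"
      by (rule Cauchy_Schwarz_ineq_sum)
    also have "\<dots> = (\<Sum>k\<in>K. norm (ent X i k)) * (\<Sum>k\<in>K. norm (ent X i k) * (norm (ent Y k j))\<^sup>2)"
      by (simp add: power_mult_distrib)
    also have "\<dots> \<le> a * (\<Sum>k\<in>K. norm (ent X i k) * (norm (ent Y k j))\<^sup>2)"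
      using schur_row[OF X[unfolded sbd_def] fin(3)] by (intro mult_right_mono sum_nonneg) auto
    finally show ?thesis .
  qed
  then have "(\<Sum>i\<in>I. \<Sum>j\<in>J. (norm (\<Sum>k\<in>K. ent X i k * ent Y k j))\<^sup>2)
      \<le> (\<Sum>i\<in>I. \<Sum>j\<in>J. a * (\<Sum>k\<in>K. norm (ent X i k) * (norm (ent Y k j))\<^sup>2))"
    by (intro sum_mono)
  also have "\<dots> = a * (\<Sum>k\<in>K. \<Sum>j\<in>J. (\<Sum>i\<in>I. norm (ent X i k)) * (norm (ent Y k j))\<^sup>2)"
  proof -
    let ?g = "\<lambda>i j k. norm (ent X i k) * (norm (ent Y k j))\<^sup>2"
    have "(\<Sum>i\<in>I. \<Sum>j\<in>J. \<Sum>k\<in>K. ?g i j k) = (\<Sum>i\<in>I. \<Sum>k\<in>K. \<Sum>j\<in>J. ?g i j k)"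
      by (rule sum.cong[OF refl]) (rule sum.swap)
    also have "\<dots> = (\<Sum>k\<in>K. \<Sum>i\<in>I. \<Sum>j\<in>J. ?g i j k)"
      by (rule sum.swap)
    also have "\<dots> = (\<Sum>k\<in>K. \<Sum>j\<in>J. \<Sum>i\<in>I. ?g i j k)"
      by (rule sum.cong[OF refl]) (rule sum.swap)
    finally show ?thesis unfolding sum_distrib_left[symmetric] sum_distrib_right by simp
  qed
  also have "\<dots> \<le> a * (\<Sum>k\<in>K. \<Sum>j\<in>J. a * (norm (ent Y k j))\<^sup>2)"
    using schur_col[OF X[unfolded sbd_def] fin(1)] a by (intro mult_left_mono sum_mono mult_right_mono) auto
  also have "\<dots> = a\<^sup>2 * (\<Sum>k\<in>K. \<Sum>j\<in>J. (norm (ent Y k j))\<^sup>2)"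
    by (simp add: sum_distrib_left power2_eq_square mult.assoc)
  also have "\<dots> \<le> a\<^sup>2 * b\<^sup>2"
    by (intro mult_left_mono froD[OF Y]) (auto simp: fin)
  finally show "(\<Sum>i\<in>I. \<Sum>j\<in>J. (norm (\<Sum>k\<in>K. ent X i k * ent Y k j))\<^sup>2) \<le> (a * b)\<^sup>2"
    by (simp add: power_mult_distrib)
qed

lemma fro_mult_right:
  assumes "fro X a" "sbd Y b"
  shows "fro (X * Y) (a * b)"
  using fro_mult_left[of "strans Y" b "strans X" a] assms
  by (simp flip: strans_mult add: mult.commute)

definition str :: "nat \<Rightarrow> smat \<Rightarrow> complex" where "str N X = (\<Sum>i<N. ent X i i)"

lemma str_add: "str N (X + Y) = str N X + str N Y"
  by (simp add: str_def sum.distrib)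

text \<open>Cauchy-Schwarz for the trace pairing of two Hilbert-Schmidt matrices. The bound does not
  depend on \<open>N\<close> and takes the place of trace norm estimates.\<close>

lemma norm_str_mult:
  assumes X: "fro X a" and Y: "fro Y b"
  shows "norm (str N (X * Y)) \<le> a * b"
proof (rule tendsto_le[OF _ tendsto_const])
  show "((\<lambda>K. norm (\<Sum>i<N. \<Sum>k\<in>K. ent X i k * ent Y k i)) \<longlongrightarrow> norm (str N (X * Y))) (finite_subsets_at_top UNIV)"
    unfolding str_def using ent_mult_has_sum unfolding has_sum_def by (intro tendsto_intros) blast
  have "norm (\<Sum>i<N. \<Sum>k\<in>K. ent X i k * ent Y k i) \<le> a * b" if "finite K" for K
  proof -
    have "norm (\<Sum>i<N. \<Sum>k\<in>K. ent X i k * ent Y k i) = norm (\<Sum>(i, k)\<in>{..<N} \<times> K. ent X i k * ent Y k i)"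
      by (simp add: sum.cartesian_product)
    also have "\<dots> \<le> (\<Sum>p\<in>{..<N} \<times> K. \<bar>case p of (i, k) \<Rightarrow> norm (ent X i k)\<bar> * \<bar>case p of (i, k) \<Rightarrow> norm (ent Y k i)\<bar>)"
      by (rule order_trans[OF norm_sum]) (auto intro!: sum_mono simp: norm_mult)
    also have "\<dots> \<le> L2_set (\<lambda>(i, k). norm (ent X i k)) ({..<N} \<times> K) * L2_set (\<lambda>(i, k). norm (ent Y k i)) ({..<N} \<times> K)"
      by (rule L2_set_mult_ineq)
    also have "\<dots> \<le> a * b"
    proof (intro mult_mono)
      show "L2_set (\<lambda>(i, k). norm (ent X i k)) ({..<N} \<times> K) \<le> a"
        using X that by (auto simp: fro_L2)
      have "fro (strans Y) b" using Y by simp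
      then show "L2_set (\<lambda>(i, k). norm (ent Y k i)) ({..<N} \<times> K) \<le> b"
        using that unfolding fro_L2 ent_strans by blast
    qed (auto intro: fro_nonneg[OF X])
    finally show ?thesis .
  qed
  then show "\<forall>\<^sub>F K in finite_subsets_at_top UNIV. norm (\<Sum>i<N. \<Sum>k\<in>K. ent X i k * ent Y k i) \<le> a * b"
    by (intro eventually_finite_subsets_at_top_weakI)
qed simp

text \<open>The least Hilbert-Schmidt bound. An actual number is wanted where a bound is absorbed
  into itself, in \<open>PBP_inverse\<close>.\<close>

definition fnorm :: "smat \<Rightarrow> real" where
  "fnorm X = Sup ((\<lambda>(I, J). L2_set (\<lambda>(i, j). norm (ent X i j)) (I \<times> J)) ` {(I, J). finite I \<and> finite J})"

lemma fro_fnorm: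
  assumes "fro X a"
  shows "fro X (fnorm X)" "fnorm X \<le> a"
proof -
  let ?f = "\<lambda>(I, J). L2_set (\<lambda>(i, j). norm (ent X i j)) (I \<times> J)"
  let ?A = "{(I, J). finite I \<and> finite J} :: (nat set \<times> nat set) set"
  have bdd: "bdd_above (?f ` ?A)"
    using assms by (intro bdd_aboveI2[where M = a]) (auto simp: fro_L2)
  have up: "L2_set (\<lambda>(i, j). norm (ent X i j)) (I \<times> J) \<le> fnorm X" if "finite I" "finite J" for I J
    unfolding fnorm_def using cSUP_upper[OF _ bdd, of "(I, J)"] that by simp
  have "0 \<le> fnorm X" using up[of "{}" "{}"] by simp
  with up show "fro X (fnorm X)" by (auto simp: fro_L2)
  have "?A \<noteq> {}" by auto
  then show "fnorm X \<le> a"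
    unfolding fnorm_def using assms by (intro cSUP_least) (auto simp: fro_L2)
qed

section \<open>Toeplitz and Hankel matrices of Wiener symbols\<close>

lemma sum_coef_inj_le: "finite S \<Longrightarrow> inj_on h S \<Longrightarrow> (\<Sum>j\<in>S. norm (coef f (h j))) \<le> norm f"
  using sum_norm_coef_le[of "h ` S" f] by (simp add: sum.reindex)

definition toep :: "wiener \<Rightarrow> smat" where
  "toep f = Abs_smat (\<lambda>i j. coef f (int i - int j))"

text \<open>The quotient keeps the matrix bounded for every weight \<open>e\<close>; it is \<open>e j\<close> if \<open>\<bar>e j\<bar> \<le> 1\<close>.\<close>

definition hank :: "(nat \<Rightarrow> complex) \<Rightarrow> int \<Rightarrow> wiener \<Rightarrow> smat" where
  "hank e \<kappa> f = Abs_smat (\<lambda>i j. (e j / of_real (max 1 (norm (e j)))) * coef f (int i + int j + 1 - \<kappa>))"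

lemma schur_toep: "schur (\<lambda>i j. coef f (int i - int j)) (norm f)"
  by (rule schurI) (rule sum_coef_inj_le, assumption, simp add: inj_on_def)+

lemma schur_hank:
  assumes "\<And>j. norm (e j) \<le> 1"
  shows "schur (\<lambda>i j. e j * coef f (int i + int j + 1 - \<kappa>)) (norm f)"
proof -
  have "schur (\<lambda>i j. coef f (int i + int j + 1 - \<kappa>)) (norm f)"
    by (rule schurI) (rule sum_coef_inj_le, assumption, simp add: inj_on_def)+
  then show ?thesis
    by (rule schur_le) (simp add: norm_mult mult_left_le_one_le assms)
qed

lemma ent_toep [simp]: "ent (toep f) i j = coef f (int i - int j)"
  unfolding toep_def by (subst Abs_smat_inverse) (use schur_toep in blast)+

lemma ent_hank [simp]: 
  assumes "\<And>j. norm (e j) \<le> 1"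
  shows "ent (hank e \<kappa> f) i j = e j * coef f (int i + int j + 1 - \<kappa>)"
proof -
  have e: "e j / of_real (max 1 (norm (e j))) = e j" for j
    using assms[of j] by (simp add: max_def)
  show ?thesis
    unfolding hank_def e by (subst Abs_smat_inverse) (use schur_hank[of e, OF assms] in blast)+
qed

lemma sbd_toep: "sbd (toep f) (norm f)"
  unfolding sbd_def using schur_toep[of f] ent_toep[of f] by (metis (no_types, lifting) ext)

lemma sbd_hank: "(\<And>j. norm (e j) \<le> 1) \<Longrightarrow> sbd (hank e \<kappa> f) (norm f)"
  unfolding sbd_def using schur_hank[of e f \<kappa>] by (simp add: schur_def)

abbreviation hank1 :: "wiener \<Rightarrow> smat" where "hank1 \<equiv> hank (\<lambda>_. 1) 0"

lemma has_sum_int_split: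
  fixes F :: "int \<Rightarrow> complex"
  assumes "(\<lambda>k. norm (F k)) summable_on UNIV" "(F has_sum s) UNIV"
  shows "\<exists>t u. (F has_sum t) {0..} \<and> (F has_sum u) {..<0} \<and> s = t + u"
proof -
  have "F summable_on UNIV" using assms by (auto simp: summable_on_def)
  then have "F summable_on {0..}" "F summable_on {..<0}"
    by (auto intro: summable_on_subset_banach)
  then obtain t u where tu: "(F has_sum t) {0..}" "(F has_sum u) {..<0}"
    by (auto simp: summable_on_def)
  have "({0..} :: int set) \<inter> {..<0} = {}" "({0..} :: int set) \<union> {..<0} = UNIV" by auto
  with has_sum_Un_disjoint[OF tu] assms(2) have "s = t + u"
    using has_sum_unique by metis
  with tu show ?thesis by blast
qed

lemma has_sum_int_nat:
  "(F has_sum s) {0::int..} \<longleftrightarrow> ((\<lambda>k. F (int k)) has_sum s) UNIV"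
  by (rule has_sum_reindex_bij_witness[where i = int and j = nat]) auto

lemma has_sum_int_neg_nat:
  "(F has_sum s) {..<0::int} \<longleftrightarrow> ((\<lambda>k. F (- 1 - int k)) has_sum s) UNIV"
  by (rule has_sum_reindex_bij_witness[where i = "\<lambda>k. - 1 - int k" and j = "\<lambda>k. nat (- 1 - k)"]) auto

lemma conv_shift:
  "((\<lambda>k. coef f (a - k) * coef g (k - b)) has_sum coef (f * g) (a - b)) UNIV"
  "(\<lambda>k. norm (coef f (a - k) * coef g (k - b))) summable_on UNIV"
proof -
  have "((\<lambda>k. coef f ((a - b) - k) * coef g k) has_sum coef (f * g) (a - b)) UNIV"
    unfolding coef_mult by (rule has_sum_infsum[OF abs_summable_summable[OF coef_mult_summable]])
  also have "?this \<longleftrightarrow> ((\<lambda>k. coef f (a - k) * coef g (k - b)) has_sum coef (f * g) (a - b)) UNIV"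
    by (rule has_sum_reindex_bij_witness[where i = "\<lambda>k. k - b" and j = "\<lambda>k. k + b"])
       (auto simp: algebra_simps)
  finally show "((\<lambda>k. coef f (a - k) * coef g (k - b)) has_sum coef (f * g) (a - b)) UNIV" .
  have "(\<lambda>k. norm (coef f ((a - b) - k) * coef g k)) summable_on UNIV"
    by (rule coef_mult_summable)
  also have "?this \<longleftrightarrow> (\<lambda>k. norm (coef f (a - k) * coef g (k - b))) summable_on UNIV"
    by (rule summable_on_reindex_bij_witness[where i = "\<lambda>k. k - b" and j = "\<lambda>k. k + b"])
       (auto simp: algebra_simps)
  finally show "(\<lambda>k. norm (coef f (a - k) * coef g (k - b))) summable_on UNIV" .
qed

text \<open>The convolution over all integers \<open>k\<close> splits at 0: the indices
  \<open>k \<ge> 0\<close> give the product of the Toeplitz matrices, the indices -1 - k with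
  \<open>k \<ge> 0\<close> that of the Hankel matrices.\<close>

lemma toep_mult: "toep (f * g) = toep f * toep g + hank1 f * hank1 (wtilde g)"
proof (rule smat_eqI)
  fix i j
  let ?F = "\<lambda>k. coef f (int i - k) * coef g (k - int j)"
  from has_sum_int_split[OF conv_shift(2,1)] obtain t u
    where tu: "(?F has_sum t) {0..}" "(?F has_sum u) {..<0}" "coef (f * g) (int i - int j) = t + u"
    by blast
  have "((\<lambda>k. ?F (int k)) has_sum ent (toep f * toep g) i j) UNIV"
    using ent_mult_has_sum[of "toep f" i "toep g" j] by simp
  then have "ent (toep f * toep g) i j = t"
    using tu(1) unfolding has_sum_int_nat by (rule has_sum_unique)
  moreover have "((\<lambda>k. ?F (- 1 - int k)) has_sum ent (hank1 f * hank1 (wtilde g)) i j) UNIV"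
    using ent_mult_has_sum[of "hank1 f" i "hank1 (wtilde g)" j] by (simp add: algebra_simps)
  then have "ent (hank1 f * hank1 (wtilde g)) i j = u"
    using tu(2) unfolding has_sum_int_neg_nat by (rule has_sum_unique)
  ultimately show "ent (toep (f * g)) i j = ent (toep f * toep g + hank1 f * hank1 (wtilde g)) i j"
    using tu(3) by simp
qed

lemma hank1_nonpos: "wnonpos f \<Longrightarrow> hank1 f = 0"
  by (rule smat_eqI) (simp add: wnonpos_def)

lemma toep_mult_nonpos: "wnonpos f \<Longrightarrow> toep f * toep g = toep (f * g)"
  by (simp add: toep_mult hank1_nonpos)

lemma toep_mult_nonneg: "wnonneg g \<Longrightarrow> toep f * toep g = toep (f * g)"
  by (simp add: toep_mult hank1_nonpos)

lemma toep_one [simp]: "toep 1 = 1"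
  by (rule smat_eqI) simp

lemma toep_exp_inverse:
  "wnonpos f \<Longrightarrow> toep (exp f) * toep (exp (- f)) = 1"
  "wnonpos f \<Longrightarrow> toep (exp (- f)) * toep (exp f) = 1"
  "wnonneg f \<Longrightarrow> toep (exp f) * toep (exp (- f)) = 1"
  "wnonneg f \<Longrightarrow> toep (exp (- f)) * toep (exp f) = 1"
proof -
  assume f: "wnonpos f"
  then have "wnonpos (- f)" by (simp add: wnonpos_def)
  with f show "toep (exp f) * toep (exp (- f)) = 1" "toep (exp (- f)) * toep (exp f) = 1"
    by (simp_all add: toep_mult_nonpos wnonpos_exp)
next
  assume f: "wnonneg f"
  then have "wnonneg (- f)" by (simp add: wnonneg_def)
  with f show "toep (exp f) * toep (exp (- f)) = 1" "toep (exp (- f)) * toep (exp f) = 1"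
    by (simp_all add: toep_mult_nonneg wnonneg_exp)
qed

text \<open>
  For \<open>\<kappa> = 1\<close> the first columns of \<open>T(f)\<close> and of \<open>H(f t)\<close> coincide. Dropping the latter by \<open>e 0 = 0\<close>
  makes the matrix of \<open>f = 1\<close> the identity.
\<close>

locale basecase =
  fixes \<kappa> :: int and \<epsilon> :: complex and e :: "nat \<Rightarrow> complex"
  assumes cases: "(\<kappa>, \<epsilon>) \<in> {(0, 1), (0, -1), (-1, -1), (1, 1)}"
    and e_def: "e j = (if \<kappa> = 1 \<and> j = 0 then 0 else \<epsilon>)"
begin

definition M :: "wiener \<Rightarrow> smat" where "M f = toep f + hank e \<kappa> f"

lemma e_le [simp]: "norm (e j) \<le> 1"
  using cases by (auto simp: e_def)

lemma kappa_le: "\<kappa> \<le> 1" "- 1 \<le> \<kappa>"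
  using cases by auto

lemma ent_M: "ent (M f) i j = coef f (int i - int j) + e j * coef f (int i + int j + 1 - \<kappa>)"
  by (simp add: M_def)

lemma sbd_M: "sbd (M f) (2 * norm f)"
  unfolding M_def using sbd_add[OF sbd_toep sbd_hank, of e f \<kappa> f] by simp

lemma M_one: "M 1 = 1"
  by (rule smat_eqI) (use cases in \<open>auto simp: ent_M e_def\<close>)

text \<open>Row and summation indices are arbitrary integers: each column of \<open>M g\<close> is
  continued to negative rows, which makes the product a full convolution, to be cut or folded
  afterwards.\<close>

lemma conv_shift_M:
  fixes a :: int
  shows "((\<lambda>k. coef f (a - k) * (coef g (k - int j) + e j * coef g (k + int j + 1 - \<kappa>)))
      has_sum (coef (f * g) (a - int j) + e j * coef (f * g) (a + int j + 1 - \<kappa>))) UNIV"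
    and "(\<lambda>k. norm (coef f (a - k) * (coef g (k - int j) + e j * coef g (k + int j + 1 - \<kappa>)))) summable_on UNIV"
proof -
  let ?F = "\<lambda>k. coef f (a - k) * (coef g (k - int j) + e j * coef g (k + int j + 1 - \<kappa>))"
  let ?S = "coef (f * g) (a - int j) + e j * coef (f * g) (a + int j + 1 - \<kappa>)"
  have "((\<lambda>k. coef f (a - k) * coef g (k - int j) +
      e j * (coef f (a - k) * coef g (k - (\<kappa> - 1 - int j)))) has_sum
      (coef (f * g) (a - int j) + e j * coef (f * g) (a - (\<kappa> - 1 - int j)))) UNIV"
    by (intro has_sum_add has_sum_cmult_right conv_shift)
  moreover have "k - (\<kappa> - 1 - int j) = k + int j + 1 - \<kappa>" for k by simp
  ultimately show *: "(?F has_sum ?S) UNIV"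
    by (simp add: algebra_simps)
  then show "(\<lambda>k. norm (?F k)) summable_on UNIV"
    using summable_on_iff_abs_summable_on_complex[of ?F UNIV] has_sum_imp_summable by blast
qed

text \<open>Without positive frequencies in \<open>f\<close> the factor
  \<open>coef f (int i - k)\<close> vanishes for all negative \<open>k\<close>, so the full
  convolution already is the matrix product.\<close>

lemma toep_M:
  assumes "wnonpos f"
  shows "toep f * M g = M (f * g)"
proof (rule smat_eqI)
  fix i j
  let ?F = "\<lambda>k. coef f (int i - k) * (coef g (k - int j) + e j * coef g (k + int j + 1 - \<kappa>))"
  have "(?F has_sum ent (M (f * g)) i j) UNIV"
    unfolding ent_M by (rule conv_shift_M)
  also have "?this \<longleftrightarrow> (?F has_sum ent (M (f * g)) i j) {0..}"
    by (rule has_sum_cong_neutral) (use assms in \<open>auto simp: wnonpos_def\<close>)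
  finally have 1: "((\<lambda>k. ?F (int k)) has_sum ent (M (f * g)) i j) UNIV"
    unfolding has_sum_int_nat .
  have "((\<lambda>k. ?F (int k)) has_sum ent (toep f * M g) i j) UNIV"
    using ent_mult_has_sum[of "toep f" i "M g" j] by (simp add: ent_M)
  then show "ent (toep f * M g) i j = ent (M (f * g)) i j"
    using 1 by (rule has_sum_unique)
qed

text \<open>For even \<open>g\<close> the two terms of a continued column are exchanged by the
  reflection \<open>k \<mapsto> \<kappa> - 1 - k\<close>, up to the factor
  \<open>\<epsilon>\<close>. In column 0 for \<open>\<kappa> = 1\<close> only the Toeplitz term is
  present, and evenness alone suffices.\<close>

lemma reflect:
  assumes "wtilde g = g"
  shows "coef g ((\<kappa> - 1 - k) - int j) + e j * coef g ((\<kappa> - 1 - k) + int j + 1 - \<kappa>)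
    = \<epsilon> * (coef g (k - int j) + e j * coef g (k + int j + 1 - \<kappa>))"
proof -
  have ev: "coef g (- n) = coef g n" for n
    using assms by (metis coef_wtilde)
  have 1: "coef g ((\<kappa> - 1 - k) - int j) = coef g (k + int j + 1 - \<kappa>)"
    using ev[of "k + int j + 1 - \<kappa>"] by (simp add: algebra_simps)
  have 2: "coef g ((\<kappa> - 1 - k) + int j + 1 - \<kappa>) = coef g (k - int j)"
    using ev[of "k - int j"] by (simp add: algebra_simps)
  show ?thesis
    unfolding 1 2 using cases by (auto simp: e_def algebra_simps)
qed

text \<open>The negative half of the convolution, folded onto the nonnegative indices by
  \<open>reflect\<close>, supplies exactly the Hankel part of \<open>M f\<close>.\<close>

lemma M_mult:
  assumes "wtilde g = g"
  shows "M f * M g = M (f * g)"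
proof (rule smat_eqI)
  fix i j
  let ?G = "\<lambda>k. coef g (k - int j) + e j * coef g (k + int j + 1 - \<kappa>)"
  let ?F = "\<lambda>k. coef f (int i - k) * ?G k"
  have F: "(?F has_sum ent (M (f * g)) i j) UNIV"
    unfolding ent_M by (rule conv_shift_M)
  obtain t u where tu: "(?F has_sum t) {0..}" "(?F has_sum u) {..<0}" "ent (M (f * g)) i j = t + u"
    using has_sum_int_split[OF conv_shift_M(2) F] by blast
  \<comment> \<open>For \<open>\<kappa> = - 1\<close> the folded range starts at -1. This index is
    fixed by the reflection, and \<open>\<epsilon> = - 1\<close> makes the continued column vanish
    there.\<close>
  have fixpt: "?G (-1) = 0" if "\<kappa> = - 1"
    using reflect[OF assms, of "-1" j] that cases by auto
  \<comment> \<open>For \<open>\<kappa> = 1\<close> the folded range starts at 1; the zero put at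
    \<open>k = 0\<close> is the entry \<open>e 0\<close> of the Hankel part.\<close>
  let ?E = "\<lambda>k. (if \<kappa> = 1 \<and> k = 0 then 0 else \<epsilon>) * coef f (int i + k + 1 - \<kappa>) * ?G k"
  have "(?F has_sum u) {..<0} \<longleftrightarrow> ((\<lambda>k. \<epsilon> * coef f (int i + k + 1 - \<kappa>) * ?G k) has_sum u) {\<kappa>..}"
  proof (rule has_sum_reindex_bij_witness[where i = "\<lambda>k. \<kappa> - 1 - k" and j = "\<lambda>k. \<kappa> - 1 - k"])
    fix k
    have "?G k = \<epsilon> * ?G (\<kappa> - 1 - k)"
      using reflect[OF assms, of "\<kappa> - 1 - k" j] by simp
    then show "\<epsilon> * coef f (int i + (\<kappa> - 1 - k) + 1 - \<kappa>) * ?G (\<kappa> - 1 - k) = ?F k"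
      by (simp add: algebra_simps)
  qed auto
  also have "\<dots> \<longleftrightarrow> (?E has_sum u) {0..}"
  proof (rule has_sum_cong_neutral)
    fix k assume "k \<in> {\<kappa>..} - {0..}"
    then have "k = - 1" "\<kappa> = - 1" using kappa_le by auto
    then show "\<epsilon> * coef f (int i + k + 1 - \<kappa>) * ?G k = 0" using fixpt by simp
  next
    fix k assume "k \<in> {0..} - {\<kappa>..}"
    then have "k = 0" "\<kappa> = 1" using kappa_le by auto
    then show "?E k = 0" by simp
  qed auto
  finally have "(?E has_sum u) {0..}" using tu(2) by simp
  from has_sum_add[OF tu(1) this] have "((\<lambda>k. ?F k + ?E k) has_sum ent (M (f * g)) i j) {0..}"
    by (simp add: tu(3))
  then have 1: "((\<lambda>k. ?F (int k) + ?E (int k)) has_sum ent (M (f * g)) i j) UNIV"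
    unfolding has_sum_int_nat .
  have "((\<lambda>k. ent (M f) i k * ent (M g) k j) has_sum ent (M f * M g) i j) UNIV"
    by (rule ent_mult_has_sum)
  also have "(\<lambda>k. ent (M f) i k * ent (M g) k j) = (\<lambda>k. ?F (int k) + ?E (int k))"
    by (rule ext) (simp add: ent_M e_def algebra_simps)
  finally show "ent (M f * M g) i j = ent (M (f * g)) i j"
    using 1 by (rule has_sum_unique)
qed

end

text \<open>A rectangle of indices lies in a triangle, whose antidiagonal number \<open>m\<close>
  has \<open>Suc m\<close> elements.\<close>

lemma sum_square_le_triangle:
  fixes h :: "nat \<Rightarrow> real"
  assumes "\<And>m. 0 \<le> h m" "finite I" "finite J"
  shows "\<exists>n. (\<Sum>i\<in>I. \<Sum>j\<in>J. h (i + j)) \<le> (\<Sum>m\<le>n. real (Suc m) * h m)"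
proof -
  obtain a b where ab: "I \<subseteq> {..a}" "J \<subseteq> {..b}"
    using finite_nat_iff_bounded_le assms(2,3) by metis
  have "(\<Sum>i\<in>I. \<Sum>j\<in>J. h (i + j)) = (\<Sum>(i, j)\<in>I \<times> J. h (i + j))"
    by (simp add: sum.cartesian_product)
  also have "\<dots> \<le> (\<Sum>(i, j)\<in>{(i, j). i + j \<le> a + b}. h (i + j))"
  proof (rule sum_mono2)
    have "{(i, j). i + j \<le> a + b} \<subseteq> {..a + b} \<times> {..a + b}" by auto
    then show "finite {(i, j). i + j \<le> a + b}" by (rule finite_subset) simp
    show "I \<times> J \<subseteq> {(i, j). i + j \<le> a + b}" using ab by (auto intro!: add_mono)
  qed (use assms(1) in auto)
  also have "\<dots> = (\<Sum>m\<le>a + b. \<Sum>i\<le>m. h (i + (m - i)))"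
    by (rule sum.triangle_reindex_eq)
  also have "\<dots> = (\<Sum>m\<le>a + b. real (Suc m) * h m)"
    by (intro sum.cong) auto
  finally show ?thesis by blast
qed

text \<open>A Hankel matrix is constant on antidiagonals, up to the weights \<open>e\<close>, so its
  Hilbert-Schmidt norm is a sum of squares with weights \<open>Suc m\<close>. One factor is absorbed
  by the decay of the coefficients, the other one is summable.\<close>

lemma fro_hank_ex:
  assumes "wlip f" "\<kappa> \<le> 1" "\<And>j. norm (e j) \<le> 1"
  shows "\<exists>c. fro (hank e \<kappa> f) c"
proof -
  obtain C where C: "\<And>n. real_of_int \<bar>n\<bar> * norm (coef f n) \<le> C"
    using assms unfolding wlip_def by blast
  from C[of 0] have C0: "0 \<le> C" by simp
  \<comment> \<open>The weight \<open>Suc m\<close> exceeds the frequency \<open>m + ?s\<close> by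
    one if \<open>\<kappa> = 1\<close>; the summand \<open>norm f\<close> covers this.\<close>
  define D where "D = C + norm f"
  have D0: "0 \<le> D" by (simp add: D_def C0)
  let ?s = "nat (1 - \<kappa>)"
  have s: "int i + int j + 1 - \<kappa> = int (i + j + ?s)" for i j using assms(2) by simp
  have key: "real (Suc m) * (norm (coef f (int (m + ?s))))\<^sup>2 \<le> D * norm (coef f (int (m + ?s)))" for m
  proof -
    have "real (Suc m) * norm (coef f (int (m + ?s))) \<le> real_of_int \<bar>int (m + ?s)\<bar> * norm (coef f (int (m + ?s))) + norm (coef f (int (m + ?s)))"
      by (simp add: distrib_right mult_right_mono)
    also have "\<dots> \<le> D" unfolding D_def by (intro add_mono C norm_coef_le)
    finally have "real (Suc m) * norm (coef f (int (m + ?s))) * norm (coef f (int (m + ?s))) \<le> D * norm (coef f (int (m + ?s)))"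
      by (rule mult_right_mono) simp
    then show ?thesis by (simp only: power2_eq_square mult.assoc)
  qed
  have "fro (hank e \<kappa> f) (sqrt (D * norm f))"
  proof (rule froI)
    show "0 \<le> sqrt (D * norm f)" using D0 by simp
    fix I J :: "nat set" assume fin: "finite I" "finite J"
    have "(\<Sum>i\<in>I. \<Sum>j\<in>J. (norm (ent (hank e \<kappa> f) i j))\<^sup>2) \<le> (\<Sum>i\<in>I. \<Sum>j\<in>J. (norm (coef f (int ((i + j) + ?s))))\<^sup>2)"
      unfolding ent_hank[OF assms(3)] s
      by (intro sum_mono power_mono) (auto simp: norm_mult mult_left_le_one_le assms(3))
    also obtain n where "\<dots> \<le> (\<Sum>m\<le>n. real (Suc m) * (norm (coef f (int (m + ?s))))\<^sup>2)"
      using sum_square_le_triangle[OF _ fin, of "\<lambda>m. (norm (coef f (int (m + ?s))))\<^sup>2"] by auto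
    also have "(\<Sum>m\<le>n. real (Suc m) * (norm (coef f (int (m + ?s))))\<^sup>2) \<le> (\<Sum>m\<le>n. D * norm (coef f (int (m + ?s))))"
      by (rule sum_mono) (rule key)
    also have "\<dots> = D * (\<Sum>m\<le>n. norm (coef f (int (m + ?s))))"
      by (rule sum_distrib_left[symmetric])
    also have "\<dots> \<le> D * norm f"
      by (rule mult_left_mono[OF sum_coef_inj_le D0]) (auto simp: inj_on_def)
    finally show "(\<Sum>i\<in>I. \<Sum>j\<in>J. (norm (ent (hank e \<kappa> f) i j))\<^sup>2) \<le> (sqrt (D * norm f))\<^sup>2"
      using D0 by simp
  qed
  then show ?thesis by blast
qed

section \<open>Finite sections and determinants\<close>

definition sP :: "nat \<Rightarrow> smat" where
  "sP N = Abs_smat (\<lambda>i j. if i = j \<and> i < N then 1 else 0)"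

lemma schur_sP: "schur (\<lambda>i j. if i = j \<and> i < N then 1 else 0) 1"
proof (rule schurI)
  fix S :: "nat set" and i assume S: "finite S"
  have "(\<Sum>j\<in>S. norm (if i = j \<and> i < N then 1 else 0 :: complex)) \<le> (\<Sum>j\<in>S. if i = j then 1 else 0)"
    by (rule sum_mono) simp
  also have "\<dots> \<le> 1" using S by simp
  finally show "(\<Sum>j\<in>S. norm (if i = j \<and> i < N then 1 else 0 :: complex)) \<le> 1" .
  have "(\<Sum>j\<in>S. norm (if j = i \<and> j < N then 1 else 0 :: complex)) \<le> (\<Sum>j\<in>S. if i = j then 1 else 0)"
    by (rule sum_mono) simp
  also have "\<dots> \<le> 1" using S by simp
  finally show "(\<Sum>j\<in>S. norm (if j = i \<and> j < N then 1 else 0 :: complex)) \<le> 1" .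
qed

lemma ent_sP [simp]: "ent (sP N) i j = (if i = j \<and> i < N then 1 else 0)"
  unfolding sP_def by (subst Abs_smat_inverse) (use schur_sP in blast)+

lemma ent_sP_mult [simp]: "ent (sP N * X) i j = (if i < N then ent X i j else 0)"
proof -
  have "ent (sP N * X) i j = (\<Sum>\<^sub>\<infinity>k\<in>{i}. if i < N then ent X i j else 0)"
    unfolding ent_mult by (rule infsum_cong_neutral) auto
  then show ?thesis by simp
qed

lemma ent_mult_sP [simp]: "ent (X * sP N) i j = (if j < N then ent X i j else 0)"
proof -
  have "ent (X * sP N) i j = (\<Sum>\<^sub>\<infinity>k\<in>{j}. if j < N then ent X i j else 0)"
    unfolding ent_mult by (rule infsum_cong_neutral) auto
  then show ?thesis by simp
qed

lemma sP_idem [simp]: "sP N * sP N = sP N" "sP N * (sP N * X) = sP N * X"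
  by (rule smat_eqI; simp)+

definition sQ :: "nat \<Rightarrow> smat" where "sQ N = 1 - sP N"

lemma ent_sQ [simp]: "ent (sQ N) i j = (if i = j \<and> N \<le> i then 1 else 0)"
  by (simp add: sQ_def)

lemma ent_sQ_mult [simp]: "ent (sQ N * X) i j = (if N \<le> i then ent X i j else 0)"
  "ent (X * sQ N) i j = (if N \<le> j then ent X i j else 0)"
  by (simp_all add: sQ_def algebra_simps)

lemma fro_proj:
  assumes "fro X a"
  shows "fro (sP N * X) a" "fro (X * sP N) a" "fro (sQ N * X) a" "fro (X * sQ N) a"
  by (rule fro_le[OF assms], simp)+

lemma sbd_proj:
  assumes "sbd X a"
  shows "sbd (sP N * X) a" "sbd (X * sP N) a" "sbd (sQ N * X) a" "sbd (X * sQ N) a"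
  unfolding sbd_def by (rule schur_le[OF assms[unfolded sbd_def]], simp)+

lemma ent_mult_sP_mult: "ent (X * sP N * Y) i j = (\<Sum>k<N. ent X i k * ent Y k j)"
proof -
  have "ent (X * sP N * Y) i j = (\<Sum>\<^sub>\<infinity>k\<in>{..<N}. ent X i k * ent Y k j)"
    unfolding ent_mult[of "X * sP N"] by (rule infsum_cong_neutral) auto
  then show ?thesis by simp
qed

text \<open>The supremum of the square sums over finite blocks is nearly attained on some
  \<open>I0 \<times> J0\<close>. A block that avoids \<open>I0\<close> or \<open>J0\<close> can be
  added to it, hence contributes at most the gap.\<close>

lemma fro_tail:
  assumes "fro X a" "0 < \<epsilon>"
  shows "\<exists>N0. \<forall>N\<ge>N0. fro (sQ N * X) \<epsilon> \<and> fro (X * sQ N) \<epsilon>"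
proof -
  let ?s = "\<lambda>I J. \<Sum>i\<in>I. \<Sum>j\<in>J. (norm (ent X i j))\<^sup>2"
  define A where "A = (\<lambda>(I, J). ?s I J) ` {(I, J). finite I \<and> finite J}"
  have bdd: "bdd_above A"
    unfolding A_def by (rule bdd_aboveI2[where M = "a\<^sup>2"]) (auto intro: froD[OF assms(1)])
  have ne: "A \<noteq> {}" by (auto simp: A_def)
  have "Sup A - \<epsilon>\<^sup>2 < Sup A" using assms(2) by simp
  then obtain y where y: "y \<in> A" "Sup A - \<epsilon>\<^sup>2 < y"
    using less_cSup_iff[OF ne bdd, of "Sup A - \<epsilon>\<^sup>2"] by blast
  from y(1) obtain I0 J0 where "finite I0" "finite J0" "y = ?s I0 J0"
    by (auto simp: A_def)
  with y(2) have 0: "finite I0" "finite J0" "Sup A - \<epsilon>\<^sup>2 < ?s I0 J0"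
    by simp_all
  obtain N0 where N0: "I0 \<subseteq> {..<N0}" "J0 \<subseteq> {..<N0}"
  proof -
    obtain p q where "I0 \<subseteq> {..<p}" "J0 \<subseteq> {..<q}"
      using finite_nat_iff_bounded 0(1,2) by metis
    then have "I0 \<subseteq> {..<max p q}" "J0 \<subseteq> {..<max p q}" by (auto simp: less_max_iff_disj)
    with that show ?thesis by blast
  qed
  have key: "?s I J \<le> \<epsilon>\<^sup>2" if "finite I" "finite J" "I \<inter> I0 = {} \<or> J \<inter> J0 = {}" for I J
  proof -
    have "?s I J + ?s I0 J0 = (\<Sum>(i, j)\<in>I \<times> J \<union> I0 \<times> J0. (norm (ent X i j))\<^sup>2)"
      using that 0 by (subst sum.union_disjoint) (auto simp: sum.cartesian_product)
    also have "\<dots> \<le> (\<Sum>(i, j)\<in>(I \<union> I0) \<times> (J \<union> J0). (norm (ent X i j))\<^sup>2)"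
      using that 0 by (intro sum_mono2) auto
    also have "\<dots> = ?s (I \<union> I0) (J \<union> J0)"
      by (simp add: sum.cartesian_product)
    also have "\<dots> \<le> Sup A"
      using that 0 by (intro cSup_upper[OF _ bdd]) (auto simp: A_def)
    finally show ?thesis using 0(3) by simp
  qed
  have "fro (sQ N * X) \<epsilon>" "fro (X * sQ N) \<epsilon>" if "N \<ge> N0" for N
  proof -
    have z: "(norm (if b then z else 0))\<^sup>2 = (if b then (norm z)\<^sup>2 else 0)" for b and z :: complex by simp
    show "fro (sQ N * X) \<epsilon>"
    proof (rule froI)
      fix I J :: "nat set" assume fin: "finite I" "finite J"
      have "(\<Sum>i\<in>I. \<Sum>j\<in>J. (norm (ent (sQ N * X) i j))\<^sup>2) = (\<Sum>i\<in>I. if N \<le> i then \<Sum>j\<in>J. (norm (ent X i j))\<^sup>2 else 0)"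
        by (intro sum.cong) auto
      also have "\<dots> = ?s {i \<in> I. N \<le> i} J"
        using fin by (simp add: sum.inter_filter)
      also have "\<dots> \<le> \<epsilon>\<^sup>2" by (rule key) (use fin N0 that in auto)
      finally show "(\<Sum>i\<in>I. \<Sum>j\<in>J. (norm (ent (sQ N * X) i j))\<^sup>2) \<le> \<epsilon>\<^sup>2" .
    qed (use assms in simp)
    show "fro (X * sQ N) \<epsilon>"
    proof (rule froI)
      fix I J :: "nat set" assume fin: "finite I" "finite J"
      have "(\<Sum>i\<in>I. \<Sum>j\<in>J. (norm (ent (X * sQ N) i j))\<^sup>2) = ?s I {j \<in> J. N \<le> j}"
        unfolding ent_sQ_mult z using fin by (simp add: sum.inter_filter)
      also have "\<dots> \<le> \<epsilon>\<^sup>2" by (rule key) (use fin N0 that in auto)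
      finally show "(\<Sum>i\<in>I. \<Sum>j\<in>J. (norm (ent (X * sQ N) i j))\<^sup>2) \<le> \<epsilon>\<^sup>2" .
    qed (use assms in simp)
  qed
  then show ?thesis by blast
qed

section \<open>Determinants of finite sections\<close>

abbreviation sdet :: "nat \<Rightarrow> smat \<Rightarrow> complex" where "sdet N X \<equiv> det_P N (ent X)"

lemma det_P_cong: "(\<And>i j. i < N \<Longrightarrow> j < N \<Longrightarrow> A i j = B i j) \<Longrightarrow> det_P N A = det_P N B"
  unfolding det_P_def by (rule arg_cong[where f = Determinant.det]) (rule eq_matI, auto)

lemma det_P_mult:
  "det_P N (\<lambda>i j. \<Sum>k<N. A i k * B k j) = det_P N A * det_P N B"
proof -
  let ?m = "\<lambda>A. Matrix.mat N N (\<lambda>(i, j). A i j)"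
  have "?m (\<lambda>i j. \<Sum>k<N. A i k * B k j) = ?m A * ?m B"
    by (rule eq_matI) (auto simp: scalar_prod_def lessThan_atLeast0)
  moreover have "Determinant.det (?m A * ?m B) = Determinant.det (?m A) * Determinant.det (?m B)"
    by (rule det_mult[of _ N]) auto
  ultimately show ?thesis unfolding det_P_def by simp
qed

lemma sdet_mult: "sdet N (X * sP N * Y) = sdet N X * sdet N Y"
  unfolding det_P_mult[symmetric] by (rule det_P_cong) (simp add: ent_mult_sP_mult)

lemma det_P_upper:
  assumes "\<And>i j. j < i \<Longrightarrow> A i j = 0" "\<And>i. A i i = 1"
  shows "det_P N A = 1"
  unfolding det_P_def
  by (subst det_upper_triangular[of _ N]) (auto simp: assms prod_list_diag_prod)

lemma det_P_sum: "det_P N A = (\<Sum>p | p permutes {0..<N}. signof p * (\<Prod>i = 0..<N. A i (p i)))"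
  unfolding det_P_def
  by (subst det_def'[of _ N]) (auto intro!: sum.cong prod.cong simp: permutes_in_image)

text \<open>The derivative of the determinant at \<open>A\<close> in the direction \<open>B\<close>,
  written out by the Leibniz formula so that it makes sense for singular \<open>A\<close>.\<close>

definition det_dir :: "nat \<Rightarrow> inf_mat \<Rightarrow> inf_mat \<Rightarrow> complex" where
  "det_dir N A B = (\<Sum>p | p permutes {0..<N}. signof p *
     (\<Sum>i = 0..<N. B i (p i) * (\<Prod>j\<in>{0..<N} - {i}. A j (p j))))"

lemma has_vector_derivative_prod:
  fixes f :: "'a \<Rightarrow> real \<Rightarrow> 'b :: real_normed_field"
  assumes "\<And>i. i \<in> I \<Longrightarrow> (f i has_vector_derivative f' i) (at x within S)"
  shows "((\<lambda>x. \<Prod>i\<in>I. f i x) has_vector_derivative (\<Sum>i\<in>I. f' i * (\<Prod>j\<in>I - {i}. f j x))) (at x within S)"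
  using has_derivative_prod[of I f "\<lambda>i h. h *\<^sub>R f' i" x S] assms
  by (simp add: has_vector_derivative_def scaleR_sum_right)

lemma det_P_has_vector_derivative:
  assumes "\<And>i j. i < N \<Longrightarrow> j < N \<Longrightarrow> ((\<lambda>s. A s i j) has_vector_derivative B i j) (at s within S)"
  shows "((\<lambda>s. det_P N (A s)) has_vector_derivative det_dir N (A s) B) (at s within S)"
  unfolding det_P_sum det_dir_def
  by (intro has_vector_derivative_sum has_vector_derivative_mult_right has_vector_derivative_prod assms)
     (auto simp: permutes_in_image)

lemma det_dir_one: "det_dir N (\<lambda>i j. if i = j then 1 else 0) B = (\<Sum>i<N. B i i)"
proof -
  have "(\<Sum>i = 0..<N. B i (p i) * (\<Prod>j\<in>{0..<N} - {i}. if j = p j then 1 else 0)) = 0"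
    if p: "p permutes {0..<N}" "p \<noteq> id" for p
  proof (rule sum.neutral, rule ballI)
    fix i assume i: "i \<in> {0..<N}"
    \<comment> \<open>A permutation cannot move exactly one point, so some off-diagonal entry of the
      identity matrix occurs among the remaining factors.\<close>
    have "\<exists>j\<in>{0..<N} - {i}. p j \<noteq> j"
    proof (rule ccontr)
      assume "\<not> ?thesis"
      then have *: "p j = j" if "j \<noteq> i" for j
        using p(1) that by (cases "j \<in> {0..<N}") (auto simp: permutes_not_in)
      then have "p i = i" using permutes_inj[OF p(1)] by (metis injD)
      with * have "p = id" by (metis eq_id_iff)
      with p(2) show False by simp
    qed
    then show "B i (p i) * (\<Prod>j\<in>{0..<N} - {i}. if j = p j then 1 else 0) = 0" by auto
  qed
  then have "det_dir N (\<lambda>i j. if i = j then 1 else 0) B =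
      (\<Sum>p\<in>{id}. signof p * (\<Sum>i = 0..<N. B i (p i) * (\<Prod>j\<in>{0..<N} - {i}. if j = p j then 1 else 0)))"
    unfolding det_dir_def
    by (intro sum.mono_neutral_right) (auto simp: finite_permutations permutes_id)
  then show ?thesis by (simp add: lessThan_atLeast0)
qed

text \<open>Jacobi's formula: both sides are the derivative at \<open>0\<close> of \<open>t \<mapsto> det (A (1 + t G))\<close>.\<close>

lemma det_dir_mult: "det_dir N A (\<lambda>i j. \<Sum>k<N. A i k * G k j) = det_P N A * (\<Sum>i<N. G i i)"
proof -
  let ?I = "\<lambda>i j. if i = j then 1 else 0 :: complex"
  let ?E = "\<lambda>t i j. ?I i j + complex_of_real t * G i j"
  have E: "((\<lambda>t. ?E t i j) has_vector_derivative G i j) (at 0)" for i j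
    by (auto intro!: derivative_eq_intros)
  have "((\<lambda>t. \<Sum>k<N. A i k * ?E t k j) has_vector_derivative (\<Sum>k<N. A i k * G k j)) (at 0)" for i j
    by (intro has_vector_derivative_sum has_vector_derivative_mult_right E)
  from det_P_has_vector_derivative[where A = "\<lambda>t i j. \<Sum>k<N. A i k * ?E t k j" and N = N, OF this]
  have 1: "((\<lambda>t. det_P N A * det_P N (?E t)) has_vector_derivative
      det_dir N (\<lambda>i j. \<Sum>k<N. A i k * ?I k j) (\<lambda>i j. \<Sum>k<N. A i k * G k j)) (at 0)"
    by (simp only: det_P_mult of_real_0 mult_zero_left add_0_right)
  from det_P_has_vector_derivative[where A = ?E and N = N and S = UNIV and s = 0, OF E]
  have "((\<lambda>t. det_P N (?E t)) has_vector_derivative det_dir N ?I G) (at 0)"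
    by (simp only: of_real_0 mult_zero_left add_0_right)
  then have 2: "((\<lambda>t. det_P N A * det_P N (?E t)) has_vector_derivative
      det_P N A * det_dir N ?I G) (at 0)"
    by (rule has_vector_derivative_mult_right)
  have "det_dir N (\<lambda>i j. \<Sum>k<N. A i k * ?I k j) (\<lambda>i j. \<Sum>k<N. A i k * G k j) =
      det_dir N A (\<lambda>i j. \<Sum>k<N. A i k * G k j)"
    unfolding det_dir_def
    by (intro sum.cong arg_cong2[where f = times] prod.cong refl)
       (auto simp: permutes_in_image if_distrib[of "times _"] cong: if_cong)
  then show ?thesis
    using vector_derivative_unique_at[OF 1 2] by (simp only: det_dir_one)
qed

text \<open>Jacobi's identity for complementary minors, without an inverse matrix: replacing the
  first \<open>l\<close> columns of the identity by those of \<open>Y\<close> gives a block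
  triangular \<open>?W\<close> with determinant \<open>det_P l Y\<close>, and \<open>X\<close> times
  \<open>?W\<close> has unit vectors as its first \<open>l\<close> columns.\<close>

lemma det_P_minor:
  assumes "\<And>i j. i < l + m \<Longrightarrow> j < l + m \<Longrightarrow> (\<Sum>k<l + m. X i k * Y k j) = (if i = j then 1 else 0)"
  shows "det_P (l + m) X * det_P l Y = det_P m (\<lambda>i j. X (i + l) (j + l))"
proof -
  let ?W = "\<lambda>i j. if j < l then Y i j else if i = j then 1 else 0"
  let ?m = "\<lambda>r c A. Matrix.mat r c (\<lambda>(i, j). A i j)"
  have W: "?m (l + m) (l + m) ?W = four_block_mat (?m l l Y) (0\<^sub>m l m) (?m m l (\<lambda>i j. Y (i + l) j)) (1\<^sub>m m)"
    by (rule eq_matI) (auto simp: four_block_mat_def Let_def)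
  have detW: "det_P (l + m) ?W = det_P l Y"
    unfolding det_P_def W by (subst det_four_block_mat_upper_right_zero[of _ l _ m]) auto
  let ?R = "\<lambda>i j. if j < l then (if i = j then 1 else 0) else X i j"
  have "det_P (l + m) X * det_P (l + m) ?W = det_P (l + m) (\<lambda>i j. \<Sum>k<l + m. X i k * ?W k j)"
    by (rule det_P_mult[symmetric])
  also have "\<dots> = det_P (l + m) ?R"
  proof (rule det_P_cong)
    fix i j assume ij: "i < l + m" "j < l + m"
    show "(\<Sum>k<l + m. X i k * ?W k j) = ?R i j"
      using ij assms[OF ij] by (auto simp: if_distrib[of "times _"] cong: if_cong)
  qed
  also have R: "?m (l + m) (l + m) ?R = four_block_mat (1\<^sub>m l) (?m l m (\<lambda>i j. X i (j + l))) (0\<^sub>m m l) (?m m m (\<lambda>i j. X (i + l) (j + l)))"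
    by (rule eq_matI) (auto simp: four_block_mat_def Let_def)
  have "det_P (l + m) ?R = det_P m (\<lambda>i j. X (i + l) (j + l))"
    unfolding det_P_def R by (subst det_four_block_mat_lower_left_zero[of _ l _ m]) auto
  finally show ?thesis by (simp add: detW)
qed

text \<open>A vector in the kernel of the section of \<open>1 + X\<close> would equal minus its
  image under the section of \<open>X\<close>, so its squared length would be at most a quarter of
  itself. The determinant is therefore nonzero.\<close>

lemma finite_inverse_ex:
  assumes "fro (sP N * X * sP N) (1/2)"
  shows "\<exists>D. sP N * D = D \<and> D * sP N = D \<and> (sP N + sP N * X * sP N) * D = sP N"
proof -
  let ?f = "\<lambda>(i, j). (if i = j then 1 else 0) + ent X i j"
  let ?A = "Matrix.mat N N ?f"
  have A: "?A \<in> carrier_mat N N" by simp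
  have "Determinant.det ?A \<noteq> 0"
  proof
    assume "Determinant.det ?A = 0"
    then obtain v where v: "v \<in> carrier_vec N" "v \<noteq> 0\<^sub>v N" "?A *\<^sub>v v = 0\<^sub>v N"
      using det_0_iff_vec_prod_zero_field[OF A] by blast
    have eq: "v $ i = - (\<Sum>j<N. ent X i j * v $ j)" if "i < N" for i
    proof -
      have "0 = (?A *\<^sub>v v) $ i" using v(3) that by simp
      also have "\<dots> = (\<Sum>j<N. ((if i = j then 1 else 0) + ent X i j) * v $ j)"
        using that v(1) by (simp add: scalar_prod_def lessThan_atLeast0)
      also have "\<dots> = v $ i + (\<Sum>j<N. ent X i j * v $ j)"
        using that by (simp add: distrib_right sum.distrib if_distrib[of "\<lambda>x. x * _"] cong: if_cong)
      finally show ?thesis by (simp add: eq_neg_iff_add_eq_0)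
    qed
    let ?n = "\<Sum>i<N. (norm (v $ i))\<^sup>2"
    have "?n \<le> (\<Sum>i<N. (\<Sum>j<N. (norm (ent X i j))\<^sup>2) * ?n)"
    proof (rule sum_mono)
      fix i assume "i \<in> {..<N}"
      then have "norm (v $ i) \<le> (\<Sum>j<N. norm (ent X i j) * norm (v $ j))"
        using eq[of i] norm_sum[of "\<lambda>j. ent X i j * v $ j" "{..<N}"] by (simp add: norm_mult)
      then have "(norm (v $ i))\<^sup>2 \<le> (\<Sum>j<N. norm (ent X i j) * norm (v $ j))\<^sup>2"
        by (rule power_mono) simp
      also have "\<dots> \<le> (\<Sum>j<N. (norm (ent X i j))\<^sup>2) * ?n"
        by (rule Cauchy_Schwarz_ineq_sum)
      finally show "(norm (v $ i))\<^sup>2 \<le> (\<Sum>j<N. (norm (ent X i j))\<^sup>2) * ?n" .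
    qed
    also have "\<dots> = (\<Sum>i<N. \<Sum>j<N. (norm (ent X i j))\<^sup>2) * ?n"
      by (simp add: sum_distrib_right)
    also have "\<dots> \<le> (1/2)\<^sup>2 * ?n"
    proof (rule mult_right_mono)
      have "(\<Sum>i<N. \<Sum>j<N. (norm (ent (sP N * X * sP N) i j))\<^sup>2) \<le> (1/2)\<^sup>2"
        by (rule froD[OF assms]) auto
      then show "(\<Sum>i<N. \<Sum>j<N. (norm (ent X i j))\<^sup>2) \<le> (1/2)\<^sup>2" by simp
    qed (simp add: sum_nonneg)
    finally have "?n \<le> 0" by (simp add: power2_eq_square)
    then have "?n = 0" by (simp add: sum_nonneg order_antisym)
    then have "v $ i = 0" if "i < N" for i
      using that by (simp add: sum_nonneg_eq_0_iff)
    then have "v = 0\<^sub>v N" using v(1) by (intro eq_vecI) auto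
    with v(2) show False by simp
  qed
  from det_non_zero_imp_unit[OF A this, of "()"] obtain B
    where B: "B \<in> carrier_mat N N" "?A * B = 1\<^sub>m N"
    by (auto simp: Units_def ring_mat_simps)
  \<comment> \<open>The inverse of the section is extended by zeros, to live in the same ring as the
    other matrices.\<close>
  let ?d = "\<lambda>i j. if i < N \<and> j < N then B $$ (i, j) else 0"
  have "schur ?d (\<Sum>i<N. \<Sum>j<N. norm (B $$ (i, j)))"
  proof (rule schurI)
    fix S :: "nat set" and i assume S: "finite S"
    have "(\<Sum>j\<in>S. norm (?d i j)) = (\<Sum>j\<in>S \<inter> {..<N}. norm (?d i j))"
      using S by (intro sum.mono_neutral_right) auto
    also have "\<dots> \<le> (\<Sum>j<N. norm (?d i j))"
      by (rule sum_mono2) auto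
    also have "\<dots> \<le> (\<Sum>i<N. \<Sum>j<N. norm (B $$ (i, j)))"
      by (cases "i < N") (auto intro!: sum_nonneg member_le_sum[of i "{..<N}" "\<lambda>i. \<Sum>j<N. norm (B $$ (i, j))", simplified])
    finally show "(\<Sum>j\<in>S. norm (?d i j)) \<le> (\<Sum>i<N. \<Sum>j<N. norm (B $$ (i, j)))" .
    have "(\<Sum>j\<in>S. norm (?d j i)) = (\<Sum>j\<in>S \<inter> {..<N}. norm (?d j i))"
      using S by (intro sum.mono_neutral_right) auto
    also have "\<dots> \<le> (\<Sum>j<N. norm (?d j i))"
      by (rule sum_mono2) auto
    also have "\<dots> \<le> (\<Sum>j<N. \<Sum>i<N. norm (B $$ (j, i)))"
      by (rule sum_mono) (auto intro!: sum_nonneg member_le_sum[of i "{..<N}" "\<lambda>i. norm (B $$ (_, i))", simplified])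
    finally show "(\<Sum>j\<in>S. norm (?d j i)) \<le> (\<Sum>i<N. \<Sum>j<N. norm (B $$ (i, j)))" .
  qed
  then have ent_D: "ent (Abs_smat ?d) = ?d"
    by (intro Abs_smat_inverse) blast
  define D where "D = Abs_smat ?d"
  have D: "ent D i j = ?d i j" for i j by (simp add: D_def ent_D)
  have "sP N * D = D" "D * sP N = D"
    by (rule smat_eqI, simp add: D)+
  moreover have "(sP N + sP N * X * sP N) * D = sP N"
  proof (rule smat_eqI)
    fix i j
    have "(sP N + sP N * X * sP N) * D = (sP N + sP N * X * sP N) * sP N * D"
      using \<open>sP N * D = D\<close> by (simp add: mult.assoc)
    then have "ent ((sP N + sP N * X * sP N) * D) i j = (\<Sum>k<N. ent (sP N + sP N * X * sP N) i k * ?d k j)"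
      by (simp only: ent_mult_sP_mult D)
    also have "\<dots> = ent (sP N) i j"
    proof (cases "i < N \<and> j < N")
      case True
      then have "(\<Sum>k<N. ent (sP N + sP N * X * sP N) i k * ?d k j) = (?A * B) $$ (i, j)"
        using B(1) by (auto simp: scalar_prod_def lessThan_atLeast0 intro!: sum.cong)
      then show ?thesis using True by (simp add: B(2))
    qed auto
    finally show "ent ((sP N + sP N * X * sP N) * D) i j = ent (sP N) i j" .
  qed
  ultimately show ?thesis by blast
qed

section \<open>Asymptotics of the determinants of shifted sections\<close>

text \<open>Entrywise majorants turn pointwise statements into uniform ones: the tails of a single
  Hilbert-Schmidt majorant bound the tails of a whole family in \<open>s\<close>.\<close>

definition mdom :: "smat \<Rightarrow> smat \<Rightarrow> bool" where
  "mdom X Y \<longleftrightarrow> (\<forall>i j. ent Y i j = complex_of_real (Re (ent Y i j)) \<and> norm (ent X i j) \<le> Re (ent Y i j))"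

lemma mdom_norm: "mdom X Y \<Longrightarrow> norm (ent X i j) \<le> norm (ent Y i j)"
  unfolding mdom_def by (meson complex_Re_le_cmod order_trans)

lemma mdom_toep: "wdom f g \<Longrightarrow> mdom (toep f) (toep g)"
  by (simp add: mdom_def wdom_def)

lemma mdom_hank:
  assumes "wdom f g" "\<And>j. norm (e j) \<le> 1"
  shows "mdom (hank e \<kappa> f) (hank (\<lambda>_. 1) \<kappa> g)"
  unfolding mdom_def
proof (intro allI conjI)
  fix i j
  let ?n = "int i + int j + 1 - \<kappa>"
  show "ent (hank (\<lambda>_. 1) \<kappa> g) i j = complex_of_real (Re (ent (hank (\<lambda>_. 1) \<kappa> g) i j))"
    using wdomD(2)[OF assms(1), of ?n] by simp
  have "norm (e j * coef f ?n) \<le> 1 * norm (coef f ?n)"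
    unfolding norm_mult by (rule mult_right_mono[OF assms(2)]) simp
  also have "\<dots> \<le> Re (coef g ?n)" using wdomD(1)[OF assms(1)] by simp
  finally show "norm (ent (hank e \<kappa> f) i j) \<le> Re (ent (hank (\<lambda>_. 1) \<kappa> g) i j)"
    by (simp add: assms(2))
qed

lemma mdom_add:
  assumes "mdom X X'" "mdom Y Y'"
  shows "mdom (X + Y) (X' + Y')" "mdom (X - Y) (X' + Y')"
proof -
  have *: "norm (ent X i j) \<le> Re (ent X' i j)" "norm (ent Y i j) \<le> Re (ent Y' i j)"
    "Im (ent X' i j) = 0" "Im (ent Y' i j) = 0" for i j
    using assms unfolding mdom_def by (auto simp: complex_eq_iff)
  show "mdom (X + Y) (X' + Y')" "mdom (X - Y) (X' + Y')"
    unfolding mdom_def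
    using order_trans[OF norm_triangle_ineq add_mono[OF *(1,2)]]
      order_trans[OF norm_triangle_ineq4 add_mono[OF *(1,2)]]
    by (auto simp: complex_eq_iff *(3,4))
qed

lemma mdom_mult:
  assumes "mdom X X'" "mdom Y Y'"
  shows "mdom (X * Y) (X' * Y')"
  unfolding mdom_def
proof (intro allI conjI)
  fix i j
  let ?a = "\<lambda>k. Re (ent X' i k) * Re (ent Y' k j)"
  have *: "norm (ent X i j) \<le> Re (ent X' i j)" "norm (ent Y i j) \<le> Re (ent Y' i j)"
    "ent X' i j = complex_of_real (Re (ent X' i j))" "ent Y' i j = complex_of_real (Re (ent Y' i j))" for i j
    using assms unfolding mdom_def by auto
  have eq: "ent X' i k * ent Y' k j = complex_of_real (?a k)" for k
    by (metis *(3,4) of_real_mult)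
  have nn: "0 \<le> Re (ent X' i k)" "0 \<le> Re (ent Y' k j)" for k
    using *(1,2) norm_ge_zero order_trans by metis+
  have c: "((\<lambda>k. complex_of_real (?a k)) has_sum ent (X' * Y') i j) UNIV"
    using ent_mult_has_sum[of X' i Y' j] unfolding eq .
  from has_sum_Re[OF this] have r: "(?a has_sum Re (ent (X' * Y') i j)) UNIV"
    by (simp del: of_real_mult)
  have "((\<lambda>k. complex_of_real (?a k)) has_sum complex_of_real (Re (ent (X' * Y') i j))) UNIV"
    by (rule has_sum_of_real[OF r])
  with c show "ent (X' * Y') i j = complex_of_real (Re (ent (X' * Y') i j))"
    by (rule has_sum_unique)
  show "norm (ent (X * Y) i j) \<le> Re (ent (X' * Y') i j)"
    by (rule norm_infsum_le[OF ent_mult_has_sum r]) (auto simp: norm_mult intro!: mult_mono * nn)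
qed

text \<open>Reversing the rows below \<open>N\<close> and shifting the columns from \<open>N\<close>
  on is injective on pairs of indices. Bounds of a matrix free of \<open>N\<close> are carried over
  to corner blocks that move with \<open>N\<close>.\<close>

lemma fro_flip:
  assumes "fro X c" "\<And>i j. norm (ent Y i j) \<le> (if i < N \<and> N \<le> j then norm (ent X (N - Suc i) (j - N)) else 0)"
  shows "fro Y c"
proof (rule froI)
  show "0 \<le> c" by (rule fro_nonneg[OF assms(1)])
  fix I J :: "nat set" assume fin: "finite I" "finite J"
  let ?I = "{i \<in> I. i < N}" and ?J = "{j \<in> J. N \<le> j}"
  have "(\<Sum>i\<in>I. \<Sum>j\<in>J. (norm (ent Y i j))\<^sup>2) \<le>
      (\<Sum>i\<in>I. \<Sum>j\<in>J. if i < N \<and> N \<le> j then (norm (ent X (N - Suc i) (j - N)))\<^sup>2 else 0)"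
  proof (intro sum_mono)
    fix i j
    have "(norm (ent Y i j))\<^sup>2 \<le> (if i < N \<and> N \<le> j then norm (ent X (N - Suc i) (j - N)) else 0)\<^sup>2"
      by (rule power_mono[OF assms(2)]) simp
    then show "(norm (ent Y i j))\<^sup>2 \<le> (if i < N \<and> N \<le> j then (norm (ent X (N - Suc i) (j - N)))\<^sup>2 else 0)"
      by (simp split: if_splits)
  qed
  also have "\<dots> = (\<Sum>i\<in>I. if i < N then \<Sum>j\<in>?J. (norm (ent X (N - Suc i) (j - N)))\<^sup>2 else 0)"
    using fin by (intro sum.cong) (auto simp: sum.inter_filter)
  also have "\<dots> = (\<Sum>i\<in>?I. \<Sum>j\<in>?J. (norm (ent X (N - Suc i) (j - N)))\<^sup>2)"
    by (rule sum.inter_filter[symmetric]) (rule fin(1))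
  also have "\<dots> = (\<Sum>p\<in>(\<lambda>i. N - Suc i) ` ?I. \<Sum>j\<in>?J. (norm (ent X p (j - N)))\<^sup>2)"
    by (subst sum.reindex) (auto simp: inj_on_def)
  also have "\<dots> = (\<Sum>p\<in>(\<lambda>i. N - Suc i) ` ?I. \<Sum>q\<in>(\<lambda>j. j - N) ` ?J. (norm (ent X p q))\<^sup>2)"
    by (subst sum.reindex) (auto simp: inj_on_def)
  also have "\<dots> \<le> c\<^sup>2"
    by (rule froD[OF assms(1)]) (use fin in auto)
  finally show "(\<Sum>i\<in>I. \<Sum>j\<in>J. (norm (ent Y i j))\<^sup>2) \<le> c\<^sup>2" .
qed

text \<open>The mean value inequality bounds the distance to 1 by \<epsilon> times the maximum of
  the modulus, and this maximum is then at most 2. No logarithm of \<open>u\<close> is formed, so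
  zeros of \<open>u\<close> need not be excluded beforehand.\<close>

lemma gronwall_unit:
  fixes u :: "real \<Rightarrow> complex"
  assumes der: "\<And>s. s \<in> {0..1} \<Longrightarrow> (u has_vector_derivative u' s) (at s within {0..1})"
    and bd: "\<And>s. s \<in> {0..1} \<Longrightarrow> norm (u' s) \<le> \<epsilon> * norm (u s)"
    and "u 0 = 1" "\<epsilon> \<le> 1/2" "0 \<le> \<epsilon>"
  shows "norm (u 1 - 1) \<le> 2 * \<epsilon>"
proof -
  have cont: "continuous_on {0..1} (\<lambda>s. norm (u s))"
    by (rule continuous_on_norm, unfold continuous_on_eq_continuous_within, rule ballI)
      (rule has_vector_derivative_continuous[OF der])
  obtain s1 where s1: "s1 \<in> {0..1}" "\<And>s. s \<in> {0..1} \<Longrightarrow> norm (u s) \<le> norm (u s1)"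
    using continuous_attains_sup[OF _ _ cont] by auto
  have le: "norm (u s - 1) \<le> \<epsilon> * norm (u s1)" if s: "s \<in> {0..1}" for s
  proof -
    have "norm (u s - u 0) \<le> (\<epsilon> * norm (u s1)) * norm (s - 0)"
    proof (rule differentiable_bound[where S = "{0..1}" and f' = "\<lambda>s h. h *\<^sub>R u' s"])
      fix x :: real assume x: "x \<in> {0..1}"
      show "(u has_derivative (\<lambda>h. h *\<^sub>R u' x)) (at x within {0..1})"
        using der[OF x] by (simp add: has_vector_derivative_def)
      have "norm (u' x) \<le> \<epsilon> * norm (u s1)"
        using bd[OF x] mult_left_mono[OF s1(2)[OF x] assms(5)] by simp
      then show "onorm (\<lambda>h. h *\<^sub>R u' x) \<le> \<epsilon> * norm (u s1)"
        by (intro onorm_le) (simp add: mult.commute mult_left_mono)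
    qed (use s in auto)
    also have "\<dots> \<le> \<epsilon> * norm (u s1)"
      using s assms(5) by (simp add: mult_left_le)
    finally show ?thesis using assms(3) by simp
  qed
  have "norm (u s1) \<le> 1 + \<epsilon> * norm (u s1)"
    using le[OF s1(1)] norm_triangle_ineq2[of "u s1" 1] by simp
  also have "\<dots> \<le> 1 + 1/2 * norm (u s1)"
    using assms(4) by (intro add_left_mono mult_right_mono) auto
  finally have "norm (u s1) \<le> 2" by simp
  then have "\<epsilon> * norm (u s1) \<le> \<epsilon> * 2" by (rule mult_left_mono) (rule assms(5))
  with le[of 1] show ?thesis by simp
qed

section \<open>Inverting sections uniformly along the deformation\<close>

locale symbol_splitting = basecase +
  fixes \<mu> b :: wiener
  assumes mu: "wnonpos \<mu>" "coef \<mu> 0 = 0" "wlip \<mu>"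
    and b: "wnonneg b" "coef b 0 = 0" "wlip b"
begin

text \<open>
  \<open>B s * C s = 1\<close> and \<open>C s = 1 - K s\<close>, where \<open>K s\<close> is Hilbert-Schmidt; hence so is \<open>B s - 1\<close>.
\<close>

definition \<beta> :: wiener where "\<beta> = b + wtilde b"
definition A :: "real \<Rightarrow> smat" where "A s = M (exp (\<mu> + s *\<^sub>R \<beta>))"
text \<open>Exponent of the upper triangular factor; the lower one has \<open>s *\<^sub>R b\<close>.
  The two exponents together make up \<open>\<mu> + s *\<^sub>R \<beta>\<close>, and
  \<open>lf s\<close> below is \<open>lc s - s *\<^sub>R \<beta>\<close>, the exponent that appears
  when the outer factors are moved to the inverse.\<close>

definition lc :: "real \<Rightarrow> wiener" where "lc s = \<mu> + s *\<^sub>R wtilde b"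
definition lf :: "real \<Rightarrow> wiener" where "lf s = \<mu> - s *\<^sub>R b"
definition U :: "real \<Rightarrow> smat" where "U s = toep (exp (lc s))"
definition Ui :: "real \<Rightarrow> smat" where "Ui s = toep (exp (- lc s))"
definition L :: "real \<Rightarrow> smat" where "L s = toep (exp (s *\<^sub>R b))"
definition Li :: "real \<Rightarrow> smat" where "Li s = toep (exp (- (s *\<^sub>R b)))"
definition B :: "real \<Rightarrow> smat" where "B s = Li s * A s * Ui s"
definition C :: "real \<Rightarrow> smat" where "C s = M (exp (lf s)) * toep (exp (- lf s))"
definition K :: "real \<Rightarrow> smat" where
  "K s = hank1 (exp (lf s)) * hank1 (wtilde (exp (- lf s))) - hank e \<kappa> (exp (lf s)) * toep (exp (- lf s))"

lemma nonpos_lc: "wnonpos (lc s)" "wnonpos (- lc s)" "coef (lc s) 0 = 0" "coef (- lc s) 0 = 0"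
  using mu b by (auto simp: lc_def wnonpos_def wnonneg_def)

lemma nonneg_sb: "wnonneg (s *\<^sub>R b)" "wnonneg (- (s *\<^sub>R b))"
  using b by (auto simp: wnonneg_def)

lemma wtilde_beta: "wtilde \<beta> = \<beta>"
  by (simp add: \<beta>_def add.commute)

lemma UUi: "U s * Ui s = 1" "Ui s * U s = 1"
  unfolding U_def Ui_def using toep_exp_inverse(1,2)[OF nonpos_lc(1)] by auto

lemma LLi: "L s * Li s = 1" "Li s * L s = 1"
  unfolding L_def Li_def using toep_exp_inverse(3,4)[OF nonneg_sb(1)] by auto

lemma A_LBU: "A s = L s * B s * U s"
proof -
  have "L s * B s * U s = (L s * Li s) * A s * (Ui s * U s)"
    unfolding B_def by (simp only: mult.assoc)
  then show ?thesis by (simp add: UUi LLi)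
qed

lemma A_V: "A s * (M (exp (- (s *\<^sub>R \<beta>))) * toep (exp (- \<mu>))) = 1"
proof -
  have ev: "wtilde (exp (- (s *\<^sub>R \<beta>))) = exp (- (s *\<^sub>R \<beta>))"
    by (simp add: wtilde_beta)
  have "A s = toep (exp \<mu>) * M (exp (s *\<^sub>R \<beta>))"
    unfolding A_def by (simp add: toep_M wnonpos_exp mu exp_add')
  then have "A s * (M (exp (- (s *\<^sub>R \<beta>))) * toep (exp (- \<mu>))) =
      toep (exp \<mu>) * (M (exp (s *\<^sub>R \<beta>)) * M (exp (- (s *\<^sub>R \<beta>)))) * toep (exp (- \<mu>))"
    by (simp only: mult.assoc)
  also have "\<dots> = 1"
    by (simp add: M_mult[OF ev] M_one toep_exp_inverse mu)
  finally show ?thesis .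
qed

text \<open>\<open>C s\<close> is \<open>U s\<close> times the right inverse of \<open>A s\<close>
  from \<open>A_V\<close> times \<open>L s\<close>, with the symbols multiplied together where one
  of them has one-sided frequencies.\<close>

lemma BC: "B s * C s = 1"
proof -
  have "Ui s * M (exp (lf s)) = M (exp (- (s *\<^sub>R \<beta>)))"
    unfolding Ui_def by (subst toep_M[OF wnonpos_exp[OF nonpos_lc(2)]])
      (simp add: lc_def lf_def \<beta>_def scaleR_add_right algebra_simps flip: exp_add')
  moreover have "toep (exp (- lf s)) = toep (exp (- \<mu>)) * L s"
    unfolding L_def
    by (subst toep_mult_nonpos[OF wnonpos_exp]) (use mu in \<open>simp_all add: lf_def wnonpos_def flip: exp_add'\<close>)
  ultimately have "B s * C s = Li s * (A s * (M (exp (- (s *\<^sub>R \<beta>))) * toep (exp (- \<mu>)))) * L s"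
    unfolding B_def C_def by (simp only: mult.assoc) (simp only: mult.assoc[symmetric, of "Ui s"])
  then show ?thesis by (simp add: A_V LLi)
qed

lemma C_K: "C s = 1 - K s"
proof -
  have "toep (exp (lf s)) * toep (exp (- lf s)) = 1 - hank1 (exp (lf s)) * hank1 (wtilde (exp (- lf s)))"
    using toep_mult[of "exp (lf s)" "exp (- lf s)"] by (simp add: eq_diff_eq)
  then show ?thesis
    by (simp add: C_def K_def M_def distrib_right)
qed

lemma B_K: "B s = 1 + B s * K s"
  using BC[of s] by (simp add: C_K algebra_simps)

text \<open>All exponents have norm at most \<open>norm \<mu> + 2 * norm b\<close>. The product
  \<open>B s\<close> has three factors, and the factor 2 is for the sum of a Toeplitz and a Hankel
  matrix.\<close>

definition R :: real where "R = 2 * exp (norm \<mu> + 2 * norm b) ^ 3"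

lemma R_ge: "1 \<le> exp (norm \<mu> + 2 * norm b)" "exp (norm \<mu> + 2 * norm b) \<le> R"
  "2 * exp (norm \<mu> + 2 * norm b) \<le> R"
  "2 * exp (norm \<mu> + 2 * norm b) * exp (norm \<mu> + 2 * norm b) \<le> R" "1 \<le> R"
proof -
  let ?x = "exp (norm \<mu> + 2 * norm b)"
  show 1: "1 \<le> ?x" by simp
  have "?x * 1 \<le> ?x * ?x\<^sup>2" "?x * ?x * 1 \<le> ?x * ?x * ?x"
    using 1 by (intro mult_left_mono; simp)+
  then show 2: "2 * ?x \<le> R" and "2 * ?x * ?x \<le> R"
    by (simp_all add: R_def power3_eq_cube power2_eq_square)
  from 2 1 show "?x \<le> R" "1 \<le> R" by linarith+
qed

lemma norm_exp_le:
  assumes "norm x \<le> norm \<mu> + 2 * norm b"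
  shows "norm (exp x :: wiener) \<le> exp (norm \<mu> + 2 * norm b)"
  using order_trans[OF norm_exp[of x]] assms by simp

lemma norm_le:
  assumes "s \<in> {0..1}"
  shows "norm (lc s) \<le> norm \<mu> + 2 * norm b" "norm (lf s) \<le> norm \<mu> + 2 * norm b"
    "norm (s *\<^sub>R b) \<le> norm \<mu> + 2 * norm b" "norm (\<mu> + s *\<^sub>R \<beta>) \<le> norm \<mu> + 2 * norm b"
proof -
  have s: "s * norm x \<le> norm x" for x :: wiener using assms by (simp add: mult_left_le_one_le)
  have "norm (s *\<^sub>R b) \<le> norm b" using assms s by simp
  moreover have "norm (s *\<^sub>R wtilde b) \<le> norm b" using assms s[of b] by simp
  moreover have "norm (s *\<^sub>R \<beta>) \<le> norm b + norm b"
    using assms s[of \<beta>] norm_triangle_ineq[of b "wtilde b"] by (simp add: \<beta>_def)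
  ultimately show "norm (lc s) \<le> norm \<mu> + 2 * norm b" "norm (lf s) \<le> norm \<mu> + 2 * norm b"
    "norm (s *\<^sub>R b) \<le> norm \<mu> + 2 * norm b" "norm (\<mu> + s *\<^sub>R \<beta>) \<le> norm \<mu> + 2 * norm b"
    using norm_triangle_ineq[of \<mu> "s *\<^sub>R wtilde b"] norm_triangle_ineq4[of \<mu> "s *\<^sub>R b"]
      norm_triangle_ineq[of \<mu> "s *\<^sub>R \<beta>"] norm_ge_zero[of \<mu>] norm_ge_zero[of b]
    unfolding lc_def lf_def by linarith+
qed

lemma sbd_R:
  assumes "s \<in> {0..1}"
  shows "sbd (U s) R" "sbd (Ui s) R" "sbd (B s) R" "sbd (C s) R"
proof -
  let ?x = "exp (norm \<mu> + 2 * norm b)"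
  note n = norm_le[OF assms]
  have U: "sbd (U s) ?x" "sbd (Ui s) ?x" and Li: "sbd (Li s) ?x"
    unfolding U_def Ui_def Li_def by (rule sbd_mono[OF sbd_toep norm_exp_le]; use n in simp)+
  then show "sbd (U s) R" "sbd (Ui s) R" using R_ge(2) by (auto intro: sbd_mono)
  have A: "sbd (A s) (2 * ?x)"
    unfolding A_def by (rule sbd_mono[OF sbd_M]) (use norm_exp_le[OF n(4)] in simp)
  from sbd_mult[OF sbd_mult[OF Li A] U(2)] show "sbd (B s) R"
    unfolding B_def by (rule sbd_mono) (simp add: R_def power3_eq_cube)
  have 1: "sbd (M (exp (lf s))) (2 * ?x)"
    by (rule sbd_mono[OF sbd_M]) (use norm_exp_le[OF n(2)] in simp)
  have 2: "sbd (toep (exp (- lf s))) ?x"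
    by (rule sbd_mono[OF sbd_toep norm_exp_le]) (use n in simp)
  from sbd_mult[OF 1 2] show "sbd (C s) R"
    unfolding C_def by (rule sbd_mono) (rule R_ge(4))
qed

text \<open>A common majorant of the exponentials of \<open>lf s\<close>, \<open>lc s\<close> and
  their negatives for \<open>s\<close> in [0, 1]; both \<open>b\<close> and its reflection are
  included to serve the two kinds of exponents.\<close>

definition \<Phi> :: wiener where "\<Phi> = exp (wabs \<mu> + wabs b + wabs (wtilde b))"

lemma wdom_Phi:
  assumes "\<And>n. norm (coef x n) \<le> norm (coef \<mu> n) + norm (coef b n) + norm (coef b (- n))"
  shows "wdom (exp x) \<Phi>"
  unfolding \<Phi>_def by (rule wdom_exp) (simp add: wdom_def assms)

lemma wdom_Phi_tilde: "wdom f \<Phi> \<Longrightarrow> wdom (wtilde f) (wtilde \<Phi>)"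
  by (simp add: wdom_def)

lemma wlip_Phi: "wlip \<Phi>" "wlip (wtilde \<Phi>)"
proof -
  show "wlip \<Phi>"
    unfolding \<Phi>_def by (intro wlip_exp wlip_add wlip_simps mu b)
  then show "wlip (wtilde \<Phi>)" by (rule wlip_simps)
qed

lemma wdom_s:
  assumes "s \<in> {0..1}"
  shows "wdom (exp (lf s)) \<Phi>" "wdom (exp (- lf s)) \<Phi>" "wdom (exp (lc s)) \<Phi>" "wdom (exp (- lc s)) \<Phi>"
proof -
  have s: "norm (complex_of_real s * z) \<le> norm z" for z
    using assms by (simp add: norm_mult mult_left_le_one_le)
  have 1: "norm (x + y) \<le> norm x + a + norm z" "norm (x - y) \<le> norm x + norm z + a"
    "norm (y - x) \<le> norm x + norm z + a" "norm (- x - y) \<le> norm x + a + norm z"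
    if "norm y \<le> norm z" "0 \<le> a" for x y z :: complex and a
    using that norm_triangle_ineq[of x y] norm_triangle_ineq4[of x y] norm_triangle_ineq4[of y x]
      norm_triangle_ineq4[of "-x" y] norm_minus_cancel[of x] by linarith+
  show "wdom (exp (lf s)) \<Phi>" "wdom (exp (- lf s)) \<Phi>" "wdom (exp (lc s)) \<Phi>" "wdom (exp (- lc s)) \<Phi>"
    by (rule wdom_Phi; simp add: lf_def lc_def scaleR_conv_of_real[where 'a = complex] 1 s)+
qed

text \<open>The matrix \<open>?K\<close> is free of \<open>s\<close>, is Hilbert-Schmidt by its
  Hankel factors, and dominates every \<open>K s\<close> once the difference is replaced by a
  sum.\<close>

lemma K_bounds:
  "\<exists>k. \<forall>s\<in>{0..1}. fro (K s) k"
  "\<eta> > 0 \<Longrightarrow> \<exists>N0. \<forall>N\<ge>N0. \<forall>s\<in>{0..1}. fro (K s * sQ N) \<eta>"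
proof -
  let ?K = "hank1 \<Phi> * hank1 (wtilde \<Phi>) + hank (\<lambda>_. 1) \<kappa> \<Phi> * toep \<Phi>"
  have dom: "mdom (K s) ?K" if "s \<in> {0..1}" for s
    unfolding K_def
    by (intro mdom_add(2) mdom_mult mdom_hank mdom_toep wdom_s[OF that] wdom_Phi_tilde) auto
  obtain c d where c: "fro (hank1 \<Phi>) c" and d: "fro (hank (\<lambda>_. 1) \<kappa> \<Phi>) d"
    using fro_hank_ex[OF wlip_Phi(1), of 0 "\<lambda>_. 1"] fro_hank_ex[OF wlip_Phi(1) kappa_le(1), of "\<lambda>_. 1"] by auto
  have "sbd (hank1 (wtilde \<Phi>)) (norm \<Phi>)" using sbd_hank[of "\<lambda>_. 1" 0 "wtilde \<Phi>"] by simp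
  from fro_add[OF fro_mult_right[OF c this] fro_mult_right[OF d sbd_toep]]
  obtain k where k: "fro ?K k" by blast
  show "\<exists>k. \<forall>s\<in>{0..1}. fro (K s) k"
    using fro_le[OF k mdom_norm[OF dom]] by blast
  assume "\<eta> > 0"
  from fro_tail[OF k this] obtain N0 where N0: "\<And>N. N \<ge> N0 \<Longrightarrow> fro (?K * sQ N) \<eta>" by blast
  have "fro (K s * sQ N) \<eta>" if "N \<ge> N0" "s \<in> {0..1}" for N s
    by (rule fro_le[OF N0[OF that(1)]]) (use mdom_norm[OF dom[OF that(2)]] in auto)
  then show "\<exists>N0. \<forall>N\<ge>N0. \<forall>s\<in>{0..1}. fro (K s * sQ N) \<eta>" by blast
qed

text \<open>By \<open>B_K\<close> and since \<open>sP N * sQ N\<close> vanishes, the identity does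
  not contribute to the corner of \<open>B s\<close>; it is as small as the tail of
  \<open>K s\<close>.\<close>

lemma PBQ_bound:
  assumes "fro (K s * sQ N) \<eta>" "s \<in> {0..1}"
  shows "fro (sP N * B s * sQ N) (R * \<eta>)"
proof -
  have "sP N * B s * sQ N = sP N * (1 + B s * K s) * sQ N"
    by (simp only: B_K[symmetric])
  also have "\<dots> = sP N * sQ N + sP N * (B s * (K s * sQ N))"
    by (simp only: distrib_left distrib_right mult.assoc mult_1_left mult_1_right)
  also have "sP N * sQ N = 0" by (rule smat_eqI) simp
  finally show ?thesis
    using fro_proj(1)[OF fro_mult_left[OF sbd_R(3)[OF assms(2)] assms(1)]] by simp
qed

text \<open>The section of \<open>B s\<close> times the section of \<open>C s\<close> is
  \<open>sP N\<close> minus the small corner of \<open>B s\<close> times \<open>C s\<close>, a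
  perturbation of norm at most 1/2. So \<open>Z\<close> is the section of \<open>C s\<close> times
  the inverse \<open>D\<close> of this perturbed identity.\<close>

lemma PBP_inverse:
  assumes "fro (K s * sQ N) \<eta>" "s \<in> {0..1}" "R * \<eta> * R \<le> 1/2"
  obtains Z where "sP N * Z = Z" "sP N * B s * sP N * Z = sP N"
    "\<And>Y c. sP N * Y = Y \<Longrightarrow> fro Y c \<Longrightarrow> fro (Z * Y) (R * (2 * c))"
proof -
  let ?P = "sP N" and ?Q = "sQ N"
  define X where "X = - (B s * ?Q * C s)"
  have PXP: "?P * X * ?P = - ((?P * B s * ?Q) * C s * ?P)"
    by (simp add: X_def mult.assoc)
  have X: "fro (?P * X * ?P) (1/2)"
    unfolding PXP fro_uminus
    by (rule fro_mono[OF fro_proj(2)[OF fro_mult_right[OF PBQ_bound[OF assms(1,2)] sbd_R(4)[OF assms(2)]]] assms(3)])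
  from finite_inverse_ex[OF this] obtain D
    where D: "?P * D = D" "D * ?P = D" "(?P + ?P * X * ?P) * D = ?P" by blast
  define Z where "Z = ?P * C s * D"
  have BP: "B s * ?P = B s - B s * ?Q" by (simp add: sQ_def algebra_simps)
  have eq: "?P * B s * ?P * C s * ?P = ?P + ?P * X * ?P"
  proof -
    have "?P * B s * ?P * C s * ?P = ?P * (B s * C s) * ?P - ?P * (B s * ?Q * C s) * ?P"
      by (simp only: mult.assoc[of ?P "B s" ?P] BP) (simp add: algebra_simps)
    also have "\<dots> = ?P * ?P + ?P * X * ?P" by (simp add: BC X_def)
    finally show ?thesis by simp
  qed
  have 1: "?P * Z = Z" by (simp add: Z_def mult.assoc)
  have "?P * B s * ?P * Z = ?P * B s * (?P * ?P) * C s * (?P * D)"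
    by (simp only: Z_def D(1) mult.assoc)
  also have "\<dots> = (?P * B s * ?P * C s * ?P) * D" by (simp add: mult.assoc)
  also have "\<dots> = ?P" by (simp only: eq D(3))
  finally have 2: "?P * B s * ?P * Z = ?P" .
  have 3: "fro (Z * Y) (R * (2 * c))" if Y: "?P * Y = Y" "fro Y c" for Y c
  proof -
    define W where "W = D * Y"
    \<comment> \<open>The bound \<open>d\<close> may grow with \<open>N\<close> and only shows that
      \<open>W\<close> is Hilbert-Schmidt. The uniform bound comes from
      \<open>W = Y - ?P * X * ?P * W\<close>, where half of the norm of \<open>W\<close> is absorbed
      on the left.\<close>
    obtain d where d: "sbd D d" using sbd_ex by blast
    have W: "fro W (fnorm W)"
      unfolding W_def by (rule fro_fnorm(1)[OF fro_mult_left[OF d Y(2)]])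
    have "W + ?P * X * ?P * W = (?P * D) * Y + ?P * X * ?P * (D * Y)"
      by (simp only: W_def D(1))
    also have "\<dots> = ((?P + ?P * X * ?P) * D) * Y"
      by (simp only: distrib_right mult.assoc)
    also have "\<dots> = Y" by (simp only: D(3) Y(1))
    finally have "W = Y - ?P * X * ?P * W" by (simp add: algebra_simps)
    then have "fro W (c + 1/2 * fnorm W)"
      using fro_diff[OF Y(2) fro_mult[OF X W]] by simp
    from fro_fnorm(2)[OF this] have "fnorm W \<le> 2 * c" by simp
    then have W2: "fro W (2 * c)" by (rule fro_mono[OF W])
    have "Z * Y = ?P * C s * W" by (simp add: Z_def W_def mult.assoc)
    then show ?thesis
      using fro_mult_left[OF sbd_proj(1)[OF sbd_R(4)[OF assms(2)]] W2] by simp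
  qed
  show thesis by (rule that[OF 1 2 3])
qed

end

section \<open>The limit of the truncation correction\<close>

lemma has_sum_nat_tail:
  assumes "\<And>j. j < N \<Longrightarrow> f j = 0"
  shows "(f has_sum S) UNIV \<longleftrightarrow> ((\<lambda>q. f (N + q)) has_sum S) (UNIV :: nat set)"
proof -
  have "(f has_sum S) UNIV \<longleftrightarrow> (f has_sum S) {N..}"
    by (rule has_sum_cong_neutral) (use assms in auto)
  also have "\<dots> \<longleftrightarrow> ((\<lambda>q. f (N + q)) has_sum S) UNIV"
    by (rule has_sum_reindex_bij_witness[where i = "\<lambda>q. N + q" and j = "\<lambda>j. j - N"]) auto
  finally show ?thesis .
qed

lemma sum_triangle_const:
  fixes h :: "nat \<Rightarrow> complex"
  shows "(\<Sum>p\<le>m. \<Sum>r\<le>p. h r) = (\<Sum>r\<le>m. of_nat (Suc m - r) * h r)"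
proof (induction m)
  case (Suc m)
  have "(\<Sum>r\<le>Suc m. of_nat (Suc (Suc m) - r) * h r) = (\<Sum>r\<le>Suc m. of_nat (Suc m - r) * h r + h r)"
    by (intro sum.cong) (auto simp: Suc_diff_le algebra_simps)
  also have "\<dots> = (\<Sum>r\<le>m. of_nat (Suc m - r) * h r) + (\<Sum>r\<le>Suc m. h r)"
    by (simp add: sum.distrib)
  finally show ?case using Suc by simp
qed simp

lemma str_sP: "str N (X * sP N) = str N X"
  by (simp add: str_def)

lemma wlip_summable:
  assumes "wlip f"
  shows "summable (\<lambda>m. of_nat (Suc m) * coef f (int (Suc m)) * coef g (- int (Suc m)))"
    "summable (\<lambda>m. of_nat (Suc m) * coef f (int (Suc m)) * coef g (int (Suc m)))"
proof -
  obtain c where c: "\<And>n. real_of_int \<bar>n\<bar> * norm (coef f n) \<le> c"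
    using assms unfolding wlip_def by blast
  have c': "norm (of_nat (Suc m) * coef f (int (Suc m)) * z) \<le> c * norm z" for m z
    using mult_right_mono[OF c[of "int (Suc m)"], of "norm z"] by (simp add: norm_mult del: of_nat_Suc)
  have s: "summable (\<lambda>m. norm (coef g (h m)))" if "inj h" for h :: "nat \<Rightarrow> int"
  proof -
    have "(\<lambda>n. norm (coef g n)) summable_on range h"
      by (rule summable_on_subset_banach[OF coef_summable]) simp
    then have "(\<lambda>m. norm (coef g (h m))) summable_on UNIV"
      using that by (subst (asm) summable_on_reindex) (auto simp: o_def)
    then show ?thesis by (rule summable_on_imp_summable)
  qed
  have "summable (\<lambda>m. c * norm (coef g (- int (Suc m))))"
    by (rule summable_mult, rule s) (simp add: inj_def)
  then show "summable (\<lambda>m. of_nat (Suc m) * coef f (int (Suc m)) * coef g (- int (Suc m)))"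
    by (rule summable_comparison_test'[where N = 0]) (rule c')
  have "summable (\<lambda>m. c * norm (coef g (int (Suc m))))"
    by (rule summable_mult, rule s) (simp add: inj_def)
  then show "summable (\<lambda>m. of_nat (Suc m) * coef f (int (Suc m)) * coef g (int (Suc m)))"
    by (rule summable_comparison_test'[where N = 0]) (rule c')
qed

context symbol_splitting
begin

text \<open>
  The entry \<open>(p, q)\<close> of \<open>Xs s\<close> is that of \<open>(P U P)\<^sup>-\<^sup>1 P U Q\<close> at \<open>(N - 1 - p, N + q)\<close>, for \<open>P = sP N\<close>, \<open>Q = sQ N\<close>;
  it does not depend on \<open>N\<close>.
\<close>

definition Xs :: "real \<Rightarrow> smat" where
  "Xs s = toep (wtilde (exp (- lc s))) * hank1 (wtilde (exp (lc s)))"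

text \<open>The limit of the correction to the trace is the sum of \<open>n\<close> times
  \<open>coef b n\<close> times \<open>coef (lc s) (- n)\<close>. Its share from
  \<open>\<mu>\<close> is \<open>g0\<close>, that from the reflection of \<open>b\<close> is
  \<open>s\<close> times \<open>g1\<close>.\<close>

definition g0 :: complex where
  "g0 = (\<Sum>m. of_nat (Suc m) * coef b (int (Suc m)) * coef \<mu> (- int (Suc m)))"

definition g1 :: complex where
  "g1 = (\<Sum>m. of_nat (Suc m) * coef b (int (Suc m)) * coef b (int (Suc m)))"

definition \<tau> :: "nat \<Rightarrow> complex" where
  "\<tau> N = (\<Sum>i<N. e i * coef \<beta> (2 * int i + 1 - \<kappa>))"

lemma exp_lc_pos: "n > 0 \<Longrightarrow> coef (exp (lc s)) n = 0" "n > 0 \<Longrightarrow> coef (exp (- lc s)) n = 0"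
  using wnonpos_exp[OF nonpos_lc(1)] wnonpos_exp[OF nonpos_lc(2)] by (auto simp: wnonpos_def)

lemma ent_Xs: "ent (Xs s) p q = (\<Sum>k\<le>p. coef (exp (- lc s)) (int k - int p) * coef (exp (lc s)) (- int (k + q + 1)))"
proof -
  have "ent (Xs s) p q = (\<Sum>\<^sub>\<infinity>k\<in>{..p}. coef (exp (- lc s)) (int k - int p) * coef (exp (lc s)) (- int (k + q + 1)))"
    unfolding Xs_def ent_mult
    by (rule infsum_cong_neutral) (simp_all add: exp_lc_pos del: wtilde_exp)
  then show ?thesis by simp
qed

lemma ent_W: "ent (sP N * Ui s * sP N * U s * sQ N) i j =
    (if i < N \<and> N \<le> j then ent (Xs s) (N - Suc i) (j - N) else 0)"
proof (cases "i < N \<and> N \<le> j")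
  case True
  have "sP N * Ui s * sP N * U s * sQ N = sP N * (Ui s * sP N * U s * sQ N)"
    by (simp only: mult.assoc)
  then have "ent (sP N * Ui s * sP N * U s * sQ N) i j = ent (Ui s * sP N * U s) i j"
    using True by simp
  also have "\<dots> = (\<Sum>k<N. coef (exp (- lc s)) (int i - int k) * coef (exp (lc s)) (int k - int j))"
    by (simp add: ent_mult_sP_mult U_def Ui_def)
  \<comment> \<open>Counting rows and inner indices backwards from \<open>N - 1\<close> leaves
    differences that do not involve \<open>N\<close>; by triangularity the sum then ends at
    \<open>N - Suc i\<close>.\<close>
  also have "\<dots> = (\<Sum>k<N. coef (exp (- lc s)) (int i - int (N - Suc k)) * coef (exp (lc s)) (int (N - Suc k) - int j))"
    by (rule sum.nat_diff_reindex[symmetric])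
  also have "\<dots> = (\<Sum>k<N. coef (exp (- lc s)) (int k - int (N - Suc i)) * coef (exp (lc s)) (- int (k + (j - N) + 1)))"
    using True by (intro sum.cong refl arg_cong2[where f = times] arg_cong2[where f = coef]) auto
  also have "\<dots> = (\<Sum>k\<le>N - Suc i. coef (exp (- lc s)) (int k - int (N - Suc i)) * coef (exp (lc s)) (- int (k + (j - N) + 1)))"
    using True by (intro sum.mono_neutral_right) (auto simp: exp_lc_pos)
  also have "\<dots> = ent (Xs s) (N - Suc i) (j - N)" by (rule ent_Xs[symmetric])
  finally show ?thesis using True by simp
next
  case False
  have "sP N * Ui s * sP N * U s * sQ N = sP N * (Ui s * sP N * U s * sQ N)"
    by (simp only: mult.assoc)
  then show ?thesis using False by auto
qed

text \<open>On an antidiagonal each product of a coefficient of \<open>exp (- lc s)\<close> at -r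
  and one of \<open>exp (lc s)\<close> at r - m - 1 occurs \<open>Suc m - r\<close> times. This
  multiplicity is the weight of a derivative, and the logarithmic derivative of the exponential
  remains.\<close>

lemma Xs_diag: "(\<Sum>p\<le>m. ent (Xs s) p (m - p)) = of_nat (Suc m) * coef (lc s) (- int (Suc m))"
proof -
  let ?h = "\<lambda>r. coef (exp (- lc s)) (- int r) * coef (exp (lc s)) (- int (Suc m - r))"
  have "(\<Sum>p\<le>m. ent (Xs s) p (m - p)) = (\<Sum>p\<le>m. \<Sum>r\<le>p. ?h r)"
  proof (rule sum.cong[OF refl])
    fix p assume p: "p \<in> {..m}"
    show "ent (Xs s) p (m - p) = (\<Sum>r\<le>p. ?h r)"
      unfolding ent_Xs
      by (rule sum.reindex_bij_witness[where i = "\<lambda>r. p - r" and j = "\<lambda>k. p - k"])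
         (use p in \<open>auto intro!: arg_cong2[where f = times] arg_cong2[where f = coef]\<close>)
  qed
  also have "\<dots> = (\<Sum>r\<le>m. of_nat (Suc m - r) * ?h r)" by (rule sum_triangle_const)
  also have "\<dots> = (\<Sum>r\<le>Suc m. coef (exp (- lc s)) (- int r) * (of_nat (Suc m - r) * coef (exp (lc s)) (- int (Suc m - r))))"
    by (simp add: mult_ac)
  also have "\<dots> = of_nat (Suc m) * coef (lc s) (- int (Suc m))"
    by (rule exp_log_derivative[OF nonpos_lc(1)])
  finally show ?thesis .
qed

lemma wlip_beta: "wlip \<beta>"
  unfolding \<beta>_def by (intro wlip_add wlip_simps b)

lemma coef_beta_pos: "n > 0 \<Longrightarrow> coef \<beta> n = coef b n"
  using b by (simp add: \<beta>_def wnonneg_def)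

text \<open>The double series of the trace converges absolutely because both factors are
  Hilbert-Schmidt. It may be summed along antidiagonals, where \<open>hank1 \<beta>\<close> is
  constant and \<open>Xs_diag\<close> applies.\<close>

lemma str_Xs_limit: "(\<lambda>N. str N (Xs s * hank1 \<beta>)) \<longlonglongrightarrow> g0 + of_real s * g1" if Xs: "fro (Xs s) x"
proof -
  obtain h where h: "fro (hank1 \<beta>) h"
    using fro_hank_ex[OF wlip_beta, of 0 "\<lambda>_. 1"] by auto
  let ?F = "\<lambda>(p, q). ent (Xs s) p q * ent (hank1 \<beta>) q p"
  have "(\<lambda>z. norm (?F z)) summable_on UNIV \<times> UNIV"
  proof (rule nonneg_bdd_above_summable_on)
    show "bdd_above (sum (\<lambda>z. norm (?F z)) ` {S. S \<subseteq> UNIV \<times> UNIV \<and> finite S})"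
    proof (rule bdd_aboveI2[where M = "x\<^sup>2 + h\<^sup>2"])
      fix S :: "(nat \<times> nat) set" assume "S \<in> {S. S \<subseteq> UNIV \<times> UNIV \<and> finite S}"
      then have S: "finite S" by simp
      let ?I = "fst ` S" and ?J = "snd ` S"
      have "(\<Sum>z\<in>S. norm (?F z)) \<le> (\<Sum>z\<in>?I \<times> ?J. norm (?F z))"
        by (rule sum_mono2) (use S in \<open>auto simp: subset_fst_snd\<close>)
      also have "\<dots> = (\<Sum>p\<in>?I. \<Sum>q\<in>?J. norm (ent (Xs s) p q) * norm (ent (hank1 \<beta>) q p))"
        by (simp add: sum.cartesian_product case_prod_unfold norm_mult)
      also have "\<dots> \<le> (\<Sum>p\<in>?I. \<Sum>q\<in>?J. (norm (ent (Xs s) p q))\<^sup>2 + (norm (ent (hank1 \<beta>) q p))\<^sup>2)"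
      proof (intro sum_mono)
        show "norm u * norm v \<le> (norm u)\<^sup>2 + (norm v)\<^sup>2" for u v :: complex
        proof -
          have "0 \<le> norm u * norm v" by simp
          then show ?thesis using sum_squares_bound[of "norm u" "norm v"] by linarith
        qed
      qed
      also have "\<dots> = (\<Sum>p\<in>?I. \<Sum>q\<in>?J. (norm (ent (Xs s) p q))\<^sup>2) + (\<Sum>q\<in>?J. \<Sum>p\<in>?I. (norm (ent (hank1 \<beta>) q p))\<^sup>2)"
        by (simp add: sum.distrib sum.swap[of _ ?J ?I])
      also have "\<dots> \<le> x\<^sup>2 + h\<^sup>2"
        by (intro add_mono froD[OF Xs] froD[OF h]) (use S in auto)
      finally show "(\<Sum>z\<in>S. norm (?F z)) \<le> x\<^sup>2 + h\<^sup>2" .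
    qed
  qed simp
  then have sm: "?F summable_on UNIV \<times> UNIV" by (rule abs_summable_summable)
  then obtain S where S: "(?F has_sum S) (UNIV \<times> UNIV)" by (auto simp: summable_on_def)
  have "((\<lambda>p. ent (Xs s * hank1 \<beta>) p p) has_sum S) UNIV"
    by (rule has_sum_SigmaD[OF S]) (use ent_mult_has_sum[of "Xs s" _ "hank1 \<beta>"] in simp)
  then have "(\<lambda>p. ent (Xs s * hank1 \<beta>) p p) sums S" by (rule has_sum_imp_sums)
  then have 1: "(\<lambda>N. str N (Xs s * hank1 \<beta>)) \<longlonglongrightarrow> S"
    by (simp add: sums_def str_def)
  let ?g = "\<lambda>m. of_nat (Suc m) * coef b (int (Suc m)) * coef (lc s) (- int (Suc m))"
  have "((\<lambda>(m, p). ent (Xs s) p (m - p) * coef \<beta> (int (Suc m))) has_sum S) (Sigma UNIV (\<lambda>m. {..m})) \<longleftrightarrow> (?F has_sum S) (UNIV \<times> UNIV)"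
    by (rule has_sum_reindex_bij_witness[where i = "\<lambda>(p, q). (p + q, p)" and j = "\<lambda>(m, p). (p, m - p)"])
       (auto simp: add.commute of_nat_diff)
  with S have "((\<lambda>(m, p). ent (Xs s) p (m - p) * coef \<beta> (int (Suc m))) has_sum S) (Sigma UNIV (\<lambda>m. {..m}))"
    by simp
  then have "(?g has_sum S) UNIV"
  proof (rule has_sum_SigmaD)
    fix m
    have "?g m = (\<Sum>p\<le>m. ent (Xs s) p (m - p) * coef \<beta> (int (Suc m)))"
      using coef_beta_pos[of "int (Suc m)"] by (simp add: sum_distrib_right[symmetric] Xs_diag del: of_nat_Suc)
    then show "((\<lambda>p. case (m, p) of (m, p) \<Rightarrow> ent (Xs s) p (m - p) * coef \<beta> (int (Suc m))) has_sum ?g m) {..m}"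
      by (simp add: has_sum_finiteI)
  qed
  then have "?g sums S" by (rule has_sum_imp_sums)
  moreover have "(\<lambda>m. of_nat (Suc m) * coef b (int (Suc m)) * coef \<mu> (- int (Suc m)) +
      of_real s * (of_nat (Suc m) * coef b (int (Suc m)) * coef b (int (Suc m)))) sums (g0 + of_real s * g1)"
    unfolding g0_def g1_def
    by (intro sums_add sums_mult summable_sums wlip_summable b)
  moreover have "?g = (\<lambda>m. of_nat (Suc m) * coef b (int (Suc m)) * coef \<mu> (- int (Suc m)) +
      of_real s * (of_nat (Suc m) * coef b (int (Suc m)) * coef b (int (Suc m))))"
    by (rule ext) (simp add: lc_def scaleR_conv_of_real[where 'a = complex] algebra_simps)
  ultimately have "S = g0 + of_real s * g1" using sums_unique2 by metis
  with 1 show ?thesis by simp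
qed

lemma Xs_bounds:
  "\<exists>x. \<forall>s\<in>{0..1}. fro (Xs s) x"
  "\<eta> > 0 \<Longrightarrow> \<exists>N0. \<forall>N\<ge>N0. \<forall>s\<in>{0..1}. fro (sQ N * Xs s) \<eta>"
proof -
  let ?X = "toep (wtilde \<Phi>) * hank1 (wtilde \<Phi>)"
  have dom: "mdom (Xs s) ?X" if "s \<in> {0..1}" for s
    unfolding Xs_def
    by (intro mdom_mult mdom_hank mdom_toep wdom_s[OF that] wdom_Phi_tilde) auto
  obtain c where c: "fro (hank1 (wtilde \<Phi>)) c"
    using fro_hank_ex[OF wlip_Phi(2), of 0 "\<lambda>_. 1"] by auto
  from fro_mult_left[OF sbd_toep this] obtain k where k: "fro ?X k" by blast
  show "\<exists>x. \<forall>s\<in>{0..1}. fro (Xs s) x"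
    using fro_le[OF k mdom_norm[OF dom]] by blast
  assume "\<eta> > 0"
  from fro_tail[OF k this] obtain N0 where N0: "\<And>N. N \<ge> N0 \<Longrightarrow> fro (sQ N * ?X) \<eta>" by blast
  have "fro (sQ N * Xs s) \<eta>" if "N \<ge> N0" "s \<in> {0..1}" for N s
    by (rule fro_le[OF N0[OF that(1)]]) (use mdom_norm[OF dom[OF that(2)]] in auto)
  then show "\<exists>N0. \<forall>N\<ge>N0. \<forall>s\<in>{0..1}. fro (sQ N * Xs s) \<eta>" by blast
qed

text \<open>The difference of two traces only involves the rows of \<open>Xs s\<close> from
  \<open>N\<close> on, which are uniformly small in \<open>s\<close>; the longer trace is then sent
  to its limit.\<close>

lemma str_Xs_uniform:
  assumes "\<eta> > 0"
  shows "\<exists>N0. \<forall>N\<ge>N0. \<forall>s\<in>{0..1}. norm (str N (Xs s * hank1 \<beta>) - (g0 + of_real s * g1)) \<le> \<eta>"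
proof -
  obtain x where x: "\<And>s. s \<in> {0..1} \<Longrightarrow> fro (Xs s) x" using Xs_bounds(1) by blast
  obtain h where h: "fro (hank1 \<beta>) h"
    using fro_hank_ex[OF wlip_beta, of 0 "\<lambda>_. 1"] by auto
  then have h': "fro (hank1 \<beta>) (h + 1)" by (rule fro_mono) simp
  have h0: "0 < h + 1" using fro_nonneg[OF h] by simp
  from assms h0 have "0 < \<eta> / (h + 1)" by simp
  from Xs_bounds(2)[OF this] obtain N0
    where N0: "\<And>N s. N \<ge> N0 \<Longrightarrow> s \<in> {0..1} \<Longrightarrow> fro (sQ N * Xs s) (\<eta> / (h + 1))" by blast
  have "norm (str N (Xs s * hank1 \<beta>) - (g0 + of_real s * g1)) \<le> \<eta>" if N: "N \<ge> N0" and s: "s \<in> {0..1}" for N s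
  proof (rule LIMSEQ_le_const2)
    show "(\<lambda>N'. norm (str N (Xs s * hank1 \<beta>) - str N' (Xs s * hank1 \<beta>))) \<longlonglongrightarrow>
        norm (str N (Xs s * hank1 \<beta>) - (g0 + of_real s * g1))"
      by (intro tendsto_intros str_Xs_limit[OF x[OF s]])
    have "norm (str N (Xs s * hank1 \<beta>) - str N' (Xs s * hank1 \<beta>)) \<le> \<eta>" if "N' \<ge> N" for N'
    proof -
      have "str N' (sQ N * Xs s * hank1 \<beta>) = (\<Sum>i<N'. if N \<le> i then ent (Xs s * hank1 \<beta>) i i else 0)"
        by (simp add: str_def mult.assoc)
      also have "\<dots> = (\<Sum>i\<in>{N..<N'}. ent (Xs s * hank1 \<beta>) i i)"
        by (subst sum.inter_filter[symmetric]) (auto intro!: sum.cong)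
      also have "\<dots> = str N' (Xs s * hank1 \<beta>) - str N (Xs s * hank1 \<beta>)"
        using sum_diff_nat_ivl[of 0 N N' "\<lambda>i. ent (Xs s * hank1 \<beta>) i i"] that
        by (simp add: str_def lessThan_atLeast0)
      finally have "norm (str N (Xs s * hank1 \<beta>) - str N' (Xs s * hank1 \<beta>)) = norm (str N' (sQ N * Xs s * hank1 \<beta>))"
        by (simp add: norm_minus_commute)
      also have "\<dots> \<le> \<eta> / (h + 1) * (h + 1)"
        by (rule norm_str_mult[OF N0[OF N s] h'])
      finally show ?thesis using h0 by simp
    qed
    then show "\<exists>n. \<forall>N'\<ge>n. norm (str N (Xs s * hank1 \<beta>) - str N' (Xs s * hank1 \<beta>)) \<le> \<eta>" by blast
  qed
  then show ?thesis by blast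
qed

text \<open>Seen from the corner at \<open>N\<close>, with rows reversed, the Toeplitz block below
  the section is a Hankel matrix. After this change \<open>N\<close> only counts the diagonal
  entries.\<close>

lemma str_W_toep: "str N (sP N * Ui s * sP N * U s * sQ N * toep \<beta>) = str N (Xs s * hank1 \<beta>)"
proof -
  let ?W = "sP N * Ui s * sP N * U s * sQ N"
  have "ent (?W * toep \<beta>) i i = ent (Xs s * hank1 \<beta>) (N - Suc i) (N - Suc i)" if i: "i < N" for i
  proof -
    have "((\<lambda>j. ent ?W i j * ent (toep \<beta>) j i) has_sum ent (?W * toep \<beta>) i i) UNIV"
      by (rule ent_mult_has_sum)
    also have "?this \<longleftrightarrow> ((\<lambda>q. ent ?W i (N + q) * ent (toep \<beta>) (N + q) i) has_sum ent (?W * toep \<beta>) i i) UNIV"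
      by (rule has_sum_nat_tail) (simp add: ent_W)
    also have "(\<lambda>q. ent ?W i (N + q) * ent (toep \<beta>) (N + q) i) =
        (\<lambda>q. ent (Xs s) (N - Suc i) q * ent (hank1 \<beta>) q (N - Suc i))"
      unfolding ent_W using i by (intro ext) (simp add: of_nat_diff algebra_simps)
    finally show ?thesis by (rule has_sum_unique) (rule ent_mult_has_sum)
  qed
  then have "str N (?W * toep \<beta>) = (\<Sum>i<N. ent (Xs s * hank1 \<beta>) (N - Suc i) (N - Suc i))"
    by (simp add: str_def)
  also have "\<dots> = str N (Xs s * hank1 \<beta>)"
    unfolding str_def by (rule sum.nat_diff_reindex)
  finally show ?thesis .
qed

lemma triangular:
  "sP N * L s * sP N = sP N * L s" "sP N * U s * sP N = U s * sP N" "sP N * Ui s * sP N = Ui s * sP N"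
proof -
  have "wnonneg (exp (s *\<^sub>R b))" by (rule wnonneg_exp[OF nonneg_sb(1)])
  then show "sP N * L s * sP N = sP N * L s"
    by (intro smat_eqI) (auto simp: L_def wnonneg_def mult.assoc)
  show "sP N * U s * sP N = U s * sP N" "sP N * Ui s * sP N = Ui s * sP N"
    by (rule smat_eqI, auto simp: U_def Ui_def exp_lc_pos mult.assoc)+
qed

text \<open>
  \<open>X = (P A P)\<^sup>-\<^sup>1 P A Q\<close> measures how far the inverse of the section is from the section of the inverse.
\<close>

lemma section_solution:
  assumes K: "fro (K s * sQ N) \<eta>" "s \<in> {0..1}" "R * \<eta> * R \<le> 1/2"
    and Xs: "fro (Xs s) x" and ht: "fro (sQ N * hank e \<kappa> \<beta>) \<eta>'" and hb: "fro (sQ N * M \<beta> * sP N) h"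
  obtains X where "sP N * A s * sP N * X = sP N * A s * sQ N" "X * sQ N = X" "sP N * X = X"
    "norm (str N (X * M \<beta>) - str N (Xs s * hank1 \<beta>)) \<le> x * \<eta>' + R * (R * (2 * (R * \<eta>))) * (R * h)"
    "\<And>T t. fro T t \<Longrightarrow> fro (X * T) (R * (R * t) + R * (R * (2 * (R * (R * t)))))"
proof -
  let ?P = "sP N" and ?Q = "sQ N"
  obtain Z where Z: "?P * Z = Z" "?P * B s * ?P * Z = ?P"
    "\<And>Y c. ?P * Y = Y \<Longrightarrow> fro Y c \<Longrightarrow> fro (Z * Y) (R * (2 * c))"
    using PBP_inverse[OF K] by blast
  note sR = sbd_R[OF K(2)]
  \<comment> \<open>\<open>W\<close> would be the solution if \<open>B s\<close> were the identity;
    \<open>Y\<close> collects the effect of its corner. Both come from factoring the section of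
    \<open>A s\<close> into the sections of \<open>L s\<close>, \<open>B s\<close> and
    \<open>U s\<close>, which is exact because the outer ones are triangular.\<close>
  define W where "W = ?P * Ui s * ?P * U s * ?Q"
  define Y where "Y = ?P * Ui s * Z * (?P * B s * ?Q)"
  define X where "X = W + Y * U s * ?Q"
  have P2: "?P * (?P * T) = ?P * T" for T by simp
  have UUiP: "?P * U s * ?P * (?P * Ui s * (?P * T)) = ?P * T" for T
  proof -
    have "?P * U s * ?P * (?P * Ui s * (?P * T)) = ?P * U s * (?P * Ui s * ?P) * T"
      by (simp add: mult.assoc)
    also have "\<dots> = ?P * (U s * Ui s) * ?P * T"
      unfolding triangular by (simp only: mult.assoc)
    finally show ?thesis by (simp add: UUi mult.assoc)
  qed
  have PAP: "?P * A s * ?P = ?P * L s * ?P * B s * ?P * U s * ?P"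
  proof -
    have "?P * A s * ?P = (?P * L s) * B s * (U s * ?P)" unfolding A_LBU by (simp only: mult.assoc)
    also have "\<dots> = (?P * L s * ?P) * B s * (?P * U s * ?P)" unfolding triangular ..
    finally show ?thesis by (simp only: mult.assoc)
  qed
  have X_eq: "X = ?P * Ui s * (?P * (U s * ?Q + Z * (?P * B s * ?Q) * U s * ?Q))"
    unfolding X_def W_def Y_def
    by (simp only: distrib_left mult.assoc) (simp only: mult.assoc[symmetric, of ?P Z] Z(1))
  have QP: "?P + ?Q = 1" by (simp add: sQ_def)
  have "?P * A s * ?P * X = ?P * L s * ?P * B s * (?P * U s * ?P * X)"
    unfolding PAP by (simp only: mult.assoc P2)
  also have "?P * U s * ?P * X = ?P * (U s * ?Q + Z * (?P * B s * ?Q) * U s * ?Q)"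
    unfolding X_eq by (rule UUiP)
  also have "?P * L s * ?P * B s * (?P * (U s * ?Q + Z * (?P * B s * ?Q) * U s * ?Q)) =
      ?P * L s * (?P * B s * ?P * U s * ?Q + (?P * B s * ?P * Z) * (?P * B s * ?Q) * U s * ?Q)"
    by (simp only: distrib_left mult.assoc)
  also have "\<dots> = ?P * L s * (?P * B s * ?P * U s * ?Q + ?P * B s * ?Q * U s * ?Q)"
    by (simp only: Z(2)) (simp only: mult.assoc P2)
  also have "\<dots> = (?P * L s * ?P) * (B s * (?P + ?Q) * U s * ?Q)"
    by (simp only: distrib_left distrib_right mult.assoc)
  also have "\<dots> = ?P * A s * ?Q"
    unfolding triangular QP A_LBU by (simp add: mult.assoc)
  finally have 1: "?P * A s * ?P * X = ?P * A s * ?Q" .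
  have Q2: "?Q * ?Q = ?Q" by (rule smat_eqI) simp
  have 2: "X * ?Q = X"
    unfolding X_def W_def by (simp add: distrib_right mult.assoc Q2)
  have 3: "?P * X = X"
    unfolding X_def W_def Y_def by (simp add: distrib_left mult.assoc)
  have PBQ: "fro (?P * B s * ?Q) (R * \<eta>)" by (rule PBQ_bound[OF K(1,2)])
  have froY: "fro Y (R * (R * (2 * (R * \<eta>))))"
    unfolding Y_def mult.assoc[of "?P * Ui s"]
    by (rule fro_mult_left[OF sbd_proj(1)[OF sR(2)] Z(3)[OF _ PBQ]]) (simp add: mult.assoc)
  \<comment> \<open>The trace up to \<open>N\<close> only sees the columns below \<open>N\<close>.
    The factor \<open>?P\<close> gained in this way matters: \<open>?Q * M \<beta>\<close> need not
    be Hilbert-Schmidt because of its Toeplitz part, but its corner is.\<close>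
  have s1: "str N (X * M \<beta>) = str N (W * M \<beta>) + str N (Y * (U s * (?Q * M \<beta> * ?P)))"
  proof -
    have "str N (Y * (U s * (?Q * M \<beta> * ?P))) = str N ((Y * U s * ?Q * M \<beta>) * ?P)"
      by (simp only: mult.assoc)
    then show ?thesis by (simp add: X_def distrib_right str_add str_sP)
  qed
  \<comment> \<open>The Toeplitz part of \<open>M \<beta>\<close> gives the main term exactly. The
    Hankel part is met only in the rows from \<open>N\<close> on, as \<open>W\<close> ends with
    \<open>?Q\<close>, and is an error term.\<close>
  have s2: "str N (W * M \<beta>) = str N (Xs s * hank1 \<beta>) + str N (W * (?Q * hank e \<kappa> \<beta>))"
  proof -
    have "W * ?Q = W" unfolding W_def by (simp add: mult.assoc Q2)
    then have "W * (?Q * hank e \<kappa> \<beta>) = W * hank e \<kappa> \<beta>" by (simp only: mult.assoc[symmetric])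
    then show ?thesis by (simp add: M_def distrib_left str_add str_W_toep[of N s, folded W_def])
  qed
  have n1: "norm (str N (W * (?Q * hank e \<kappa> \<beta>))) \<le> x * \<eta>'"
  proof (rule norm_str_mult[OF _ ht])
    show "fro W x"
      by (rule fro_flip[OF Xs, of _ N]) (unfold W_def ent_W, simp)
  qed
  have n2: "norm (str N (Y * (U s * (?Q * M \<beta> * ?P)))) \<le> R * (R * (2 * (R * \<eta>))) * (R * h)"
    by (rule norm_str_mult[OF froY fro_mult_left[OF sR(1) hb]])
  have 4: "norm (str N (X * M \<beta>) - str N (Xs s * hank1 \<beta>)) \<le> x * \<eta>' + R * (R * (2 * (R * \<eta>))) * (R * h)"
    using norm_triangle_le[OF add_mono[OF n1 n2]] unfolding s1 s2 by simp
  have 5: "fro (X * T) (R * (R * t) + R * (R * (2 * (R * (R * t)))))" if T: "fro T t" for T t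
  proof -
    have QT: "fro (U s * (?Q * T)) (R * t)" by (rule fro_mult_left[OF sR(1) fro_proj(3)[OF T]])
    have a: "fro (?P * Ui s * (?P * (U s * (?Q * T)))) (R * (R * t))"
      by (rule fro_mult_left[OF sbd_proj(1)[OF sR(2)] fro_proj(1)[OF QT]])
    have "fro (?P * B s * ?Q * (U s * (?Q * T))) (R * (R * t))"
      by (rule fro_mult_left[OF sbd_proj(4)[OF sbd_proj(1)[OF sR(3)]] QT])
    then have b': "fro (?P * Ui s * (Z * (?P * B s * ?Q * (U s * (?Q * T))))) (R * (R * (2 * (R * (R * t)))))"
      by (intro fro_mult_left[OF sbd_proj(1)[OF sR(2)] Z(3)]) (simp_all add: mult.assoc)
    have "X * T = ?P * Ui s * (?P * (U s * (?Q * T))) + ?P * Ui s * (Z * (?P * B s * ?Q * (U s * (?Q * T))))"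
      by (simp only: X_def W_def Y_def distrib_right mult.assoc)
    then show ?thesis using fro_add[OF a b'] by simp
  qed
  show thesis by (rule that[OF 1 2 3 4 5])
qed

end

section \<open>From traces to determinants\<close>

lemma tendsto_det_P:
  assumes "\<And>i j. i < l \<Longrightarrow> j < l \<Longrightarrow> ((\<lambda>n. X n i j) \<longlongrightarrow> Y i j) F"
  shows "((\<lambda>n. det_P l (X n)) \<longlongrightarrow> det_P l Y) F"
  unfolding det_P_sum
  by (intro tendsto_intros assms) (auto simp: permutes_in_image)

lemma fro_entry: "fro X c \<Longrightarrow> norm (ent X i j) \<le> c"
  using froD[of X c "{i}" "{j}"] fro_nonneg[of X c] by (auto intro: power2_le_imp_le)

lemma fro_sP: "fro (sP l) (sqrt (real l))"
proof (rule froI)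
  fix I J :: "nat set" assume fin: "finite I" "finite J"
  have "(\<Sum>i\<in>I. \<Sum>j\<in>J. (norm (ent (sP l) i j))\<^sup>2) \<le> (\<Sum>i\<in>I. if i < l then 1 else 0)"
  proof (rule sum_mono)
    fix i
    have "(\<Sum>j\<in>J. (norm (ent (sP l) i j))\<^sup>2) = (\<Sum>j\<in>J. if i = j then (if i < l then 1 else 0) else 0)"
      by (intro sum.cong) auto
    then show "(\<Sum>j\<in>J. (norm (ent (sP l) i j))\<^sup>2) \<le> (if i < l then 1 else 0)"
      using fin(2) by simp
  qed
  also have "\<dots> = real (card {i \<in> I. i < l})"
    using fin(1) by (simp add: sum.inter_filter[symmetric])
  also have "\<dots> \<le> real l"
    using card_mono[of "{..<l}" "{i \<in> I. i < l}"] by (simp add: subset_iff)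
  finally show "(\<Sum>i\<in>I. \<Sum>j\<in>J. (norm (ent (sP l) i j))\<^sup>2) \<le> (sqrt (real l))\<^sup>2" by simp
qed simp

context symbol_splitting
begin

text \<open>Controls multiplication by the solution of \<open>section_solution\<close> for all large
  \<open>N\<close> and all \<open>s\<close>. The second summand has a surplus factor
  \<open>R\<close>, harmless since \<open>1 \<le> R\<close>.\<close>

definition cX :: real where "cX = R * R + 2 * R * R * R * R * R"

text \<open>The lower left corner of a Toeplitz matrix, transposed and with reversed rows, is a part
  of \<open>hank1 \<beta>\<close>, so its Hilbert-Schmidt bound does not grow with
  \<open>N\<close>.\<close>

lemma corner_bound: "\<exists>h. \<forall>N. fro (sQ N * M \<beta> * sP N) h"
proof -
  obtain c d where c: "fro (hank1 \<beta>) c" and d: "fro (hank e \<kappa> \<beta>) d"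
    using fro_hank_ex[OF wlip_beta, of 0 "\<lambda>_. 1"] fro_hank_ex[OF wlip_beta kappa_le(1), of e] by auto
  have "fro (sQ N * M \<beta> * sP N) (c + d)" for N
  proof -
    have "fro (strans (sQ N * toep \<beta> * sP N)) c"
      by (rule fro_flip[OF c, of _ N]) (auto simp: of_nat_diff algebra_simps)
    then have "fro (sQ N * toep \<beta> * sP N) c" by simp
    from fro_add[OF this fro_proj(2)[OF fro_proj(3)[OF d]]] show ?thesis
      by (simp add: M_def distrib_left distrib_right)
  qed
  then show ?thesis by blast
qed

lemma str_M: "str N (M \<beta>) = \<tau> N"
proof -
  have "coef \<beta> 0 = 0" using b by (simp add: \<beta>_def)
  moreover have "int i + int i = 2 * int i" for i by simp
  ultimately show ?thesis unfolding str_def \<tau>_def by (simp only: ent_M diff_self add_0_left)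
qed

lemma solution_uniform:
  assumes "\<eta> > 0"
  shows "\<exists>N0. \<forall>N\<ge>N0. \<forall>s\<in>{0..1}. \<exists>X. sP N * A s * sP N * X = sP N * A s * sQ N \<and> X * sQ N = X \<and>
    norm (str N (M \<beta> + X * M \<beta>) - (\<tau> N + (g0 + of_real s * g1))) \<le> \<eta> \<and>
    (\<forall>T t. fro T t \<longrightarrow> fro (X * T) (cX * t))"
proof -
  obtain x where x: "\<And>s. s \<in> {0..1} \<Longrightarrow> fro (Xs s) x" using Xs_bounds(1) by blast
  obtain h where h: "\<And>N. fro (sQ N * M \<beta> * sP N) h" using corner_bound by blast
  obtain d where d: "fro (hank e \<kappa> \<beta>) d"
    using fro_hank_ex[OF wlip_beta kappa_le(1), of e] by auto
  have R1: "1 \<le> R" by (rule R_ge(5))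
  have "0 \<in> {0..1::real}" by simp
  note x0 = fro_nonneg[OF x[OF this]] and h0 = fro_nonneg[OF h[of 0]]
  \<comment> \<open>One third of \<open>\<eta>\<close> each goes to the Hankel tail, to the corner
    of \<open>B s\<close>, and to the convergence of the main trace. The bound
    \<open>1 / (2 * R\<^sup>2)\<close> on \<open>\<delta>\<close> is what the inversion of the
    section requires.\<close>
  define \<eta>' where "\<eta>' = \<eta> / 3 / (x + 1)"
  define \<delta> where "\<delta> = min (1 / (2 * R\<^sup>2)) (\<eta> / 3 / (2 * R ^ 4 * (h + 1)))"
  have pos: "0 < \<eta>'" "0 < \<delta>" "0 < \<eta> / 3"
    using assms x0 h0 R1 by (simp_all add: \<eta>'_def \<delta>_def)
  have canc: "c * (t / c) = t" if "c \<noteq> 0" for c t :: real using that by simp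
  have d1: "R * \<delta> * R \<le> 1 / 2"
  proof -
    have "R\<^sup>2 * \<delta> \<le> R\<^sup>2 * (1 / (2 * R\<^sup>2))" by (rule mult_left_mono) (simp_all add: \<delta>_def)
    then show ?thesis using R1 by (simp add: power2_eq_square mult_ac)
  qed
  have d2: "x * \<eta>' + R * (R * (2 * (R * \<delta>))) * (R * h) \<le> 2 * (\<eta> / 3)"
  proof -
    have "x * \<eta>' \<le> (x + 1) * \<eta>'" using pos by (intro mult_right_mono) auto
    also have "\<dots> = \<eta> / 3"
    proof -
      have "x + 1 \<noteq> 0" using x0 by simp
      then show ?thesis unfolding \<eta>'_def by (rule canc)
    qed
    finally have 1: "x * \<eta>' \<le> \<eta> / 3" .
    have "R * (R * (2 * (R * \<delta>))) * (R * h) = 2 * R ^ 4 * h * \<delta>"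
      by (simp add: power4_eq_xxxx mult_ac)
    also have "\<dots> \<le> 2 * R ^ 4 * (h + 1) * \<delta>"
      using pos R1 by (intro mult_right_mono mult_left_mono) auto
    also have "\<dots> \<le> 2 * R ^ 4 * (h + 1) * (\<eta> / 3 / (2 * R ^ 4 * (h + 1)))"
      using R1 h0 by (intro mult_left_mono) (auto simp: \<delta>_def)
    also have "\<dots> = \<eta> / 3"
    proof -
      have "2 * R ^ 4 * (h + 1) \<noteq> 0" using R1 h0 by simp
      then show ?thesis by (rule canc)
    qed
    finally show ?thesis using 1 by simp
  qed
  obtain N1 where N1: "\<And>N s. N \<ge> N1 \<Longrightarrow> s \<in> {0..1} \<Longrightarrow> fro (K s * sQ N) \<delta>"
    using K_bounds(2)[OF pos(2)] by blast
  obtain N2 where N2: "\<And>N. N \<ge> N2 \<Longrightarrow> fro (sQ N * hank e \<kappa> \<beta>) \<eta>'"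
    using fro_tail[OF d pos(1)] by blast
  obtain N3 where N3: "\<And>N s. N \<ge> N3 \<Longrightarrow> s \<in> {0..1} \<Longrightarrow>
      norm (str N (Xs s * hank1 \<beta>) - (g0 + of_real s * g1)) \<le> \<eta> / 3"
    using str_Xs_uniform[OF pos(3)] by blast
  have "\<exists>X. sP N * A s * sP N * X = sP N * A s * sQ N \<and> X * sQ N = X \<and>
    norm (str N (M \<beta> + X * M \<beta>) - (\<tau> N + (g0 + of_real s * g1))) \<le> \<eta> \<and>
    (\<forall>T t. fro T t \<longrightarrow> fro (X * T) (cX * t))" if N: "N \<ge> max N1 (max N2 N3)" and s: "s \<in> {0..1}" for N s
  proof -
    from N have N': "N1 \<le> N" "N2 \<le> N" "N3 \<le> N" by auto
    obtain X where X: "sP N * A s * sP N * X = sP N * A s * sQ N" "X * sQ N = X"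
      "norm (str N (X * M \<beta>) - str N (Xs s * hank1 \<beta>)) \<le> x * \<eta>' + R * (R * (2 * (R * \<delta>))) * (R * h)"
      "\<And>T t. fro T t \<Longrightarrow> fro (X * T) (R * (R * t) + R * (R * (2 * (R * (R * t)))))"
      by (rule section_solution[OF N1[OF N'(1) s] s d1 x[OF s] N2[OF N'(2)] h]) (rule that)
    have "str N (M \<beta> + X * M \<beta>) - (\<tau> N + (g0 + of_real s * g1)) =
        (str N (X * M \<beta>) - str N (Xs s * hank1 \<beta>)) + (str N (Xs s * hank1 \<beta>) - (g0 + of_real s * g1))"
      by (simp add: str_add str_M)
    also have "norm \<dots> \<le> 2 * (\<eta> / 3) + \<eta> / 3"
      by (rule norm_triangle_le[OF add_mono[OF order_trans[OF X(3) d2] N3[OF N'(3) s]]])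
    finally have 1: "norm (str N (M \<beta> + X * M \<beta>) - (\<tau> N + (g0 + of_real s * g1))) \<le> \<eta>" by simp
    have 2: "fro (X * T) (cX * t)" if T: "fro T t" for T t
    proof (rule fro_mono[OF X(4)[OF T]])
      have "2 * R * R * R * R * t * 1 \<le> 2 * R * R * R * R * t * R"
        using R1 fro_nonneg[OF T] by (intro mult_left_mono) auto
      then show "R * (R * t) + R * (R * (2 * (R * (R * t)))) \<le> cX * t"
        by (simp add: cX_def algebra_simps)
    qed
    show ?thesis
      by (intro exI[of _ X] conjI allI impI X(1,2) 1 2)
  qed
  then show ?thesis by blast
qed

text \<open>In its first \<open>N\<close> rows \<open>A s\<close> equals its own section followed by
  \<open>sP N + X\<close>. With \<open>Y = M \<beta>\<close> this brings the derivative into the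
  form of Jacobi's formula; with a right inverse \<open>Y\<close> of \<open>A s\<close> it yields
  the inverse of the section.\<close>

lemma section_mult:
  assumes "sP N * A s * sP N * X = sP N * A s * sQ N" "i < N"
  shows "ent (A s * Y) i j = (\<Sum>k<N. ent (A s) i k * ent (Y + X * Y) k j)"
proof -
  have "sP N * (A s * Y) = sP N * A s * (sP N + sQ N) * Y"
    by (simp add: sQ_def mult.assoc)
  also have "\<dots> = sP N * A s * sP N * Y + sP N * A s * sP N * X * Y"
    by (simp only: assms(1) distrib_left distrib_right)
  also have "\<dots> = sP N * (A s * sP N * (Y + X * Y))"
    by (simp only: distrib_left mult.assoc)
  finally have "ent (sP N * (A s * Y)) i j = ent (sP N * (A s * sP N * (Y + X * Y))) i j" by simp
  then show ?thesis using assms(2) by (simp add: ent_mult_sP_mult)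
qed

text \<open>Only because \<open>\<beta>\<close> is even can the derivative be written with
  \<open>A s\<close> as a left factor.\<close>

lemma A_derivative:
  "((\<lambda>s. ent (A s) i j) has_vector_derivative ent (A s * M \<beta>) i j) (at s within S)"
proof -
  have "((\<lambda>s. exp \<mu> * exp (s *\<^sub>R \<beta>)) has_vector_derivative exp \<mu> * (exp (s *\<^sub>R \<beta>) * \<beta>)) (at s within S)"
    by (rule has_vector_derivative_mult_right) (rule exp_scaleR_has_vector_derivative_right)
  then have "((\<lambda>s. exp (\<mu> + s *\<^sub>R \<beta>)) has_vector_derivative exp (\<mu> + s *\<^sub>R \<beta>) * \<beta>) (at s within S)"
    by (simp add: exp_add' mult.assoc)
  then have c: "((\<lambda>s. coef (exp (\<mu> + s *\<^sub>R \<beta>)) n) has_vector_derivative coef (exp (\<mu> + s *\<^sub>R \<beta>) * \<beta>) n) (at s within S)" for n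
    by (rule bounded_linear.has_vector_derivative[OF bounded_linear_coef])
  have "A s * M \<beta> = M (exp (\<mu> + s *\<^sub>R \<beta>) * \<beta>)"
    unfolding A_def by (rule M_mult[OF wtilde_beta])
  then show ?thesis
    unfolding A_def ent_M
    by (simp only: ent_M) (intro has_vector_derivative_add has_vector_derivative_mult_right c)
qed

lemma sdet_A0: "sdet N (A 0) = 1"
proof -
  have np: "wnonpos (exp \<mu>)" by (rule wnonpos_exp[OF mu(1)])
  have "coef (\<mu> ^ m) 0 = (if m = 0 then 1 else 0)" for m
  proof -
    have "fps_nth (wfps (\<mu> ^ m)) 0 = fps_nth (wfps \<mu>) 0 ^ m"
      unfolding wfps_power[OF mu(1)] by (induction m) auto
    then show ?thesis using mu(2) by (cases m) auto
  qed
  then have "(\<lambda>m. coef (\<mu> ^ m) 0 /\<^sub>R fact m) = (\<lambda>m. if m = 0 then 1 else 0)" by auto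
  then have "(\<lambda>m. if m = 0 then 1 else 0) sums coef (exp \<mu>) 0"
    using coef_exp_sums[of \<mu> 0] by simp
  then have 1: "coef (exp \<mu>) 0 = 1"
    using sums_unique2 sums_single[of 0 "\<lambda>_. 1 :: complex"] by blast
  \<comment> \<open>The Hankel part only meets positive frequencies, except for the entry (0, 0)
    when \<open>\<kappa> = 1\<close>, and that one is removed by \<open>e 0 = 0\<close>. So
    \<open>A 0\<close> is unit upper triangular.\<close>
  have h: "e j * coef (exp \<mu>) (int i + int j + 1 - \<kappa>) = 0" for i j
    using cases np by (cases "i = 0 \<and> j = 0") (auto simp: e_def wnonpos_def)
  have "ent (A 0) = (\<lambda>i j. coef (exp \<mu>) (int i - int j))"
    by (intro ext) (simp only: A_def ent_M h scaleR_zero_left add_0_right)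
  then show ?thesis
    by (simp only:) (rule det_P_upper; use np in \<open>simp add: 1 wnonpos_def\<close>)
qed

text \<open>After division by the expected exponential the determinant satisfies u' = r u with
  \<open>r\<close> at most \<open>\<eta>\<close>. Neither Jacobi's formula nor
  \<open>gronwall_unit\<close> presupposes that the determinant is nonzero along the way.\<close>

lemma det_asymptotics:
  assumes "0 < \<eta>" "\<eta> \<le> 1/2"
  shows "\<exists>N0. \<forall>N\<ge>N0. norm (sdet N (A 1) * exp (- (\<tau> N + g0 + g1 / 2)) - 1) \<le> 2 * \<eta>"
proof -
  obtain N0 where N0: "\<And>N s. N \<ge> N0 \<Longrightarrow> s \<in> {0..1} \<Longrightarrow> \<exists>X. sP N * A s * sP N * X = sP N * A s * sQ N \<and>
      norm (str N (M \<beta> + X * M \<beta>) - (\<tau> N + (g0 + of_real s * g1))) \<le> \<eta>"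
    using solution_uniform[OF assms(1)] by blast
  have "norm (sdet N (A 1) * exp (- (\<tau> N + g0 + g1 / 2)) - 1) \<le> 2 * \<eta>" if N: "N \<ge> N0" for N
  proof -
    obtain X where X: "\<And>s. s \<in> {0..1} \<Longrightarrow> sP N * A s * sP N * X s = sP N * A s * sQ N"
      "\<And>s. s \<in> {0..1} \<Longrightarrow> norm (str N (M \<beta> + X s * M \<beta>) - (\<tau> N + (g0 + of_real s * g1))) \<le> \<eta>"
      using N0[OF N] by metis
    \<comment> \<open>The exponent is minus the integral of \<open>\<tau> N + g0 + s g1\<close> from
      0 to \<open>s\<close>.\<close>
    let ?E = "\<lambda>s. exp (- (complex_of_real s * (\<tau> N + g0) + (complex_of_real s)\<^sup>2 * (g1 / 2)))"
    let ?u = "\<lambda>s. sdet N (A s) * ?E s"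
    let ?r = "\<lambda>s. str N (M \<beta> + X s * M \<beta>) - (\<tau> N + (g0 + of_real s * g1))"
    have "norm (?u 1 - 1) \<le> 2 * \<eta>"
    proof (rule gronwall_unit[where u = ?u and u' = "\<lambda>s. ?r s * ?u s"])
      fix s :: real assume s: "s \<in> {0..1}"
      have "((\<lambda>s. sdet N (A s)) has_vector_derivative
          det_dir N (ent (A s)) (\<lambda>i j. \<Sum>k<N. ent (A s) i k * ent (M \<beta> + X s * M \<beta>) k j)) (at s within {0..1})"
        by (rule det_P_has_vector_derivative)
           (simp only: section_mult[OF X(1)[OF s], symmetric] A_derivative)
      then have D: "((\<lambda>s. sdet N (A s)) has_vector_derivative sdet N (A s) * str N (M \<beta> + X s * M \<beta>)) (at s within {0..1})"
        by (simp only: det_dir_mult str_def)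
      have "((\<lambda>z. exp (- (z * (\<tau> N + g0) + z\<^sup>2 * (g1 / 2)))) has_field_derivative
          exp (- (of_real s * (\<tau> N + g0) + (of_real s)\<^sup>2 * (g1 / 2))) * (- (\<tau> N + g0 + of_real s * g1))) (at (of_real s))"
        by (auto intro!: derivative_eq_intros)
      from has_vector_derivative_real_field[OF this, of "{0..1}"]
      have E: "(?E has_vector_derivative ?E s * (- (\<tau> N + g0 + of_real s * g1))) (at s within {0..1})"
        by simp
      show "(?u has_vector_derivative ?r s * ?u s) (at s within {0..1})"
        by (rule has_vector_derivative_eq_rhs[OF has_vector_derivative_mult[OF D E]]) (simp add: algebra_simps)
      show "norm (?r s * ?u s) \<le> \<eta> * norm (?u s)"
        unfolding norm_mult[of "?r s"] by (rule mult_right_mono[OF X(2)[OF s]]) simp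
    qed (use assms in \<open>simp_all add: sdet_A0\<close>)
    then show ?thesis by (simp add: add.assoc)
  qed
  then show ?thesis by blast
qed

definition tau_lim :: complex where "tau_lim = (\<Sum>i. e i * coef \<beta> (2 * int i + 1 - \<kappa>))"

lemma tau_limit: "\<tau> \<longlonglongrightarrow> tau_lim"
proof -
  have "(\<lambda>n. norm (coef \<beta> n)) summable_on range (\<lambda>i. 2 * int i + 1 - \<kappa>)"
    by (rule summable_on_subset_banach[OF coef_summable]) simp
  then have "(\<lambda>i. norm (coef \<beta> (2 * int i + 1 - \<kappa>))) summable_on UNIV"
    by (subst (asm) summable_on_reindex) (auto simp: o_def inj_def)
  then have "summable (\<lambda>i. norm (coef \<beta> (2 * int i + 1 - \<kappa>)))" by (rule summable_on_imp_summable)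
  then have "summable (\<lambda>i. e i * coef \<beta> (2 * int i + 1 - \<kappa>))"
    by (rule summable_comparison_test'[where N = 0]) (simp add: norm_mult mult_left_le_one_le)
  then show ?thesis
    unfolding \<tau>_def tau_lim_def by (rule summable_LIMSEQ)
qed

lemma det_limit: "(\<lambda>N. sdet N (A 1)) \<longlonglongrightarrow> exp (tau_lim + g0 + g1 / 2)"
proof -
  have "(\<lambda>N. sdet N (A 1) * exp (- (\<tau> N + g0 + g1 / 2))) \<longlonglongrightarrow> 1"
  proof (rule LIMSEQ_I)
    fix r :: real assume r: "0 < r"
    define \<eta> where "\<eta> = min (1/2) (r / 4)"
    have "0 < \<eta>" "\<eta> \<le> 1/2" "2 * \<eta> < r" using r by (auto simp: \<eta>_def min_def)
    with det_asymptotics[of \<eta>] show "\<exists>no. \<forall>n\<ge>no. norm (sdet n (A 1) * exp (- (\<tau> n + g0 + g1 / 2)) - 1) < r"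
      by (meson order_le_less_trans)
  qed
  then have "(\<lambda>N. sdet N (A 1) * exp (- (\<tau> N + g0 + g1 / 2)) * exp (\<tau> N + g0 + g1 / 2)) \<longlonglongrightarrow> 1 * exp (tau_lim + g0 + g1 / 2)"
    by (intro tendsto_intros tau_limit)
  moreover have "sdet N (A 1) * exp (- (\<tau> N + g0 + g1 / 2)) * exp (\<tau> N + g0 + g1 / 2) = sdet N (A 1)" for N
    by (simp only: mult.assoc exp_minus_mult mult_1_right)
  ultimately show ?thesis by (simp only: mult_1_left)
qed

text \<open>Jacobi's identity is applied to the section of size \<open>l + m\<close> and its inverse
  \<open>V + X * V\<close>, whose upper left corner differs from that of \<open>V\<close> by a
  vanishing amount.\<close>

lemma shifted_limit:
  "(\<lambda>N. det_P N (\<lambda>i j. ent (A 1) (i + l) (j + l))) \<longlonglongrightarrow>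
     exp (tau_lim + g0 + g1 / 2) * sdet l (M (exp (- \<beta>)))"
proof -
  define V where "V = M (exp (- \<beta>)) * toep (exp (- \<mu>))"
  have AV: "A 1 * V = 1" using A_V[of 1] by (simp add: V_def)
  let ?good = "\<lambda>N s X. sP N * A s * sP N * X = sP N * A s * sQ N \<and> X * sQ N = X \<and>
    norm (str N (M \<beta> + X * M \<beta>) - (\<tau> N + (g0 + of_real s * g1))) \<le> 1 \<and>
    (\<forall>T t. fro T t \<longrightarrow> fro (X * T) (cX * t))"
  have "\<exists>N0. \<forall>N\<ge>N0. \<forall>s\<in>{0..1}. \<exists>X. ?good N s X"
    by (rule solution_uniform) simp
  then obtain N0 where N0: "\<forall>N\<ge>N0. \<forall>s\<in>{0..1}. \<exists>X. ?good N s X" ..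
  have "\<exists>X. ?good N 1 X" if "N \<ge> N0" for N
    using N0[rule_format, OF that, of 1] by simp
  then have "\<forall>N. \<exists>X. N \<ge> N0 \<longrightarrow> ?good N 1 X" by simp
  from choice[OF this] obtain X where good: "\<forall>N. N \<ge> N0 \<longrightarrow> ?good N 1 (X N)" ..
  have X: "sP N * A 1 * sP N * X N = sP N * A 1 * sQ N" "X N * sQ N = X N"
    "\<And>T t. fro T t \<Longrightarrow> fro (X N * T) (cX * t)" if "N \<ge> N0" for N
    using good[rule_format, OF that] by simp_all
  have inv: "(\<Sum>k<N. ent (A 1) i k * ent (V + X N * V) k j) = (if i = j then 1 else 0)"
    if "N \<ge> N0" "i < N" for N i j
    using section_mult[OF X(1)[OF that(1)] that(2), of V j] by (simp add: AV)
  obtain v where v: "sbd V v" using sbd_ex by blast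
  \<comment> \<open>Only the first \<open>l\<close> columns are needed. Cut down to them, the merely
    bounded matrix \<open>V\<close> becomes Hilbert-Schmidt, so that its tails vanish.\<close>
  have froV: "fro (V * sP l) (v * sqrt (real l))"
    by (rule fro_mult_left[OF v fro_sP])
  have cX0: "0 < cX" using R_ge(5) by (simp add: cX_def add_pos_pos)
  have lim: "(\<lambda>N. ent (V + X N * V) i j) \<longlonglongrightarrow> ent V i j" if "i < l" "j < l" for i j
  proof (rule LIMSEQ_I)
    fix r :: real assume r: "0 < r"
    then have "0 < r / (2 * cX)" using cX0 by simp
    from fro_tail[OF froV this] obtain N1 where N1: "\<And>N. N \<ge> N1 \<Longrightarrow> fro (sQ N * (V * sP l)) (r / (2 * cX))" by blast
    have "norm (ent (V + X N * V) i j - ent V i j) < r" if N: "N \<ge> max N0 N1" for N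
    proof -
      \<comment> \<open>\<open>X N\<close> only reads the rows from \<open>N\<close> on, so the
        difference is governed by a tail of the fixed matrix \<open>V * sP l\<close>.\<close>
      have "X N * V * sP l = X N * (sQ N * (V * sP l))"
        using X(2)[of N] N by (metis max.boundedE mult.assoc)
      then have "ent (X N * (sQ N * (V * sP l))) i j = ent (X N * V) i j"
        using \<open>j < l\<close> by (metis ent_mult_sP)
      moreover have "norm (ent (X N * (sQ N * (V * sP l))) i j) \<le> cX * (r / (2 * cX))"
        using N by (intro fro_entry X(3) N1) auto
      ultimately show ?thesis using r cX0 by simp
    qed
    then show "\<exists>no. \<forall>N\<ge>no. norm (ent (V + X N * V) i j - ent V i j) < r" by blast
  qed
  have "(\<lambda>N. sdet N (A 1) * sdet l (V + X N * V)) \<longlonglongrightarrow> exp (tau_lim + g0 + g1 / 2) * sdet l V"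
    by (intro tendsto_mult det_limit tendsto_det_P lim)
  from LIMSEQ_ignore_initial_segment[OF this, of l]
  have lim1: "(\<lambda>m. sdet (l + m) (A 1) * sdet l (V + X (l + m) * V)) \<longlonglongrightarrow> exp (tau_lim + g0 + g1 / 2) * sdet l V"
    by (simp only: add.commute[of _ l])
  have ev: "\<forall>\<^sub>F m in sequentially. sdet (l + m) (A 1) * sdet l (V + X (l + m) * V) =
      det_P m (\<lambda>i j. ent (A 1) (i + l) (j + l))"
    using eventually_ge_at_top[of N0]
  proof eventually_elim
    case (elim m)
    show ?case by (rule det_P_minor) (use inv[of "l + m"] elim in simp)
  qed
  have eqV: "sdet l V = sdet l (M (exp (- \<beta>)))"
  proof -
    have np: "wnonpos (exp (- \<mu>))" using mu by (intro wnonpos_exp) (simp add: wnonpos_def)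
    have 1: "coef (exp (- \<mu>)) 0 = 1" using mu by (intro coef_exp_nonpos_0) (simp_all add: wnonpos_def)
    have "sdet l (M (exp (- \<beta>)) * sP l * toep (exp (- \<mu>))) = sdet l (M (exp (- \<beta>)))"
      unfolding sdet_mult by (subst det_P_upper[of "ent (toep _)"]) (use np in \<open>auto simp: 1 wnonpos_def\<close>)
    moreover have "sdet l V = sdet l (M (exp (- \<beta>)) * sP l * toep (exp (- \<mu>)))"
    proof (rule det_P_cong)
      fix i j assume "i < l" "j < l"
      have "sP l * toep (exp (- \<mu>)) * sP l = toep (exp (- \<mu>)) * sP l"
        by (rule smat_eqI) (use np in \<open>auto simp: wnonpos_def mult.assoc\<close>)
      then have "V * sP l = M (exp (- \<beta>)) * sP l * toep (exp (- \<mu>)) * sP l"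
        by (simp add: V_def mult.assoc)
      then show "ent V i j = ent (M (exp (- \<beta>)) * sP l * toep (exp (- \<mu>))) i j"
        using \<open>j < l\<close> by (metis ent_mult_sP)
    qed
    ultimately show ?thesis by simp
  qed
  show ?thesis
    using Lim_transform_eventually[OF lim1 ev] unfolding eqV .
qed

end

section \<open>Wiener symbols as functions on the circle\<close>

abbreviation circ :: "real measure" where "circ \<equiv> lebesgue_on {-pi..pi}"

lemma cis_int_mult_add: "cis (real_of_int m * \<theta>) * cis (real_of_int n * \<theta>) = cis (real_of_int (m + n) * \<theta>)"
  by (simp add: cis_mult algebra_simps)

lemma fourier_alt: "fourier a n = complex_of_real (1 / (2 * pi)) * (LINT \<theta>|circ. a (cis \<theta>) * cis (- real_of_int n * \<theta>))"
proof -
  have "exp (- \<i> * of_int n * complex_of_real \<theta>) = cis (- real_of_int n * \<theta>)" for \<theta>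
    by (simp add: cis_conv_exp mult_ac)
  then show ?thesis
    unfolding fourier_def set_lebesgue_integral_def by (simp add: integral_restrict_space)
qed

lemma integrable_circ_iff: "integrable circ f \<longleftrightarrow> f absolutely_integrable_on {-pi..pi}"
  unfolding set_integrable_def by (simp add: integrable_restrict_space)

definition wev :: "wiener \<Rightarrow> real \<Rightarrow> complex" where
  "wev F \<theta> = (\<Sum>\<^sub>\<infinity>n. coef F n * cis (real_of_int n * \<theta>))"

lemma wev_summable: "(\<lambda>n. norm (coef F n * cis (real_of_int n * \<theta>))) summable_on UNIV"
  using coef_summable[of F] by (simp add: norm_mult)

lemma wev_has_sum: "((\<lambda>n. coef F n * cis (real_of_int n * \<theta>)) has_sum wev F \<theta>) UNIV"
  unfolding wev_def by (rule has_sum_infsum[OF abs_summable_summable[OF wev_summable]])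

lemma norm_wev_le: "norm (wev F \<theta>) \<le> norm F"
  using norm_infsum_bound[OF wev_summable[of F \<theta>]]
  by (simp add: wev_def norm_wiener norm_mult)

lemma wev_add: "wev (F + G) \<theta> = wev F \<theta> + wev G \<theta>"
  using has_sum_add[OF wev_has_sum wev_has_sum, of F \<theta> G \<theta>] wev_has_sum[of "F + G" \<theta>]
  by (simp add: distrib_right has_sum_unique)

lemma wev_scaleR: "wev (r *\<^sub>R F) \<theta> = r *\<^sub>R wev F \<theta>"
  using has_sum_scaleR[OF wev_has_sum, of r F \<theta>] wev_has_sum[of "r *\<^sub>R F" \<theta>]
  by (simp add: has_sum_unique)

lemma bounded_linear_wev: "bounded_linear (\<lambda>F. wev F \<theta>)"
  by (rule bounded_linear_intro[where K = 1]) (simp_all add: wev_add wev_scaleR norm_wev_le)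

lemma wev_one [simp]: "wev 1 \<theta> = 1"
proof -
  have "wev 1 \<theta> = (\<Sum>\<^sub>\<infinity>n\<in>{0::int}. 1)"
    unfolding wev_def by (rule infsum_cong_neutral) auto
  then show ?thesis by simp
qed

lemma wev_mult: "wev (F * G) \<theta> = wev F \<theta> * wev G \<theta>"
proof -
  let ?c = "\<lambda>n. cis (real_of_int n * \<theta>)"
  let ?h = "\<lambda>n k. (coef F (n - k) * ?c (n - k)) * (coef G k * ?c k)"
  have norms: "norm (?h n k) = norm (coef F (n - k) * coef G k)" for n k by (simp add: norm_mult)
  have "(\<lambda>(n, k). norm (?h n k)) summable_on UNIV"
    unfolding norms by (rule conv_summable2(1)[OF coef_summable coef_summable])
  then have "(\<lambda>p. norm (case p of (n, k) \<Rightarrow> ?h n k)) summable_on UNIV \<times> UNIV"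
    by (simp add: case_prod_unfold)
  then have s: "(\<lambda>(n, k). ?h n k) summable_on UNIV \<times> UNIV" by (rule abs_summable_summable)
  have "wev (F * G) \<theta> = (\<Sum>\<^sub>\<infinity>n. \<Sum>\<^sub>\<infinity>k. ?h n k)"
    unfolding wev_def
  proof (rule infsum_cong)
    fix n
    have "coef (F * G) n * ?c n = (\<Sum>\<^sub>\<infinity>k. coef F (n - k) * coef G k * ?c n)"
      unfolding coef_mult by (rule infsum_cmult_left'[symmetric])
    also have "\<dots> = (\<Sum>\<^sub>\<infinity>k. ?h n k)"
    proof (rule infsum_cong)
      fix k
      have "?c n = ?c (n - k) * ?c k" by (simp add: cis_int_mult_add del: of_int_diff)
      then show "coef F (n - k) * coef G k * ?c n = ?h n k" by simp
    qed
    finally show "coef (F * G) n * ?c n = (\<Sum>\<^sub>\<infinity>k. ?h n k)" .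
  qed
  also have "\<dots> = (\<Sum>\<^sub>\<infinity>k. \<Sum>\<^sub>\<infinity>n. ?h n k)" by (rule infsum_swap_banach[OF s])
  also have "\<dots> = (\<Sum>\<^sub>\<infinity>k. wev F \<theta> * (coef G k * ?c k))"
  proof (rule infsum_cong)
    fix k
    have "(\<Sum>\<^sub>\<infinity>n. ?h n k) = (\<Sum>\<^sub>\<infinity>n. coef F (n - k) * ?c (n - k)) * (coef G k * ?c k)"
      by (rule infsum_cmult_left')
    also have "(\<Sum>\<^sub>\<infinity>n. coef F (n - k) * ?c (n - k)) = wev F \<theta>"
      unfolding wev_def
      by (rule infsum_reindex_bij_witness[where i = "\<lambda>n. n + k" and j = "\<lambda>n. n - k"]) auto
    finally show "(\<Sum>\<^sub>\<infinity>n. ?h n k) = wev F \<theta> * (coef G k * ?c k)" .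
  qed
  also have "\<dots> = wev F \<theta> * wev G \<theta>"
    unfolding wev_def[of G] by (rule infsum_cmult_right')
  finally show ?thesis .
qed

lemma wev_exp: "wev (exp F) \<theta> = exp (wev F \<theta>)"
  by (rule exp_hom[OF bounded_linear_wev]) (simp_all add: wev_mult)

text \<open>Dominated convergence asks for a sequence, whereas \<open>has_sum\<close> is a limit
  along all finite sets.\<close>

lemma symmetric_partial_sums:
  assumes "(f has_sum s) (UNIV :: int set)"
  shows "(\<lambda>N. \<Sum>n\<in>{- int N..int N}. f n) \<longlonglongrightarrow> s"
proof -
  have "filterlim (\<lambda>N. {- int N..int N}) (finite_subsets_at_top UNIV) sequentially"
    unfolding filterlim_finite_subsets_at_top
  proof safe
    fix X :: "int set" assume X: "finite X"
    obtain B where B: "\<And>x. x \<in> X \<Longrightarrow> \<bar>x\<bar> \<le> B"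
      using X finite_imageI[OF X, of abs] by (meson Max_ge finite_imageI imageI)
    have "X \<subseteq> {- int N..int N}" if "N \<ge> nat B" for N
      using B that by fastforce
    then show "\<forall>\<^sub>F N in sequentially. finite {- int N..int N} \<and> X \<subseteq> {- int N..int N} \<and> {- int N..int N} \<subseteq> UNIV"
      by (intro eventually_sequentiallyI[of "nat B"]) auto
  qed
  with assms show ?thesis
    unfolding has_sum_def by (rule filterlim_compose)
qed

lemma integrable_mult_cis:
  assumes "integrable circ f"
  shows "integrable circ (\<lambda>\<theta>. f \<theta> * cis (r * \<theta>))"
proof (rule Bochner_Integration.integrable_bound[OF assms])
  have "(\<lambda>\<theta>. cis (r * \<theta>)) \<in> borel_measurable circ"
    by (intro continuous_imp_measurable_on_sets_lebesgue continuous_intros) auto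
  then show "(\<lambda>\<theta>. f \<theta> * cis (r * \<theta>)) \<in> borel_measurable circ"
    using assms by (intro borel_measurable_times) auto
qed (simp add: norm_mult)

text \<open>Termwise integration, with \<open>norm F\<close> times the modulus of \<open>f\<close>
  as the dominating function.\<close>

lemma integral_mult_wev:
  assumes f: "integrable circ f"
  shows "(\<lambda>N. \<Sum>n\<in>{- int N..int N}. coef F n * (LINT \<theta>|circ. f \<theta> * cis (real_of_int n * \<theta>)))
    \<longlonglongrightarrow> (LINT \<theta>|circ. f \<theta> * wev F \<theta>)"
    and "integrable circ (\<lambda>\<theta>. f \<theta> * wev F \<theta>)"
proof -
  let ?s = "\<lambda>N \<theta>. \<Sum>n\<in>{- int N..int N}. coef F n * (f \<theta> * cis (real_of_int n * \<theta>))"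
  have int: "integrable circ (?s N)" for N
    by (intro Bochner_Integration.integrable_sum integrable_mult_right integrable_mult_cis f)
  have eq: "?s N \<theta> = f \<theta> * (\<Sum>n\<in>{- int N..int N}. coef F n * cis (real_of_int n * \<theta>))" for N \<theta>
    by (simp add: sum_distrib_left mult_ac)
  have lim: "(\<lambda>N. ?s N \<theta>) \<longlonglongrightarrow> f \<theta> * wev F \<theta>" for \<theta>
    unfolding eq by (intro tendsto_mult_left symmetric_partial_sums wev_has_sum)
  have bd: "norm (?s N \<theta>) \<le> norm (norm F *\<^sub>R f \<theta>)" for N \<theta>
  proof -
    have "norm (\<Sum>n\<in>{- int N..int N}. coef F n * cis (real_of_int n * \<theta>)) \<le> norm F"
      using norm_sum[of "\<lambda>n. coef F n * cis (real_of_int n * \<theta>)" "{- int N..int N}"]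
        sum_norm_coef_le[of "{- int N..int N}" F] by (simp add: norm_mult)
    then show ?thesis
      unfolding eq using mult_right_mono[OF _ norm_ge_zero[of "f \<theta>"]]
      by (simp only: norm_mult norm_scaleR mult.commute[of "norm (f \<theta>)"] abs_norm_cancel)
  qed
  have fm: "f \<in> borel_measurable circ" using f by simp
  have meas: "(\<lambda>\<theta>. f \<theta> * wev F \<theta>) \<in> borel_measurable circ"
    by (rule borel_measurable_LIMSEQ_metric[OF borel_measurable_integrable[OF int] lim])
  have dom: "integrable circ (\<lambda>\<theta>. norm (norm F *\<^sub>R f \<theta>))"
    using f by (intro integrable_norm integrable_scaleR_right)
  have "(\<lambda>N. LINT \<theta>|circ. ?s N \<theta>) \<longlonglongrightarrow> (LINT \<theta>|circ. f \<theta> * wev F \<theta>)"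
    by (rule integral_dominated_convergence[OF meas borel_measurable_integrable[OF int] dom])
       (use lim bd in auto)
  moreover have "(LINT \<theta>|circ. ?s N \<theta>) = (\<Sum>n\<in>{- int N..int N}. coef F n * (LINT \<theta>|circ. f \<theta> * cis (real_of_int n * \<theta>)))" for N
    by (subst Bochner_Integration.integral_sum) (auto intro!: integrable_mult_right integrable_mult_cis f)
  ultimately show "(\<lambda>N. \<Sum>n\<in>{- int N..int N}. coef F n * (LINT \<theta>|circ. f \<theta> * cis (real_of_int n * \<theta>)))
    \<longlonglongrightarrow> (LINT \<theta>|circ. f \<theta> * wev F \<theta>)" by simp
  show "integrable circ (\<lambda>\<theta>. f \<theta> * wev F \<theta>)"
    by (rule Bochner_Integration.integrable_bound[OF dom meas])
       (auto simp: norm_mult intro!: order_trans[OF mult_left_mono[OF norm_wev_le]] simp: mult.commute)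
qed

lemma integral_cis: "(LINT \<theta>|circ. cis (real_of_int k * \<theta>)) = (if k = 0 then 2 * pi else 0)"
proof (cases "k = 0")
  case True
  then show ?thesis by (simp add: measure_restrict_space scaleR_conv_of_real)
next
  case False
  have "((\<lambda>\<theta>. cis (real_of_int k * \<theta>)) has_integral
      (cis (real_of_int k * pi) / (\<i> * of_int k) - cis (real_of_int k * - pi) / (\<i> * of_int k))) {- pi..pi}"
  proof (rule fundamental_theorem_of_calculus)
    fix x :: real
    have "((\<lambda>z. exp (\<i> * of_int k * z) / (\<i> * of_int k)) has_field_derivative exp (\<i> * of_int k * of_real x)) (at (of_real x))"
      using False by (auto intro!: derivative_eq_intros)
    from has_vector_derivative_real_field[OF this, of "{- pi..pi}"]
    show "((\<lambda>\<theta>. cis (real_of_int k * \<theta>) / (\<i> * of_int k)) has_vector_derivative cis (real_of_int k * x)) (at x within {- pi..pi})"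
      by (simp add: cis_conv_exp mult_ac)
  qed simp
  moreover have "cis (real_of_int k * pi) = cis (real_of_int k * - pi)"
    by (simp add: complex_eq_iff sin_times_pi_eq_0)
  ultimately have "integral {- pi..pi} (\<lambda>\<theta>. cis (real_of_int k * \<theta>)) = 0"
    by (simp add: integral_unique)
  moreover have "integrable circ (\<lambda>\<theta>. cis (real_of_int k * \<theta>))"
    by (intro continuous_imp_integrable_real continuous_intros)
  ultimately show ?thesis using False by (simp add: lebesgue_integral_eq_integral)
qed

lemma integrable_circ_const: "integrable circ (\<lambda>_. c :: complex)"
  by (intro continuous_imp_integrable_real continuous_intros)

lemma integral_cis_wev: "(LINT \<theta>|circ. cis (real_of_int n * \<theta>) * wev F \<theta>) = 2 * pi * coef F (- n)"
proof -
  have int: "integrable circ (\<lambda>\<theta>. cis (real_of_int n * \<theta>))"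
    using integrable_mult_cis[OF integrable_circ_const[of 1], of "real_of_int n"] by simp
  have "(\<Sum>m\<in>{- int N..int N}. coef F m * (LINT \<theta>|circ. cis (real_of_int n * \<theta>) * cis (real_of_int m * \<theta>)))
      = 2 * pi * coef F (- n)" if N: "N \<ge> nat \<bar>n\<bar>" for N
  proof -
    have "(\<Sum>m\<in>{- int N..int N}. coef F m * (LINT \<theta>|circ. cis (real_of_int n * \<theta>) * cis (real_of_int m * \<theta>)))
        = (\<Sum>m\<in>{- int N..int N}. if m = - n then 2 * pi * coef F (- n) else 0)"
      unfolding cis_int_mult_add integral_cis by (intro sum.cong) auto
    also have "\<dots> = 2 * pi * coef F (- n)" using N by auto
    finally show ?thesis .
  qed
  then have "(\<lambda>N. \<Sum>m\<in>{- int N..int N}. coef F m * (LINT \<theta>|circ. cis (real_of_int n * \<theta>) * cis (real_of_int m * \<theta>)))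
      \<longlonglongrightarrow> 2 * pi * coef F (- n)"
    by (intro tendsto_eventually eventually_sequentiallyI)
  from LIMSEQ_unique[OF integral_mult_wev(1)[OF int] this] show ?thesis .
qed

lemma fourier_of_wev:
  assumes "(\<lambda>\<theta>. a (cis \<theta>)) \<in> borel_measurable circ" "AE \<theta> in circ. a (cis \<theta>) = wev F \<theta>"
  shows "fourier a n = coef F n"
proof -
  have "(LINT \<theta>|circ. a (cis \<theta>) * cis (- real_of_int n * \<theta>)) = (LINT \<theta>|circ. cis (real_of_int (- n) * \<theta>) * wev F \<theta>)"
  proof (rule integral_cong_AE)
    have c: "(\<lambda>\<theta>. cis (r * \<theta>)) \<in> borel_measurable circ" for r
      by (intro continuous_imp_measurable_on_sets_lebesgue continuous_intros) auto
    show "(\<lambda>\<theta>. a (cis \<theta>) * cis (- real_of_int n * \<theta>)) \<in> borel_measurable circ"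
      by (intro borel_measurable_times assms c)
    have w: "wev F \<in> borel_measurable circ"
      using borel_measurable_integrable[OF integral_mult_wev(2)[OF integrable_circ_const[of 1], of F]] by simp
    show "(\<lambda>\<theta>. cis (real_of_int (- n) * \<theta>) * wev F \<theta>) \<in> borel_measurable circ"
      by (intro borel_measurable_times w c)
    show "AE \<theta> in circ. a (cis \<theta>) * cis (- real_of_int n * \<theta>) = cis (real_of_int (- n) * \<theta>) * wev F \<theta>"
      using assms(2) by eventually_elim (simp add: mult.commute)
  qed
  then show ?thesis unfolding fourier_alt integral_cis_wev by simp
qed

section \<open>Uniqueness of Fourier coefficients\<close>

lift_definition wmonom :: "int \<Rightarrow> complex \<Rightarrow> wiener" is "\<lambda>m c n. if n = m then c else 0"
proof -
  fix m :: int and c :: complex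
  show "(\<lambda>n. norm (if n = m then c else 0)) summable_on UNIV"
    by (rule finite_nonzero_values_imp_summable_on, rule finite_subset[of _ "{m}"]) auto
qed

lemma coef_wmonom [simp]: "coef (wmonom m c) n = (if n = m then c else 0)"
  by (simp add: wmonom.rep_eq)

lemma wev_wmonom [simp]: "wev (wmonom m c) \<theta> = c * cis (real_of_int m * \<theta>)"
proof -
  have "wev (wmonom m c) \<theta> = (\<Sum>\<^sub>\<infinity>n\<in>{m}. c * cis (real_of_int n * \<theta>))"
    unfolding wev_def by (rule infsum_cong_neutral) auto
  then show ?thesis by simp
qed

text \<open>On the circle a real polynomial in the coordinates is a trigonometric polynomial. This
  connects the Stone-Weierstrass theorem with Fourier coefficients.\<close>

lemma polynomial_wev:
  fixes p :: "complex \<Rightarrow> real"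
  assumes "real_polynomial_function p"
  shows "\<exists>F. \<forall>\<theta>. complex_of_real (p (cis \<theta>)) = wev F \<theta>"
  using assms
proof induction
  case (linear p)
  then interpret bounded_linear p .
  have p: "p z = Re z * p 1 + Im z * p \<i>" for z
  proof -
    have "z = Re z *\<^sub>R 1 + Im z *\<^sub>R \<i>" by (simp add: complex_eq_iff)
    then have "p z = p (Re z *\<^sub>R 1 + Im z *\<^sub>R \<i>)" by (rule arg_cong)
    then show ?thesis by (simp only: add scaleR real_scaleR_def)
  qed
  \<comment> \<open>The coefficients result from cos = (t + 1/t) / 2 and sin = (t - 1/t) / (2
    i).\<close>
  let ?F = "wmonom 1 ((p 1 - \<i> * p \<i>) / 2) + wmonom (- 1) ((p 1 + \<i> * p \<i>) / 2)"
  have "complex_of_real (p (cis \<theta>)) = wev ?F \<theta>" for \<theta>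
    unfolding p[of "cis \<theta>"] by (simp add: wev_add complex_eq_iff field_simps)
  then show ?case by blast
next
  case (const c)
  have "complex_of_real c = wev (wmonom 0 c) \<theta>" for \<theta> by simp
  then show ?case by blast
next
  case (add f g)
  then obtain F G where "\<And>\<theta>. complex_of_real (f (cis \<theta>)) = wev F \<theta>" "\<And>\<theta>. complex_of_real (g (cis \<theta>)) = wev G \<theta>"
    by blast
  then have "complex_of_real (f (cis \<theta>) + g (cis \<theta>)) = wev (F + G) \<theta>" for \<theta> by (simp add: wev_add)
  then show ?case by blast
next
  case (mult f g)
  then obtain F G where "\<And>\<theta>. complex_of_real (f (cis \<theta>)) = wev F \<theta>" "\<And>\<theta>. complex_of_real (g (cis \<theta>)) = wev G \<theta>"
    by blast
  then have "complex_of_real (f (cis \<theta>) * g (cis \<theta>)) = wev (F * G) \<theta>" for \<theta> by (simp add: wev_mult)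
  then show ?case by blast
qed

lemma le_zero_if_le_mult:
  fixes c d :: real
  assumes "\<And>e. 0 < e \<Longrightarrow> c \<le> e * d" "0 < d"
  shows "c \<le> 0"
proof (rule ccontr)
  assume c: "\<not> c \<le> 0"
  then have "0 < c / (2 * d)" using assms(2) by simp
  from assms(1)[OF this] have "c \<le> c / 2" using assms(2) by simp
  with c show False by simp
qed

text \<open>Vanishing against all characters gives vanishing against trigonometric polynomials, and
  these approximate \<open>g\<close> uniformly on the circle.\<close>

lemma integral_continuous_zero:
  assumes f: "integrable circ f" and zero: "\<And>n. (LINT \<theta>|circ. f \<theta> * cis (real_of_int n * \<theta>)) = 0"
    and g: "continuous_on UNIV (g :: complex \<Rightarrow> real)"
  shows "(LINT \<theta>|circ. f \<theta> * complex_of_real (g (cis \<theta>))) = 0"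
proof -
  let ?I = "LINT \<theta>|circ. norm (f \<theta>)"
  have I0: "0 \<le> ?I" by simp
  have pos: "0 < ?I + 1" by (rule add_nonneg_pos[OF I0]) simp
  have gm: "(\<lambda>\<theta>. complex_of_real (g (cis \<theta>))) \<in> borel_measurable circ"
    by (intro continuous_imp_measurable_on_sets_lebesgue continuous_intros continuous_on_compose2[OF g]) auto
  have "norm (LINT \<theta>|circ. f \<theta> * complex_of_real (g (cis \<theta>))) \<le> e * (?I + 1)" if e: "0 < e" for e
  proof -
    have "continuous_on (sphere 0 1) g" using g continuous_on_subset by blast
    then obtain p where p: "real_polynomial_function p" "\<And>z. z \<in> sphere 0 1 \<Longrightarrow> \<bar>g z - p z\<bar> < e"
      using Stone_Weierstrass_real_polynomial_function[of "sphere (0::complex) 1" g e] e by auto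
    obtain F where F: "\<And>\<theta>. complex_of_real (p (cis \<theta>)) = wev F \<theta>"
      using polynomial_wev[OF p(1)] by blast
    have "(LINT \<theta>|circ. f \<theta> * wev F \<theta>) = 0"
      using integral_mult_wev(1)[OF f, of F] by (simp add: zero LIMSEQ_const_iff)
    have le: "norm (f \<theta> * (complex_of_real (g (cis \<theta>)) - wev F \<theta>)) \<le> e * norm (f \<theta>)" for \<theta>
    proof -
      have "norm (complex_of_real (g (cis \<theta>)) - wev F \<theta>) = \<bar>g (cis \<theta>) - p (cis \<theta>)\<bar>"
        unfolding F[symmetric] of_real_diff[symmetric] norm_of_real ..
      also have "\<dots> \<le> e" using p(2)[of "cis \<theta>"] by simp
      finally show ?thesis
        using mult_right_mono[OF _ norm_ge_zero[of "f \<theta>"]]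
        by (simp only: norm_mult mult.commute[of "norm (f \<theta>)"])
    qed
    have wm: "(\<lambda>\<theta>. wev F \<theta>) \<in> borel_measurable circ"
      using borel_measurable_integrable[OF integral_mult_wev(2)[OF integrable_circ_const[of 1], of F]] by simp
    have dom: "integrable circ (\<lambda>\<theta>. e * norm (f \<theta>))" using f by simp
    have int: "integrable circ (\<lambda>\<theta>. f \<theta> * (complex_of_real (g (cis \<theta>)) - wev F \<theta>))"
      by (rule Bochner_Integration.integrable_bound[OF dom])
         (use f gm wm le e in \<open>auto intro!: borel_measurable_times borel_measurable_diff\<close>)
    have "(LINT \<theta>|circ. f \<theta> * complex_of_real (g (cis \<theta>))) =
        (LINT \<theta>|circ. f \<theta> * (complex_of_real (g (cis \<theta>)) - wev F \<theta>) + f \<theta> * wev F \<theta>)"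
      by (rule Bochner_Integration.integral_cong) (simp_all add: algebra_simps)
    also have "\<dots> = (LINT \<theta>|circ. f \<theta> * (complex_of_real (g (cis \<theta>)) - wev F \<theta>))"
      using \<open>(LINT \<theta>|circ. f \<theta> * wev F \<theta>) = 0\<close>
      by (subst Bochner_Integration.integral_add[OF int integral_mult_wev(2)[OF f]]) simp
    also have "norm \<dots> \<le> (LINT \<theta>|circ. e * norm (f \<theta>))"
      by (rule Bochner_Integration.integral_norm_bound_integral[OF int dom]) (rule le)
    also have "\<dots> \<le> e * (?I + 1)" using e by simp
    finally show ?thesis .
  qed
  then have "norm (LINT \<theta>|circ. f \<theta> * complex_of_real (g (cis \<theta>))) \<le> 0"
    by (rule le_zero_if_le_mult[OF _ pos])
  then show ?thesis by simp
qed

text \<open>The indicator of an open set is the pointwise limit of truncated multiples of the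
  distance to the complement, which are continuous functions on the circle.\<close>

lemma integral_open_zero:
  assumes f: "integrable circ f"
    and zero: "\<And>g. continuous_on UNIV (g :: complex \<Rightarrow> real) \<Longrightarrow> (LINT \<theta>|circ. f \<theta> * complex_of_real (g (cis \<theta>))) = 0"
    and T: "open T" "T \<subseteq> {-pi<..<pi}"
  shows "(LINT \<theta>|circ. f \<theta> * indicator T \<theta>) = 0"
proof (cases "T = {}")
  case False
  define K where "K = cis ` ({-pi..pi} - T)"
  have "compact ({-pi..pi} - T)" using T(1) by (intro compact_diff) auto
  then have K: "closed K" unfolding K_def
    by (intro compact_imp_closed compact_continuous_image continuous_intros)
  \<comment> \<open>\<open>T\<close> avoids both endpoints, which represent the same point of the
    circle; hence \<open>cis\<close> keeps \<open>T\<close> and its complement apart, and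
    \<open>K\<close> is not empty.\<close>
  have "pi \<in> {-pi..pi} - T" using T(2) by auto
  then have Kne: "K \<noteq> {}" unfolding K_def by blast
  have mem: "cis \<theta> \<in> K \<longleftrightarrow> \<theta> \<notin> T" if \<theta>: "\<theta> \<in> {-pi..pi}" for \<theta>
  proof
    assume "cis \<theta> \<in> K"
    then obtain x where x: "x \<in> {-pi..pi}" "x \<notin> T" "cis \<theta> = cis x" by (auto simp: K_def)
    show "\<theta> \<notin> T"
    proof
      assume "\<theta> \<in> T"
      with T(2) have "\<theta> \<in> {-pi<..<pi}" by blast
      then have "\<bar>\<theta> - x\<bar> < 2 * pi" using x(1) by auto
      moreover have "sin \<theta> = sin x \<and> cos \<theta> = cos x"
        using x(3) by (metis cis.sel)
      then obtain n :: int where n: "\<theta> = x + 2 * pi * of_int n"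
        unfolding sin_cos_eq_iff by auto
      ultimately have "2 * pi * \<bar>real_of_int n\<bar> < 2 * pi * 1"
        by (simp add: abs_mult)
      then have "\<bar>real_of_int n\<bar> < 1" by simp
      then have "n = 0" by linarith
      with n have "\<theta> = x" by simp
      with \<open>\<theta> \<in> T\<close> x(2) show False by simp
    qed
  qed (use \<theta> in \<open>auto simp: K_def\<close>)
  define g where "g = (\<lambda>n z. min 1 (real n * infdist z K))"
  have cont: "continuous_on UNIV (g n)" for n
    unfolding g_def by (intro continuous_intros)
  have lim: "(\<lambda>n. complex_of_real (g n (cis \<theta>))) \<longlonglongrightarrow> indicator T \<theta>" if \<theta>: "\<theta> \<in> {-pi..pi}" for \<theta>
  proof (cases "\<theta> \<in> T")
    case True
    then have "0 < infdist (cis \<theta>) K"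
      using mem[OF \<theta>] K Kne by (metis infdist_pos_not_in_closed)
    then obtain n0 where n0: "1 < real n0 * infdist (cis \<theta>) K"
      using reals_Archimedean3 by blast
    have "complex_of_real (g n (cis \<theta>)) = indicator T \<theta>" if "n \<ge> n0" for n
    proof -
      have "real n0 * infdist (cis \<theta>) K \<le> real n * infdist (cis \<theta>) K"
        using that infdist_nonneg by (intro mult_right_mono) auto
      then show ?thesis using n0 True by (simp add: g_def)
    qed
    then show ?thesis by (intro tendsto_eventually eventually_sequentiallyI)
  next
    case False
    then have "infdist (cis \<theta>) K = 0" using mem[OF \<theta>] by (intro infdist_zero) simp
    then show ?thesis using False by (simp add: g_def)
  qed
  have fm: "f \<in> borel_measurable circ" using f by simp
  have gm: "(\<lambda>\<theta>. complex_of_real (g n (cis \<theta>))) \<in> borel_measurable circ" for n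
    by (intro continuous_imp_measurable_on_sets_lebesgue continuous_intros continuous_on_compose2[OF cont]) auto
  have im: "(\<lambda>\<theta>. indicator T \<theta> :: complex) \<in> borel_measurable circ"
    by (rule measurable_restrict_space1, rule borel_measurable_indicator) (use T(1) in \<open>auto intro: borel_open\<close>)
  have "(\<lambda>n. LINT \<theta>|circ. f \<theta> * complex_of_real (g n (cis \<theta>))) \<longlonglongrightarrow> (LINT \<theta>|circ. f \<theta> * indicator T \<theta>)"
  proof (rule integral_dominated_convergence[where w = "\<lambda>\<theta>. norm (f \<theta>)"])
    show "AE \<theta> in circ. (\<lambda>n. f \<theta> * complex_of_real (g n (cis \<theta>))) \<longlonglongrightarrow> f \<theta> * indicator T \<theta>"
      using lim by (intro AE_I2 tendsto_mult_left) simp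
    have "\<bar>g n z\<bar> \<le> 1" for n z by (simp add: g_def infdist_nonneg abs_le_iff min_le_iff_disj)
    then show "AE \<theta> in circ. norm (f \<theta> * complex_of_real (g n (cis \<theta>))) \<le> norm (f \<theta>)" for n
      by (intro AE_I2) (simp add: norm_mult mult_left_le)
  qed (use f fm gm im in \<open>auto intro!: borel_measurable_times\<close>)
  then show ?thesis by (simp add: zero[OF cont] LIMSEQ_const_iff)
qed simp

text \<open>By outer regularity a measurable set is, up to a null set, the intersection of a
  decreasing sequence of open sets. So the integral of \<open>f\<close> vanishes over every
  measurable set.\<close>

lemma AE_zero_if_integral_continuous_zero:
  assumes f: "integrable circ f"
    and zero: "\<And>g. continuous_on UNIV (g :: complex \<Rightarrow> real) \<Longrightarrow> (LINT \<theta>|circ. f \<theta> * complex_of_real (g (cis \<theta>))) = 0"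
  shows "AE \<theta> in circ. f \<theta> = 0"
proof -
  have fm: "f \<in> borel_measurable circ" using f by simp
  interpret finite_measure circ
    by (rule finite_measure_lebesgue_on) auto
  have "(LINT \<theta>|circ. indicator A \<theta> *\<^sub>R f \<theta>) = 0" if A: "A \<in> sets circ" for A
  proof -
    have Al: "A \<in> sets lebesgue" "A \<subseteq> {-pi..pi}"
      using A by (auto simp: sets_restrict_space_iff sets_restrict_space)
    \<comment> \<open>\<open>integral_open_zero\<close> concerns open subsets of the open interval,
      so the endpoints are dropped; they form a null set.\<close>
    define A' where "A' = A \<inter> {-pi<..<pi}"
    have A': "A' \<in> sets lebesgue" using Al unfolding A'_def by auto
    have "\<exists>T. open T \<and> A' \<subseteq> T \<and> emeasure lebesgue (T - A') < ennreal (1 / real (Suc n))" for n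
    proof -
      have "0 < 1 / real (Suc n)" by simp
      from sets_lebesgue_outer_open[OF A' this] obtain T
        where "open T" "A' \<subseteq> T" "emeasure lebesgue (T - A') < ennreal (1 / real (Suc n))" .
      then show ?thesis by blast
    qed
    then have "\<forall>n. \<exists>T. open T \<and> A' \<subseteq> T \<and> emeasure lebesgue (T - A') < ennreal (1 / real (Suc n))" ..
    from choice[OF this] obtain T
      where T: "\<And>n. open (T n)" "\<And>n. A' \<subseteq> T n" "\<And>n. emeasure lebesgue (T n - A') < ennreal (1 / real (Suc n))"
      by auto
    define U where "U n = {-pi<..<pi} \<inter> (\<Inter>k\<le>n. T k)" for n
    define V where "V = (\<Inter>n. U n)"
    have U: "open (U n)" "U n \<subseteq> {-pi<..<pi}" "A' \<subseteq> U n" for n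
      using T(1,2) unfolding U_def A'_def by (auto intro!: open_Int open_INT)
    have Um: "U n \<in> sets lebesgue" for n using U(1) by (auto intro: borel_open)
    have Vm: "V \<in> sets lebesgue" unfolding V_def using Um by auto
    have VA: "emeasure lebesgue (V - A') \<le> ennreal (1 / real (Suc n))" for n
    proof -
      have "V - A' \<subseteq> T n - A'" unfolding V_def U_def by auto
      then have "emeasure lebesgue (V - A') \<le> emeasure lebesgue (T n - A')"
        using T(1) A' by (intro emeasure_mono) (auto intro: borel_open)
      with T(3)[of n] show ?thesis by simp
    qed
    have "emeasure lebesgue (V - A') \<le> 0"
    proof (rule ennreal_le_epsilon)
      fix e :: real assume "0 < e"
      then obtain n where n: "1 / real (Suc n) < e" by (rule nat_approx_posE)
      have "emeasure lebesgue (V - A') \<le> ennreal e"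
        by (rule order_trans[OF VA[of n] ennreal_leI]) (use n in simp)
      then show "emeasure lebesgue (V - A') \<le> 0 + ennreal e" by simp
    qed
    then have "V - A' \<in> null_sets lebesgue" using Vm A' by (auto simp: null_sets_def)
    moreover have "{-pi, pi} \<in> null_sets lebesgue"
      by (simp add: null_sets_completionI finite_imp_null_set_lborel)
    ultimately have N: "(V - A') \<union> {-pi, pi} \<in> null_sets lebesgue" by (rule null_sets.Un)
    have AE: "AE \<theta> in circ. \<theta> \<notin> (V - A') \<union> {-pi, pi}"
      using AE_not_in[OF N] by (subst AE_restrict_space_iff) (auto elim: eventually_mono)
    have VU: "A' \<subseteq> V" "V \<subseteq> {-pi<..<pi}" unfolding V_def using U(2,3) by blast+
    have AE: "AE \<theta> in circ. f \<theta> * indicator V \<theta> = indicator A \<theta> *\<^sub>R f \<theta>"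
      using AE
    proof eventually_elim
      case (elim \<theta>)
      have "\<theta> \<in> V \<longleftrightarrow> \<theta> \<in> A"
      proof
        assume "\<theta> \<in> V"
        with elim have "\<theta> \<in> A'" by simp
        then show "\<theta> \<in> A" by (simp add: A'_def)
      next
        assume A: "\<theta> \<in> A"
        then have "\<theta> \<in> {-pi..pi}" using Al(2) by (rule_tac subsetD)
        with A elim have "\<theta> \<in> A'" by (simp add: A'_def)
        then show "\<theta> \<in> V" using VU(1) by (rule_tac subsetD)
      qed
      then show ?case by (simp add: indicator_def)
    qed
    have sets: "X \<in> sets lebesgue \<Longrightarrow> indicator X \<in> borel_measurable circ" for X
      by (rule measurable_restrict_space1) simp
    have "(\<lambda>n. LINT \<theta>|circ. f \<theta> * indicator (U n) \<theta>) \<longlonglongrightarrow> (LINT \<theta>|circ. f \<theta> * indicator V \<theta>)"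
    proof (rule integral_dominated_convergence[where w = "\<lambda>\<theta>. norm (f \<theta>)"])
      have "(\<lambda>n. indicator (U n) \<theta> :: complex) \<longlonglongrightarrow> indicator V \<theta>" for \<theta>
      proof -
        have "decseq U" unfolding U_def by (intro decseq_SucI) auto
        from LIMSEQ_indicator_decseq[OF this] show ?thesis unfolding V_def .
      qed
      then show "AE \<theta> in circ. (\<lambda>n. f \<theta> * indicator (U n) \<theta>) \<longlonglongrightarrow> f \<theta> * indicator V \<theta>"
        by (intro AE_I2 tendsto_mult_left)
      show "AE \<theta> in circ. norm (f \<theta> * indicator (U n) \<theta>) \<le> norm (f \<theta>)" for n
        by (intro AE_I2) (simp add: indicator_def)
    qed (use f fm sets[OF Vm] sets[OF Um] in \<open>auto intro!: borel_measurable_times\<close>)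
    then have "(LINT \<theta>|circ. f \<theta> * indicator V \<theta>) = 0"
      by (simp add: integral_open_zero[OF f zero U(1,2)] LIMSEQ_const_iff)
    moreover have "(LINT \<theta>|circ. f \<theta> * indicator V \<theta>) = (LINT \<theta>|circ. indicator A \<theta> *\<^sub>R f \<theta>)"
      by (rule integral_cong_AE) (use AE fm sets[OF Vm] sets[OF Al(1)] in \<open>auto intro!: borel_measurable_times borel_measurable_scaleR\<close>)
    ultimately show ?thesis by simp
  qed
  then show ?thesis
    by (intro density_zero[OF f]) (simp add: set_lebesgue_integral_def)
qed

lemma fourier_unique:
  assumes "integrable circ (\<lambda>\<theta>. a (cis \<theta>))" "\<And>n. fourier a n = coef F n"
  shows "AE \<theta> in circ. a (cis \<theta>) = wev F \<theta>"
proof -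
  have w: "integrable circ (wev F)"
    using integral_mult_wev(2)[OF integrable_circ_const[of 1], of F] by simp
  have int: "integrable circ (\<lambda>\<theta>. a (cis \<theta>) - wev F \<theta>)"
    by (rule Bochner_Integration.integrable_diff[OF assms(1) w])
  have zero: "(LINT \<theta>|circ. (a (cis \<theta>) - wev F \<theta>) * cis (real_of_int n * \<theta>)) = 0" for n
  proof -
    have "2 * pi * fourier a (- n) = (LINT \<theta>|circ. a (cis \<theta>) * cis (real_of_int n * \<theta>))"
      by (simp add: fourier_alt)
    moreover have "2 * pi * coef F (- n) = (LINT \<theta>|circ. wev F \<theta> * cis (real_of_int n * \<theta>))"
      using integral_cis_wev[of n F] by (simp add: mult.commute)
    ultimately show ?thesis
      using assms(2)[of "- n"]
      by (simp add: left_diff_distrib Bochner_Integration.integral_diff[OF integrable_mult_cis[OF assms(1)] integrable_mult_cis[OF w]])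
  qed
  have "AE \<theta> in circ. a (cis \<theta>) - wev F \<theta> = 0"
    by (rule AE_zero_if_integral_continuous_zero[OF int integral_continuous_zero[OF int zero]])
  then show ?thesis by simp
qed

section \<open>Fourier coefficients of Besov functions\<close>

text \<open>The piece of the interval that is pushed out on one side is brought back on the other
  side by the period.\<close>

lemma has_integral_periodic_shift:
  fixes f :: "real \<Rightarrow> 'b::banach"
  assumes per: "\<And>x. f (x + 2 * pi) = f x" and f: "(f has_integral I) {-pi..pi}"
    and y: "0 \<le> y" "y \<le> 2 * pi"
  shows "((\<lambda>x. f (x + y)) has_integral I) {-pi..pi}"
proof -
  have int: "f integrable_on {-pi..pi}" using f by blast
  have "f integrable_on {-pi..-pi+y}" "f integrable_on {-pi+y..pi}"
    by (rule integrable_on_subinterval[OF int]; use y in auto)+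
  then obtain A B where A: "(f has_integral A) {-pi..-pi+y}" and B: "(f has_integral B) {-pi+y..pi}"
    by blast
  have I: "I = A + B"
    using has_integral_combine[OF _ _ A B] f y by (auto intro: has_integral_unique)
  have "((\<lambda>x. f (x - 2 * pi)) has_integral A) {pi..pi+y}"
    using has_integral_shift_real_ivl[OF A, of "- 2 * pi"] by simp
  moreover have "f (x - 2 * pi) = f x" for x using per[of "x - 2 * pi"] by simp
  ultimately have "(f has_integral A) {pi..pi+y}" by simp
  from has_integral_combine[OF _ _ B this] have "(f has_integral B + A) {-pi+y..pi+y}"
    using y by simp
  from has_integral_shift_real_ivl[OF this, of y] show ?thesis by (simp add: I add.commute)
qed

lemma integrable_circ_shift:
  assumes per: "\<And>x. f (x + 2 * pi) = (f x :: complex)" and f: "integrable circ f"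
    and y: "0 \<le> y" "y \<le> 2 * pi"
  shows "integrable circ (\<lambda>x. f (x + y))" "(LINT x|circ. f (x + y)) = (LINT x|circ. f x)"
proof -
  have abs: "f absolutely_integrable_on {-pi..pi}" using f by (simp add: integrable_circ_iff)
  obtain J where J: "((\<lambda>x. norm (f x)) has_integral J) {-pi..pi}"
    using abs unfolding absolutely_integrable_on_def by blast
  have has: "(f has_integral (LINT x|circ. f x)) {-pi..pi}"
    using has_integral_integral_lebesgue_on[OF f] by simp
  have "((\<lambda>x. norm (f (x + y))) has_integral J) {-pi..pi}"
    by (rule has_integral_periodic_shift[OF _ J y]) (simp add: per)
  moreover note s = has_integral_periodic_shift[OF per has y]
  ultimately have "(\<lambda>x. f (x + y)) absolutely_integrable_on {-pi..pi}"
    unfolding absolutely_integrable_on_def by blast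
  then show int: "integrable circ (\<lambda>x. f (x + y))" by (simp add: integrable_circ_iff)
  show "(LINT x|circ. f (x + y)) = (LINT x|circ. f x)"
    using has_integral_integral_lebesgue_on[OF int] s by (auto intro: has_integral_unique)
qed

lemma integrable_shift_cis:
  assumes a: "integrable circ (\<lambda>\<theta>. a (cis \<theta>))" and y: "\<bar>y\<bar> \<le> pi"
  shows "integrable circ (\<lambda>x. a (cis (x + y)) * cis (- real_of_int n * x))"
    and "(LINT x|circ. a (cis (x + y)) * cis (- real_of_int n * x)) = cis (real_of_int n * y) * (2 * pi * fourier a n)"
proof -
  \<comment> \<open>Negative shifts are moved by a full period, because the shift lemma treats
    shifts between 0 and \<open>2 * pi\<close>.\<close>
  define z where "z = (if y < 0 then y + 2 * pi else y)"
  have z: "0 \<le> z" "z \<le> 2 * pi" using y by (auto simp: z_def)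
  have per: "cis (x + 2 * pi) = cis x" for x by (simp add: complex_eq_iff)
  have cz: "cis (x + z) = cis (x + y)" for x
    using per[of "x + y"] by (auto simp: z_def add_ac)
  let ?f = "\<lambda>x. a (cis x) * cis (- real_of_int n * x)"
  have pern: "cis (- real_of_int n * (x + 2 * pi)) = cis (- real_of_int n * x)" for x
  proof -
    have "cis (- real_of_int n * (x + 2 * pi)) = cis (- real_of_int n * x) * cis (real_of_int (- n) * (2 * pi))"
      by (simp add: cis_mult algebra_simps)
    moreover have "cis (real_of_int (- n) * (2 * pi)) = 1"
      using cis_multiple_2pi[of "real_of_int (- n)"] by (simp add: mult_ac)
    ultimately show ?thesis by simp
  qed
  have p: "?f (x + 2 * pi) = ?f x" for x by (simp only: per pern)
  have f: "integrable circ ?f" by (rule integrable_mult_cis[OF a])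
  note sh = integrable_circ_shift[OF p f z]
  have nz: "cis (- real_of_int n * z) = cis (- real_of_int n * y)"
    using pern[of y] by (auto simp: z_def)
  have eq: "a (cis (x + y)) * cis (- real_of_int n * x) = cis (real_of_int n * y) * ?f (x + z)" for x
  proof -
    have "cis (- real_of_int n * (x + z)) = cis (- real_of_int n * x) * cis (- real_of_int n * y)"
      by (simp only: nz[symmetric] cis_mult distrib_left)
    moreover have "cis (real_of_int n * y) * cis (- real_of_int n * y) = 1" by (simp add: cis_mult)
    ultimately show ?thesis by (simp add: cz mult_ac)
  qed
  show "integrable circ (\<lambda>x. a (cis (x + y)) * cis (- real_of_int n * x))"
    unfolding eq by (rule integrable_mult_right) (rule sh(1))
  show "(LINT x|circ. a (cis (x + y)) * cis (- real_of_int n * x)) = cis (real_of_int n * y) * (2 * pi * fourier a n)"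
    unfolding eq fourier_alt using sh(2) by simp
qed

definition second_diff :: "(complex \<Rightarrow> complex) \<Rightarrow> real \<Rightarrow> ennreal" where
  "second_diff a y = (\<integral>\<^sup>+ x\<in>{-pi..pi}. ennreal (norm (a (cis (x + y)) + a (cis (x - y)) - 2 * a (cis x))) \<partial>lebesgue)"

text \<open>The second difference multiplies the n-th Fourier coefficient by 2 cos (n y) - 2, and 2
  \<pi> times a Fourier coefficient is bounded by the integral of the modulus.\<close>

lemma second_diff_ge:
  assumes a: "integrable circ (\<lambda>\<theta>. a (cis \<theta>))" and y: "\<bar>y\<bar> \<le> pi"
  shows "ennreal (4 * pi * (1 - cos (real_of_int n * y)) * norm (fourier a n)) \<le> second_diff a y"
proof -
  let ?d = "\<lambda>x. a (cis (x + y)) + a (cis (x - y)) - 2 * a (cis x)"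
  let ?e = "\<lambda>x. cis (- real_of_int n * x)"
  have y': "\<bar>- y\<bar> \<le> pi" and z: "\<bar>0::real\<bar> \<le> pi" using y by auto
  have i1: "integrable circ (\<lambda>x. a (cis (x + y)) * ?e x)"
    and i2: "integrable circ (\<lambda>x. a (cis (x - y)) * ?e x)"
    and i3: "integrable circ (\<lambda>x. a (cis x) * ?e x)"
    using integrable_shift_cis(1)[OF a y, of n] integrable_shift_cis(1)[OF a y', of n] integrable_shift_cis(1)[OF a z, of n] by simp_all
  have eq: "?d x * ?e x = (a (cis (x + y)) * ?e x + a (cis (x - y)) * ?e x) - 2 * (a (cis x) * ?e x)" for x
    by (simp add: algebra_simps)
  have int: "integrable circ (\<lambda>x. ?d x * ?e x)"
    unfolding eq by (intro Bochner_Integration.integrable_diff Bochner_Integration.integrable_add integrable_mult_right i1 i2 i3)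
  have "(LINT x|circ. ?d x * ?e x) = (LINT x|circ. a (cis (x + y)) * ?e x) + (LINT x|circ. a (cis (x - y)) * ?e x) - 2 * (LINT x|circ. a (cis x) * ?e x)"
    unfolding eq
    by (subst Bochner_Integration.integral_diff[OF Bochner_Integration.integrable_add[OF i1 i2] integrable_mult_right[OF i3]],
        subst Bochner_Integration.integral_add[OF i1 i2]) simp
  also have "\<dots> = (cis (real_of_int n * y) + cis (- (real_of_int n * y)) - 2) * (2 * pi * fourier a n)"
    using integrable_shift_cis(2)[OF a y, of n] integrable_shift_cis(2)[OF a y', of n] integrable_shift_cis(2)[OF a z, of n]
    by (simp add: algebra_simps)
  also have "cis (real_of_int n * y) + cis (- (real_of_int n * y)) - 2 = complex_of_real (2 * cos (real_of_int n * y) - 2)"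
    by (simp add: complex_eq_iff)
  finally have "norm (LINT x|circ. ?d x * ?e x) = \<bar>2 * cos (real_of_int n * y) - 2\<bar> * (2 * pi * norm (fourier a n))"
    by (simp only: norm_mult norm_of_real) (simp add: norm_mult)
  also have "\<bar>2 * cos (real_of_int n * y) - 2\<bar> = 2 * (1 - cos (real_of_int n * y))"
    using cos_le_one[of "real_of_int n * y"] by simp
  finally have "4 * pi * (1 - cos (real_of_int n * y)) * norm (fourier a n) = norm (LINT x|circ. ?d x * ?e x)"
    by (simp add: mult_ac)
  then have "ennreal (4 * pi * (1 - cos (real_of_int n * y)) * norm (fourier a n)) = ennreal (norm (LINT x|circ. ?d x * ?e x))"
    by simp
  also have "\<dots> \<le> (\<integral>\<^sup>+x. ennreal (norm (?d x * ?e x)) \<partial>circ)"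
    by (rule integral_norm_bound_ennreal[OF int])
  also have "\<dots> = second_diff a y"
    unfolding second_diff_def by (subst nn_integral_restrict_space) (simp_all add: norm_mult)
  finally show ?thesis .
qed

lemma besovD:
  assumes "a \<in> besov_1_1"
  shows "integrable circ (\<lambda>\<theta>. a (cis \<theta>))"
    and "(\<integral>\<^sup>+ y\<in>{-pi..pi}. ennreal (1 / y\<^sup>2) * second_diff a y \<partial>lebesgue) < \<infinity>"
  using assms unfolding besov_1_1_def second_diff_def integrable_circ_iff by auto

lemma cos_le_on:
  assumes "c \<le> x" "x \<le> pi" "0 \<le> c"
  shows "cos x \<le> cos c"
  using assms by (rule_tac cos_monotone_0_pi_le) auto

text \<open>The integral over y is restricted to [1/|n|, 2/|n|]. There 1 - cos (n y) \<ge> 1 - cos 1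
  and 1/y^2 \<ge> n^2 / 4, while the length is 1/|n|; what remains is a multiple of |n| times the
  coefficient.\<close>

lemma besov_bounded:
  assumes a: "a \<in> besov_1_1"
  shows "\<exists>C. \<forall>n. real_of_int \<bar>n\<bar> * norm (fourier a n) \<le> C"
proof -
  let ?B = "\<integral>\<^sup>+ y\<in>{-pi..pi}. ennreal (1 / y\<^sup>2) * second_diff a y \<partial>lebesgue"
  obtain B where B: "?B = ennreal B" "0 \<le> B"
    using besovD(2)[OF a] by (cases ?B) auto
  have k: "0 < 1 - cos (1::real)" using cos_monotone_0_pi[of 0 1] pi_gt3 by simp
  have "real_of_int \<bar>n\<bar> * norm (fourier a n) \<le> B / (pi * (1 - cos 1))" for n
  proof (cases "n = 0")
    case False
    define r where "r = real_of_int \<bar>n\<bar>"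
    have r: "1 \<le> r" using False by (simp add: r_def)
    let ?v = "r\<^sup>2 / 4 * (4 * pi * (1 - cos 1) * norm (fourier a n))"
    have "ennreal ?v * indicator {1/r..2/r} y \<le> ennreal (1 / y\<^sup>2) * second_diff a y * indicator {-pi..pi} y" for y
    proof (cases "y \<in> {1/r..2/r}")
      case True
      then have y: "1 \<le> r * y" "r * y \<le> 2" using r by (auto simp: field_simps)
      have y0: "0 < y" using y(1) r by (smt (verit) mult_nonneg_nonpos)
      have "1 * y \<le> r * y" using r y0 by (intro mult_right_mono) auto
      then have yp: "y \<le> 2" using y(2) by simp
      have "cos (real_of_int n * y) = cos (r * y)"
        by (cases "n \<ge> 0") (auto simp: r_def)
      also have "\<dots> \<le> cos 1" by (rule cos_le_on) (use y pi_gt3 in auto)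
      finally have c: "cos (real_of_int n * y) \<le> cos 1" .
      have "r\<^sup>2 * y\<^sup>2 \<le> 2\<^sup>2"
        unfolding power_mult_distrib[symmetric] by (rule power_mono) (use y in auto)
      then have q: "r\<^sup>2 / 4 \<le> 1 / y\<^sup>2" using y0 by (simp add: field_simps)
      have "4 * pi * (1 - cos 1) * norm (fourier a n) \<le> 4 * pi * (1 - cos (real_of_int n * y)) * norm (fourier a n)"
        using c by (intro mult_right_mono mult_left_mono) auto
      note c = this
      have "\<bar>y\<bar> \<le> pi" using y0 yp pi_gt3 by auto
      then have "ennreal (4 * pi * (1 - cos 1) * norm (fourier a n)) \<le> second_diff a y"
        by (rule order_trans[OF ennreal_leI[OF c] second_diff_ge[OF besovD(1)[OF a]]])
      then have "ennreal (r\<^sup>2 / 4) * ennreal (4 * pi * (1 - cos 1) * norm (fourier a n)) \<le> ennreal (1 / y\<^sup>2) * second_diff a y"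
        using q by (intro mult_mono ennreal_leI) auto
      moreover have "ennreal (r\<^sup>2 / 4) * ennreal (4 * pi * (1 - cos 1) * norm (fourier a n)) = ennreal ?v"
        using k by (subst ennreal_mult) auto
      moreover have "y \<in> {-pi..pi}" using y0 yp pi_gt3 by auto
      ultimately show ?thesis using True by simp
    qed simp
    then have "(\<integral>\<^sup>+ y. ennreal ?v * indicator {1/r..2/r} y \<partial>lebesgue) \<le> ?B"
      by (intro nn_integral_mono) auto
    also have "(\<integral>\<^sup>+ y. ennreal ?v * indicator {1/r..2/r} y \<partial>lebesgue) = ennreal ?v * ennreal (1 / r)"
      using r by (subst nn_integral_cmult_indicator) (auto simp: field_simps)
    also have "\<dots> = ennreal (?v * (1 / r))"
      using r k by (subst ennreal_mult) auto
    also have "?v * (1 / r) = r * norm (fourier a n) * (pi * (1 - cos 1))"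
      using r by (simp add: field_simps power2_eq_square)
    finally have "r * norm (fourier a n) * (pi * (1 - cos 1)) \<le> B" using B by simp
    then show ?thesis using k by (simp add: r_def field_simps)
  qed (use k B in auto)
  then show ?thesis by blast
qed

lemma besov_summable:
  assumes a: "a \<in> besov_1_1" and s: "s \<in> {1, -1}"
  shows "summable (\<lambda>n. norm (fourier a (s * int (Suc n))))"
proof -
  let ?B = "\<integral>\<^sup>+ y\<in>{-pi..pi}. ennreal (1 / y\<^sup>2) * second_diff a y \<partial>lebesgue"
  let ?c = "\<lambda>n. norm (fourier a (s * int (Suc n)))"
  obtain B where B: "?B = ennreal B" "0 \<le> B"
    using besovD(2)[OF a] by (cases ?B) auto
  have k: "0 < 1 - cos (1/2::real)" using cos_monotone_0_pi[of 0 "1/2"] pi_gt3 by simp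
  \<comment> \<open>On \<open>J n\<close> the product \<open>(n + 1) y\<close> stays in \<open>[1/2, 1]\<close>, so \<open>1 - cos ((n + 1) y)\<close> is bounded below,
    while the integral of \<open>1 / y\<^sup>2\<close> over these disjoint intervals is of order \<open>1\<close>.\<close>
  define J where "J n = {1 / real (Suc (Suc n))<..1 / real (Suc n)}" for n
  define v where "v n = (real (Suc n))\<^sup>2 * (4 * pi * (1 - cos (1/2)) * ?c n)" for n
  have v0: "0 \<le> v n" for n using k by (simp add: v_def)
  have disj: "m = n" if "y \<in> J m" "y \<in> J n" for m n y
  proof -
    have "\<not> m < n" if "y \<in> J m" "y \<in> J n" for m n
    proof
      assume "m < n"
      then have "1 / real (Suc n) \<le> 1 / real (Suc (Suc m))" by (intro divide_left_mono) auto
      with that show False by (auto simp: J_def)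
    qed
    from this[OF that] this[OF that(2,1)] show ?thesis by simp
  qed
  have single: "ennreal (v n) \<le> ennreal (1 / y\<^sup>2) * second_diff a y * indicator {-pi..pi} y" if "y \<in> J n" for n y
  proof -
    define r where "r = real (Suc n)"
    have r: "1 \<le> r" by (simp add: r_def)
    have y: "1 / (r + 1) < y" "y \<le> 1 / r" using that by (auto simp: J_def r_def add_ac)
    have y0: "0 < y" using y(1) r by (smt (verit) divide_pos_pos)
    have yr: "r * y \<le> 1" using y(2) r by (simp add: field_simps)
    have "1 < (r + 1) * y" using y(1) r by (simp add: field_simps)
    moreover have "1 * y \<le> r * y" using r y0 by (intro mult_right_mono) auto
    ultimately have ry: "1 / 2 \<le> r * y" by (simp add: algebra_simps)
    have yp: "y \<le> 1" using yr \<open>1 * y \<le> r * y\<close> by simp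
    have "real_of_int (s * int (Suc n)) * y = r * y \<or> real_of_int (s * int (Suc n)) * y = - (r * y)"
      using s by (auto simp: r_def algebra_simps)
    then have "cos (real_of_int (s * int (Suc n)) * y) = cos (r * y)" by (metis cos_minus)
    also have "\<dots> \<le> cos (1/2)" by (rule cos_le_on) (use yr ry pi_gt3 in auto)
    finally have c: "cos (real_of_int (s * int (Suc n)) * y) \<le> cos (1/2)" .
    have "r\<^sup>2 * y\<^sup>2 \<le> 1\<^sup>2"
      unfolding power_mult_distrib[symmetric] by (rule power_mono) (use yr ry in auto)
    then have q: "r\<^sup>2 \<le> 1 / y\<^sup>2" using y0 by (simp add: field_simps)
    have c': "4 * pi * (1 - cos (1/2)) * ?c n \<le> 4 * pi * (1 - cos (real_of_int (s * int (Suc n)) * y)) * ?c n"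
      using c by (intro mult_right_mono mult_left_mono) auto
    have "\<bar>y\<bar> \<le> pi" using y0 yp pi_gt3 by auto
    then have "ennreal (4 * pi * (1 - cos (1/2)) * ?c n) \<le> second_diff a y"
      by (rule order_trans[OF ennreal_leI[OF c'] second_diff_ge[OF besovD(1)[OF a]]])
    then have "ennreal (r\<^sup>2) * ennreal (4 * pi * (1 - cos (1/2)) * ?c n) \<le> ennreal (1 / y\<^sup>2) * second_diff a y"
      using q by (intro mult_mono ennreal_leI) auto
    moreover have "ennreal (r\<^sup>2) * ennreal (4 * pi * (1 - cos (1/2)) * ?c n) = ennreal (v n)"
      using k unfolding v_def r_def by (subst ennreal_mult) auto
    moreover have "y \<in> {-pi..pi}" using y0 yp pi_gt3 by auto
    ultimately show ?thesis by simp
  qed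
  have "(\<Sum>n<N. ?c n) \<le> B / (2 * pi * (1 - cos (1/2)))" for N
  proof -
    have "(\<Sum>n<N. ennreal (v n) * indicator (J n) y) \<le> ennreal (1 / y\<^sup>2) * second_diff a y * indicator {-pi..pi} y" for y
    proof (cases "\<exists>m<N. y \<in> J m")
      case True
      then obtain m where m: "m < N" "y \<in> J m" by blast
      have "(\<Sum>n<N. ennreal (v n) * indicator (J n) y) = (\<Sum>n\<in>{m}. ennreal (v n) * indicator (J n) y)"
        by (rule sum.mono_neutral_right) (use m disj in \<open>auto simp: indicator_def\<close>)
      also have "\<dots> = ennreal (v m)" using m by simp
      finally show ?thesis using single[OF m(2)] by simp
    next
      case False
      then have "(\<Sum>n<N. ennreal (v n) * indicator (J n) y) = 0"
        by (intro sum.neutral) (auto simp: indicator_def)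
      then show ?thesis by simp
    qed
    then have "(\<integral>\<^sup>+ y. (\<Sum>n<N. ennreal (v n) * indicator (J n) y) \<partial>lebesgue) \<le> ?B"
      by (intro nn_integral_mono) auto
    also have "(\<integral>\<^sup>+ y. (\<Sum>n<N. ennreal (v n) * indicator (J n) y) \<partial>lebesgue) =
        (\<Sum>n<N. (\<integral>\<^sup>+ y. ennreal (v n) * indicator (J n) y \<partial>lebesgue))"
      by (rule nn_integral_sum) (auto simp: J_def intro!: borel_measurable_times_ennreal borel_measurable_indicator)
    also have "\<dots> = (\<Sum>n<N. ennreal (v n * (1 / real (Suc n) - 1 / real (Suc (Suc n)))))"
    proof (rule sum.cong)
      fix n
      have le: "1 / real (Suc (Suc n)) \<le> 1 / real (Suc n)" by (intro divide_left_mono) auto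
      have "(\<integral>\<^sup>+ y. ennreal (v n) * indicator (J n) y \<partial>lebesgue) = ennreal (v n) * emeasure lebesgue (J n)"
        by (rule nn_integral_cmult_indicator) (auto simp: J_def)
      also have "emeasure lebesgue (J n) = ennreal (1 / real (Suc n) - 1 / real (Suc (Suc n)))"
        unfolding J_def using le by (subst emeasure_completion) auto
      also have "ennreal (v n) * \<dots> = ennreal (v n * (1 / real (Suc n) - 1 / real (Suc (Suc n))))"
        using v0 le by (subst ennreal_mult) auto
      finally show "(\<integral>\<^sup>+ y. ennreal (v n) * indicator (J n) y \<partial>lebesgue) = ennreal (v n * (1 / real (Suc n) - 1 / real (Suc (Suc n))))" .
    qed simp
    also have "\<dots> = ennreal (\<Sum>n<N. v n * (1 / real (Suc n) - 1 / real (Suc (Suc n))))"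
      using v0 by (intro sum_ennreal mult_nonneg_nonneg) (auto simp: field_simps)
    finally have *: "(\<Sum>n<N. v n * (1 / real (Suc n) - 1 / real (Suc (Suc n)))) \<le> B" using B by simp
    have "2 * pi * (1 - cos (1/2)) * ?c n \<le> v n * (1 / real (Suc n) - 1 / real (Suc (Suc n)))" for n
    proof -
      have "1 / 2 \<le> x\<^sup>2 * (1 / x - 1 / (x + 1))" if "1 \<le> x" for x :: real
      proof -
        have "1 / x - 1 / (x + 1) = 1 / (x * (x + 1))" using that by (simp add: field_simps)
        then have "x\<^sup>2 * (1 / x - 1 / (x + 1)) = x / (x + 1)"
          using that by (simp only: power2_eq_square) simp
        moreover have "1 / 2 \<le> x / (x + 1)" using that by (simp add: field_simps)
        ultimately show ?thesis by (simp only:)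
      qed
      from this[of "real (Suc n)"]
      have "1 / 2 \<le> (real (Suc n))\<^sup>2 * (1 / real (Suc n) - 1 / real (Suc (Suc n)))"
        by (simp add: add_ac)
      then have "1 / 2 * (4 * pi * (1 - cos (1/2)) * ?c n) \<le>
          (real (Suc n))\<^sup>2 * (1 / real (Suc n) - 1 / real (Suc (Suc n))) * (4 * pi * (1 - cos (1/2)) * ?c n)"
        by (rule mult_right_mono) (use k in auto)
      also have "\<dots> = v n * (1 / real (Suc n) - 1 / real (Suc (Suc n)))"
        unfolding v_def by (simp only: mult_ac)
      finally show ?thesis by simp
    qed
    then have "(\<Sum>n<N. 2 * pi * (1 - cos (1/2)) * ?c n) \<le> (\<Sum>n<N. v n * (1 / real (Suc n) - 1 / real (Suc (Suc n))))"
      by (rule sum_mono)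
    with * have "2 * pi * (1 - cos (1/2)) * (\<Sum>n<N. ?c n) \<le> B" by (simp add: sum_distrib_left)
    then show ?thesis using k by (simp add: pos_le_divide_eq mult_ac)
  qed
  then show ?thesis by (intro summableI_nonneg_bounded) auto
qed

text \<open>The bridge from functions to symbols: a Besov function agrees almost everywhere with its
  absolutely convergent Fourier series, whose coefficients decay as \<open>wlip\<close>
  requires.\<close>

lemma besov_wiener:
  assumes a: "a \<in> besov_1_1"
  obtains F where "\<And>n. fourier a n = coef F n" "wlip F" "AE \<theta> in circ. a (cis \<theta>) = wev F \<theta>"
    "(\<lambda>\<theta>. a (cis \<theta>)) \<in> borel_measurable circ"
proof -
  have s: "(\<lambda>n. norm (fourier a n)) summable_on (\<lambda>m. s * int (Suc m)) ` UNIV" if "s \<in> {1, -1}" for s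
    using norm_summable_imp_summable_on[of "\<lambda>n. norm (fourier a (s * int (Suc n)))"] besov_summable[OF a that] that
    by (subst summable_on_reindex) (auto simp: o_def inj_on_def)
  have "(\<lambda>n. norm (fourier a n)) summable_on ((\<lambda>m. 1 * int (Suc m)) ` UNIV \<union> (\<lambda>m. -1 * int (Suc m)) ` UNIV \<union> {0})"
    by (intro summable_on_Un_disjoint s) auto
  also have "(\<lambda>m. 1 * int (Suc m)) ` UNIV \<union> (\<lambda>m. -1 * int (Suc m)) ` UNIV \<union> {0} = UNIV"
  proof -
    have "n \<in> (\<lambda>m. 1 * int (Suc m)) ` UNIV \<union> (\<lambda>m. -1 * int (Suc m)) ` UNIV \<union> {0}" for n
    proof (cases n rule: linorder_cases[of _ 0])
      case less
      then have "n = -1 * int (Suc (nat (- n - 1)))" by simp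
      then show ?thesis by blast
    next
      case greater
      then have "n = 1 * int (Suc (nat (n - 1)))" by simp
      then show ?thesis by blast
    qed simp
    then show ?thesis by blast
  qed
  finally have sum: "(\<lambda>n. norm (fourier a n)) summable_on UNIV" .
  define F where "F = Abs_wiener (fourier a)"
  have F: "fourier a n = coef F n" for n
    unfolding F_def using sum by (simp add: Abs_wiener_inverse)
  have "wlip F" using besov_bounded[OF a] by (simp add: wlip_def F)
  show thesis
    by (rule that[OF F \<open>wlip F\<close> fourier_unique[OF besovD(1)[OF a] F]]) (use besovD(1)[OF a] in simp)
qed

section \<open>The limit theorem\<close>

lemma det_P_zero:
  assumes v: "j < N" "v j \<noteq> 0" and sum: "\<And>i. i < N \<Longrightarrow> (\<Sum>k<N. A i k * v k) = 0"
  shows "det_P N A = 0"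
  unfolding det_P_def
proof (rule iffD2[OF det_0_iff_vec_prod_zero[of _ N]], simp, intro exI conjI)
  show "Matrix.vec N v \<noteq> 0\<^sub>v N"
  proof
    assume "Matrix.vec N v = 0\<^sub>v N"
    then have "Matrix.vec N v $ j = 0\<^sub>v N $ j" by simp
    with v show False by simp
  qed
  show "Matrix.mat N N (\<lambda>(i, j). A i j) *\<^sub>v Matrix.vec N v = 0\<^sub>v N"
    by (rule eq_vecI) (auto simp: scalar_prod_def sum lessThan_atLeast0[symmetric])
qed simp

lemma det_P_diag_right: "det_P N (\<lambda>i j. A i j * d j) = det_P N A * (\<Prod>j<N. d j)"
proof -
  have "det_P N (\<lambda>i j. if i = j then d j else 0) = (\<Prod>j<N. d j)"
    unfolding det_P_def
    by (subst det_upper_triangular[of _ N]) (auto simp: prod_list_diag_prod lessThan_atLeast0)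
  moreover have "(\<lambda>i j. \<Sum>k<N. A i k * (if k = j then d j else 0)) i j = A i j * d j" if "j < N" for i j
    using that by (simp add: if_distrib cong: if_cong)
  then have "det_P N (\<lambda>i j. A i j * d j) = det_P N (\<lambda>i j. \<Sum>k<N. A i k * (if k = j then d j else 0))"
    by (intro det_P_cong) simp
  ultimately show ?thesis by (simp only: det_P_mult)
qed

lemma det_P_scale: "det_P N (\<lambda>i j. c * A i j) = c ^ N * det_P N A"
  using det_P_diag_right[of N A "\<lambda>_. c"] by (simp add: mult.commute)

lemma fourier_mult_powi: "fourier (\<lambda>t. a t * t powi k) n = fourier a (n - k)"
proof -
  have "cis (real_of_int k * \<theta>) * cis (- real_of_int n * \<theta>) = cis (- real_of_int (n - k) * \<theta>)" for \<theta>
    using cis_int_mult_add[of k \<theta> "- n"] by (simp add: algebra_simps)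
  then show ?thesis unfolding fourier_alt cis_power_int by (simp only: mult.assoc)
qed

lemma fourier_cong:
  assumes "a =\<^sub>T b" "(\<lambda>\<theta>. a (cis \<theta>)) \<in> borel_measurable circ" "(\<lambda>\<theta>. b (cis \<theta>)) \<in> borel_measurable circ"
  shows "fourier a n = fourier b n"
proof -
  have c: "(\<lambda>\<theta>. cis (r * \<theta>)) \<in> borel_measurable circ" for r
    by (intro continuous_imp_measurable_on_sets_lebesgue continuous_intros) auto
  have "(LINT \<theta>|circ. a (cis \<theta>) * cis (- real_of_int n * \<theta>)) = (LINT \<theta>|circ. b (cis \<theta>) * cis (- real_of_int n * \<theta>))"
    by (rule integral_cong_AE)
       (use assms c[of "- real_of_int n"] in \<open>auto simp: circle_eq_def intro!: borel_measurable_times elim!: eventually_mono\<close>)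
  then show ?thesis by (simp only: fourier_alt)
qed

lemma fourier_tilde: "fourier (tilde a) n = fourier a (- n)"
  using integral_reflect_real[of pi "- pi" "\<lambda>\<theta>. a (cis \<theta>) * cis (- real_of_int (- n) * \<theta>)"]
  by (simp add: fourier_alt tilde_def)

lemma measurable_tilde:
  assumes "a \<in> besov_1_1"
  shows "(\<lambda>\<theta>. tilde a (cis \<theta>)) \<in> borel_measurable circ"
  using integrable_reflect_real[of pi "- pi" "\<lambda>\<theta>. a (cis \<theta>)"] besovD(1)[OF assms]
  by (simp add: tilde_def borel_measurable_integrable)

lemma wev_inj:
  assumes "AE \<theta> in circ. wev F \<theta> = wev G \<theta>"
  shows "F = G"
proof (rule wiener_eqI)
  fix n
  have c: "(\<lambda>\<theta>. cis (r * \<theta>)) \<in> borel_measurable circ" for r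
    by (intro continuous_imp_measurable_on_sets_lebesgue continuous_intros) auto
  have w: "wev H \<in> borel_measurable circ" for H
    using borel_measurable_integrable[OF integral_mult_wev(2)[OF integrable_circ_const[of 1], of H]] by simp
  have "(LINT \<theta>|circ. cis (real_of_int (- n) * \<theta>) * wev F \<theta>) = (LINT \<theta>|circ. cis (real_of_int (- n) * \<theta>) * wev G \<theta>)"
    by (rule integral_cong_AE)
       (use assms c[of "- real_of_int n"] w in \<open>auto intro!: borel_measurable_times elim!: eventually_mono\<close>)
  then show "coef F n = coef G n" unfolding integral_cis_wev by simp
qed

lemma coef_wmonom_mult [simp]: "coef (wmonom 0 c * F) n = c * coef F n"
proof -
  have "coef (F * wmonom 0 c) n = (\<Sum>\<^sub>\<infinity>k\<in>{0::int}. coef F n * c)"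
    unfolding coef_mult by (rule infsum_cong_neutral) auto
  then show ?thesis by (simp add: mult.commute)
qed

lemma coef_summable_inj:
  assumes "inj (h :: nat \<Rightarrow> int)"
  shows "summable (\<lambda>m. coef g (h m))"
proof -
  have "(\<lambda>n. norm (coef g n)) summable_on range h"
    by (rule summable_on_subset_banach[OF coef_summable]) simp
  then have "(\<lambda>m. norm (coef g (h m))) summable_on UNIV"
    using assms by (subst (asm) summable_on_reindex) (auto simp: o_def)
  then have "summable (\<lambda>m. norm (coef g (h m)))" by (rule summable_on_imp_summable)
  then show ?thesis by (rule summable_norm_cancel)
qed

text \<open>Column \<open>k - 1\<close> is \<open>s\<close> times column 0, because \<open>s\<close>
  squared is 1. For \<open>k = 1\<close> the two columns coincide, and the relation is nontrivial
  only for \<open>s = - 1\<close>; hence the two ranges of \<open>k\<close>.\<close>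

lemma det_P_hankel_zero:
  assumes k: "int N \<ge> k" "k \<ge> 1" and s: "s = 1 \<and> k \<ge> 2 \<or> s = - 1"
  shows "det_P N (\<lambda>i j. u (int i - int j) + s * u (int i + int j + 1 - k)) = 0"
proof (rule det_P_zero[where j = 0 and v = "\<lambda>j. (if j = 0 then 1 else 0) - s * (if j = nat (k - 1) then 1 else 0)"])
  have q: "nat (k - 1) < N" "0 < N" using k by auto
  show "0 < N" by (rule q)
  show "(if 0 = (0::nat) then 1 else 0) - s * (if 0 = nat (k - 1) then 1 else 0) \<noteq> 0"
    using s k by auto
  fix i assume "i < N"
  let ?A = "\<lambda>j. u (int i - int j) + s * u (int i + int j + 1 - k)"
  have "(\<Sum>j<N. ?A j * ((if j = 0 then 1 else 0) - s * (if j = nat (k - 1) then 1 else 0)))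
      = (\<Sum>j<N. if j = 0 then ?A j else 0) - s * (\<Sum>j<N. if j = nat (k - 1) then ?A j else 0)"
    unfolding sum_distrib_left sum_subtractf[symmetric] by (rule sum.cong) (auto simp: algebra_simps)
  also have "\<dots> = ?A 0 - s * ?A (nat (k - 1))" using q by simp
  also have "\<dots> = 0" using k(2) s by (auto simp: algebra_simps)
  finally show "(\<Sum>j<N. ?A j * ((if j = 0 then 1 else 0) - s * (if j = nat (k - 1) then 1 else 0))) = 0" .
qed

text \<open>The reflection of \<open>b\<close> puts the positive coefficients of \<open>L\<close> at
  negative frequencies as well; \<open>\<mu>\<close> corrects this, which is why it is taken from
  \<open>L - wtilde L\<close>.\<close>

lemma log_splitting:
  fixes L :: wiener
  defines "b \<equiv> wrestrict {1..} L" and "\<mu> \<equiv> wrestrict {..-1} (L - wtilde L)"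
  shows "exp L = wmonom 0 (exp (coef L 0)) * exp (\<mu> + (b + wtilde b))"
proof -
  have L: "L = wmonom 0 (coef L 0) + (\<mu> + (b + wtilde b))"
    by (rule wiener_eqI) (auto simp: b_def \<mu>_def not_le)
  have "exp (wmonom 0 c) = wmonom 0 (exp c)" for c
    by (rule wev_inj) (simp add: wev_exp)
  then show ?thesis by (subst L) (simp only: exp_add')
qed

text \<open>Uniqueness of the factorization by an argument of Liouville type:
  \<open>exp (- \<mu>) * F\<close> has no positive frequencies and equals the even symbol
  \<open>E * exp \<beta> * F0i\<close>.\<close>

lemma even_factor:
  assumes E: "F * F0 = E * (exp \<mu> * exp \<beta>)" "F0 * F0i = 1"
    and F: "wnonpos F" "coef F 0 = 1" and \<mu>: "wnonpos \<mu>" "coef \<mu> 0 = 0"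
    and even: "wtilde F0i = F0i" "wtilde \<beta> = \<beta>" "wtilde E = E"
  shows "E * F0i = exp (- \<beta>)"
proof -
  have 1: "exp (- \<mu>) * F = E * exp \<beta> * F0i"
  proof -
    have "exp (- \<mu>) * F = exp (- \<mu>) * (F * (F0 * F0i))" by (simp add: E)
    also have "\<dots> = exp (- \<mu>) * (F * F0) * F0i" by (simp only: mult_ac)
    also have "\<dots> = (exp (- \<mu>) * exp \<mu>) * (E * exp \<beta> * F0i)" unfolding E by (simp only: mult_ac)
    finally show ?thesis by simp
  qed
  have "wtilde (E * exp \<beta> * F0i) = E * exp \<beta> * F0i" by (simp add: even)
  then have ev: "coef (exp (- \<mu>) * F) (- n) = coef (exp (- \<mu>) * F) n" for n
    unfolding 1 by (metis coef_wtilde)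
  have m: "wnonpos (- \<mu>)" using \<mu> by (simp add: wnonpos_def)
  have np: "wnonpos (exp (- \<mu>))" by (rule wnonpos_exp[OF m])
  have np': "wnonpos (exp (- \<mu>) * F)" by (rule wnonpos_mult[OF np F(1)])
  have "coef (exp (- \<mu>)) 0 = 1" by (rule coef_exp_nonpos_0[OF m]) (simp add: \<mu>)
  then have 0: "coef (exp (- \<mu>) * F) 0 = 1"
    using coef_mult_nonpos[OF np F(1), of 0] by (simp add: F)
  \<comment> \<open>A symbol that is even and has no positive frequencies is constant.\<close>
  have "exp (- \<mu>) * F = 1"
  proof (rule wiener_eqI)
    fix n :: int
    consider "n > 0" | "n = 0" | "- n > 0" by linarith
    then show "coef (exp (- \<mu>) * F) n = coef 1 n"
    proof cases
      case 3
      then have "coef (exp (- \<mu>) * F) (- n) = 0" using np' by (simp add: wnonpos_def)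
      with ev[of n] 3 show ?thesis by simp
    qed (use np' 0 in \<open>auto simp: wnonpos_def\<close>)
  qed
  with 1 have "E * exp \<beta> * F0i = 1" by simp
  then have "exp (- \<beta>) * (exp \<beta> * (E * F0i)) = exp (- \<beta>)" by (simp add: mult_ac)
  then show ?thesis by (simp add: mult.assoc[symmetric])
qed

text \<open>Restores the factor \<open>c\<close> and the true first column. Here
  \<open>c ^ N\<close> comes from the section itself and \<open>c ^ l\<close> from the minor of the
  inverse symbol.\<close>

lemma (in symbol_splitting) symbol_limit:
  assumes u: "\<And>n. u n = c * coef (exp (\<mu> + \<beta>)) n" and v: "\<And>n. c * v n = coef (exp (- \<beta>)) n"
    and c: "c \<noteq> 0" and l: "l \<ge> 1"
  shows "(\<lambda>N. det_P N (\<lambda>i j. u (int i - int j) + \<epsilon> * u (int i + int j + 1 - (\<kappa> - 2 * int l))) / c ^ (N + l))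
    \<longlonglongrightarrow> (if \<kappa> = 1 then 1 / 2 else 1) * exp (tau_lim + g0 + g1 / 2) *
      det_P l (\<lambda>i j. v (int i - int j) + \<epsilon> * v (int i + int j + 1 - \<kappa>))"
proof -
  let ?v = "\<lambda>i j. v (int i - int j) + \<epsilon> * v (int i + int j + 1 - \<kappa>)"
  \<comment> \<open>Removing \<open>l\<close> rows and columns keeps the differences of indices and
    raises their sums by \<open>2 * l\<close>. As \<open>l \<ge> 1\<close>, the exceptional column 0
    is removed too, so \<open>\<epsilon>\<close> stands everywhere.\<close>
  have "u (int i - int j) + \<epsilon> * u (int i + int j + 1 - (\<kappa> - 2 * int l)) = c * ent (A 1) (i + l) (j + l)" for i j
    using l by (simp add: A_def ent_M e_def u algebra_simps)
  then have eq: "det_P N (\<lambda>i j. u (int i - int j) + \<epsilon> * u (int i + int j + 1 - (\<kappa> - 2 * int l))) / c ^ (N + l)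
      = det_P N (\<lambda>i j. ent (A 1) (i + l) (j + l)) * (1 / c ^ l)" for N
    using c by (simp add: det_P_scale power_add)
  \<comment> \<open>For \<open>\<kappa> = 1\<close> the first columns of the Toeplitz and the Hankel
    part coincide by evenness, so the full matrix has twice the column of \<open>M\<close>.\<close>
  let ?d = "\<lambda>j. if \<kappa> = 1 \<and> j = 0 then 2 else (1 :: complex)"
  have "c * ?v i j = ent (M (exp (- \<beta>))) i j * ?d j" for i j
    using cases by (auto simp: ent_M e_def v[symmetric] algebra_simps)
  then have "c ^ l * det_P l ?v = sdet l (M (exp (- \<beta>))) * (\<Prod>j<l. ?d j)"
    by (simp only: det_P_diag_right det_P_scale[symmetric])
  moreover have "(\<Prod>j<l. ?d j) = (if \<kappa> = 1 then 2 else 1)"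
  proof (cases "\<kappa> = 1")
    case True
    then show ?thesis using l by (cases l) (simp_all add: prod.lessThan_Suc_shift)
  qed simp
  ultimately have "sdet l (M (exp (- \<beta>))) = (if \<kappa> = 1 then 1 / 2 else 1) * (c ^ l * det_P l ?v)"
    by auto
  then have "exp (tau_lim + g0 + g1 / 2) * sdet l (M (exp (- \<beta>))) * (1 / c ^ l) =
      (if \<kappa> = 1 then 1 / 2 else 1) * exp (tau_lim + g0 + g1 / 2) * det_P l ?v"
    using c by simp
  then show ?thesis
    unfolding eq using tendsto_mult_right[OF shifted_limit[of l], where c = "1 / c ^ l"] by (simp only:)
qed

text \<open>Treats the three asymptotic regimes at once: \<open>\<kappa> = 0\<close> for even
  \<open>k\<close>, and \<open>\<kappa> = - 1\<close> or \<open>\<kappa> = 1\<close> for the two odd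
  cases. The parity of \<open>2 * i + 1 - \<kappa>\<close> decides whether odd or even coefficients
  of the logarithm enter.\<close>

lemma toeplitz_hankel_limit:
  fixes a log_a a_minus a_0 :: "complex \<Rightarrow> complex"
  assumes a: "a \<in> besov_1_1"
    and log_a: "log_a \<in> besov_1_1" "(\<lambda>t. exp (log_a t)) =\<^sub>T a"
    and factorization: "a =\<^sub>T (\<lambda>t. a_minus t * a_0 t)"
    and a_minus: "a_minus \<in> besov_1_1" "\<forall>n>0. fourier a_minus n = 0" "fourier a_minus 0 = 1"
    and a_0: "a_0 \<in> besov_1_1" "(\<lambda>t. inverse (a_0 t)) \<in> besov_1_1"
      "(\<lambda>t. inverse (a_0 t)) =\<^sub>T tilde (\<lambda>t. inverse (a_0 t))"
    and cases: "(\<kappa>, \<epsilon>) \<in> {(0, 1), (0, -1), (-1, -1), (1, 1)}" and l: "l \<ge> 1"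
  shows "(\<lambda>N. det_P N (\<lambda>i j. fourier a (int i - int j) + \<epsilon> * fourier a (int i + int j + 1 - (\<kappa> - 2 * int l))) /
        G_const log_a ^ (N + l))
    \<longlonglongrightarrow> (if \<kappa> = 1 then 1 / 2 else 1) *
      exp (\<epsilon> * (\<Sum>i. fourier log_a (if \<kappa> = 0 then 2 * int i + 1 else 2 * int (Suc i)))
        - 1 / 2 * (\<Sum>n. of_nat (Suc n) * (fourier log_a (int (Suc n)))\<^sup>2)
        + (\<Sum>n. of_nat (Suc n) * fourier log_a (- int (Suc n)) * fourier log_a (int (Suc n)))) *
      det_P l (\<lambda>i j. fourier (\<lambda>t. inverse (a_0 t)) (int i - int j) + \<epsilon> * fourier (\<lambda>t. inverse (a_0 t)) (int i + int j + 1 - \<kappa>))"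
proof -
  obtain L where L: "\<And>n. fourier log_a n = coef L n" "wlip L" "AE \<theta> in circ. log_a (cis \<theta>) = wev L \<theta>"
    using besov_wiener[OF log_a(1)] by metis
  obtain F where F: "\<And>n. fourier a_minus n = coef F n" "AE \<theta> in circ. a_minus (cis \<theta>) = wev F \<theta>"
    using besov_wiener[OF a_minus(1)] by metis
  obtain F0 where F0: "AE \<theta> in circ. a_0 (cis \<theta>) = wev F0 \<theta>"
    using besov_wiener[OF a_0(1)] by metis
  obtain V where V: "\<And>n. fourier (\<lambda>t. inverse (a_0 t)) n = coef V n" "AE \<theta> in circ. inverse (a_0 (cis \<theta>)) = wev V \<theta>"
    using besov_wiener[OF a_0(2)] by metis
  have expL: "AE \<theta> in circ. a (cis \<theta>) = wev (exp L) \<theta>"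
    using log_a(2) L(3) unfolding circle_eq_def
    by eventually_elim (simp add: wev_exp)
  have coef_a: "fourier a n = coef (exp L) n" for n
    by (rule fourier_of_wev[OF borel_measurable_integrable[OF besovD(1)[OF a]] expL])
  have prod: "F * F0 = exp L"
  proof (rule wev_inj)
    show "AE \<theta> in circ. wev (F * F0) \<theta> = wev (exp L) \<theta>"
      using factorization expL F(2) F0 unfolding circle_eq_def
      by eventually_elim (simp add: wev_mult)
  qed
  have inv: "F0 * V = 1"
  proof (rule wev_inj)
    show "AE \<theta> in circ. wev (F0 * V) \<theta> = wev 1 \<theta>"
      using log_a(2) factorization F0 V(2) unfolding circle_eq_def
    proof eventually_elim
      case (elim \<theta>)
      \<comment> \<open>With \<open>inverse 0 = 0\<close> the product of \<open>a_0\<close> and its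
        inverse is 1 only where \<open>a_0\<close> does not vanish. An exponential excludes zeros
        almost everywhere.\<close>
      have "a_minus (cis \<theta>) * a_0 (cis \<theta>) = exp (log_a (cis \<theta>))" using elim(1,2) by simp
      then have "a_0 (cis \<theta>) \<noteq> 0" by auto
      then show ?case unfolding wev_mult elim(3)[symmetric] elim(4)[symmetric] by simp
    qed
  qed
  have "coef V n = coef V (- n)" for n
    using fourier_cong[OF a_0(3) _ measurable_tilde[OF a_0(2)], of n] besovD(1)[OF a_0(2)]
    by (simp add: fourier_tilde V(1) borel_measurable_integrable)
  then have Veven: "wtilde V = V" by (intro wiener_eqI) simp
  define b where "b = wrestrict {1..} L"
  define \<mu> where "\<mu> = wrestrict {..-1} (L - wtilde L)"
  define e where "e j = (if \<kappa> = 1 \<and> j = 0 then 0 else \<epsilon>)" for j :: nat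
  have "wlip (L - wtilde L)"
    unfolding diff_conv_add_uminus by (intro wlip_add wlip_simps L(2))
  then interpret symbol_splitting \<kappa> \<epsilon> e \<mu> b
    using cases L(2) by unfold_locales (auto simp: e_def b_def \<mu>_def wnonpos_def wnonneg_def wlip_wrestrict)
  define c where "c = exp (coef L 0)"
  have "exp L = wmonom 0 c * exp (\<mu> + \<beta>)"
    unfolding c_def \<beta>_def unfolding b_def \<mu>_def by (rule log_splitting)
  then have u: "fourier a n = c * coef (exp (\<mu> + \<beta>)) n" for n by (simp add: coef_a)
  have "wmonom 0 c * V = exp (- \<beta>)"
  proof (rule even_factor[where \<mu> = \<mu> and F = F, OF _ inv _ _ _ _ Veven])
    show "F * F0 = wmonom 0 c * (exp \<mu> * exp \<beta>)"
      using prod \<open>exp L = wmonom 0 c * exp (\<mu> + \<beta>)\<close> by (simp add: exp_add')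
    show "wnonpos F" "coef F 0 = 1" using a_minus(2,3) by (auto simp: wnonpos_def F(1))
    show "wtilde (wmonom 0 c) = wmonom 0 c" by (rule wiener_eqI) simp
    show "wtilde \<beta> = \<beta>" by (simp add: \<beta>_def add.commute)
  qed (rule mu)+
  then have v: "c * coef V n = coef (exp (- \<beta>)) n" for n by (metis coef_wmonom_mult)
  have G: "G_const log_a = c"
    by (simp add: G_const_def c_def flip: L(1)) (simp add: fourier_def)
  have coef_b: "coef b (int (Suc m)) = coef L (int (Suc m))" for m by (simp add: b_def del: of_nat_Suc)
  have coef_mu: "coef \<mu> (- int (Suc m)) = coef L (- int (Suc m)) - coef L (int (Suc m))" for m by (simp add: \<mu>_def del: of_nat_Suc)
  have s: "summable (\<lambda>m. of_nat (Suc m) * coef L (int (Suc m)) * coef L (- int (Suc m)))"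
    "summable (\<lambda>m. of_nat (Suc m) * coef L (int (Suc m)) * coef L (int (Suc m)))"
    by (rule wlip_summable[OF L(2)])+
  \<comment> \<open>The squares occur with weight -1 in \<open>g0\<close>, through the subtracted
    reflection in \<open>\<mu>\<close>, and with weight 1/2 from \<open>g1\<close>.\<close>
  have g: "g0 + g1 / 2 = - 1 / 2 * (\<Sum>n. of_nat (Suc n) * (coef L (int (Suc n)))\<^sup>2)
      + (\<Sum>n. of_nat (Suc n) * coef L (- int (Suc n)) * coef L (int (Suc n)))"
  proof -
    have "g0 = (\<Sum>m. of_nat (Suc m) * coef L (int (Suc m)) * coef L (- int (Suc m)) - of_nat (Suc m) * coef L (int (Suc m)) * coef L (int (Suc m)))"
      unfolding g0_def coef_b coef_mu by (simp only: right_diff_distrib)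
    also have "\<dots> = (\<Sum>m. of_nat (Suc m) * coef L (int (Suc m)) * coef L (- int (Suc m))) - (\<Sum>m. of_nat (Suc m) * coef L (int (Suc m)) * coef L (int (Suc m)))"
      by (rule suminf_diff[OF s, symmetric])
    finally have "g0 = \<dots>" .
    moreover have "g1 = (\<Sum>m. of_nat (Suc m) * coef L (int (Suc m)) * coef L (int (Suc m)))"
      unfolding g1_def coef_b ..
    ultimately show ?thesis by (simp add: power2_eq_square mult_ac)
  qed
  have bL: "coef \<beta> n = coef L n" if "n > 0" for n
    using that coef_beta_pos[OF that] by (simp add: b_def)
  \<comment> \<open>For \<open>\<kappa> = 1\<close> the term \<open>i = 0\<close> is suppressed by
    \<open>e 0 = 0\<close>, so the sum starts at frequency 2, as it does for
    \<open>\<kappa> = - 1\<close>.\<close>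
  have t: "tau_lim = \<epsilon> * (\<Sum>i. coef L (if \<kappa> = 0 then 2 * int i + 1 else 2 * int (Suc i)))"
  proof (cases "\<kappa> = 1")
    case True
    let ?f = "\<lambda>i. e i * coef \<beta> (2 * int i + 1 - \<kappa>)"
    have f: "?f (Suc i) = \<epsilon> * coef L (2 * int (Suc i))" "?f 0 = 0" for i
      using True by (simp_all add: e_def bL)
    have "summable (\<lambda>i. coef L (2 * int (Suc i)))"
      by (rule coef_summable_inj) (simp add: inj_def)
    then have "(\<lambda>i. ?f (Suc i)) sums (\<epsilon> * (\<Sum>i. coef L (2 * int (Suc i))))"
      unfolding f(1) by (intro sums_mult summable_sums)
    from sums_Suc[OF this] have "?f sums (\<epsilon> * (\<Sum>i. coef L (2 * int (Suc i))))"
      unfolding f(2) by simp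
    then show ?thesis
      unfolding tau_lim_def using True by (simp add: sums_unique[symmetric])
  next
    case False
    have "tau_lim = (\<Sum>i. \<epsilon> * coef L (if \<kappa> = 0 then 2 * int i + 1 else 2 * int (Suc i)))"
      unfolding tau_lim_def
    proof (rule suminf_cong)
      fix i
      have "2 * int i + 1 - \<kappa> = (if \<kappa> = 0 then 2 * int i + 1 else 2 * int (Suc i))"
        using False cases by auto
      moreover have "\<dots> > 0" by simp
      ultimately show "e i * coef \<beta> (2 * int i + 1 - \<kappa>) = \<epsilon> * coef L (if \<kappa> = 0 then 2 * int i + 1 else 2 * int (Suc i))"
        using False by (simp only: bL) (simp add: e_def)
    qed
    also have "\<dots> = \<epsilon> * (\<Sum>i. coef L (if \<kappa> = 0 then 2 * int i + 1 else 2 * int (Suc i)))"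
      by (rule suminf_mult[OF coef_summable_inj]) (auto simp: inj_def)
    finally show ?thesis .
  qed
  have "tau_lim + g0 + g1 / 2 = \<epsilon> * (\<Sum>i. coef L (if \<kappa> = 0 then 2 * int i + 1 else 2 * int (Suc i)))
        - 1 / 2 * (\<Sum>n. of_nat (Suc n) * (coef L (int (Suc n)))\<^sup>2)
        + (\<Sum>n. of_nat (Suc n) * coef L (- int (Suc n)) * coef L (int (Suc n)))"
    using g unfolding t by (simp add: add.assoc)
  moreover have "c \<noteq> 0" by (simp add: c_def)
  ultimately show ?thesis
    using symbol_limit[where u = "fourier a" and v = "coef V", OF u v _ l]
    unfolding G L(1) V(1) by simp
qed

lemma toeplitz_hankel_plus:
  "toeplitz a + hankel (\<lambda>t. a t * t powi k) = (\<lambda>i j. fourier a (int i - int j) + 1 * fourier a (int i + int j + 1 - k))"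
  by (intro ext) (simp add: plus_fun_def toeplitz_def hankel_def fourier_mult_powi)

lemma toeplitz_hankel_minus:
  "toeplitz a - hankel (\<lambda>t. a t * t powi k) = (\<lambda>i j. fourier a (int i - int j) + - 1 * fourier a (int i + int j + 1 - k))"
  by (intro ext) (simp add: fun_diff_def toeplitz_def hankel_def fourier_mult_powi)

theorem theorem4p5:
  fixes a log_a a_minus a_0 :: "complex \<Rightarrow> complex"
  assumes a: "a \<in> besov_1_1"
    and log_a: "log_a \<in> besov_1_1" "(\<lambda>t. exp (log_a t)) =\<^sub>T a"
    and factorization: "a =\<^sub>T (\<lambda>t. a_minus t * a_0 t)"
    and a_minus: "a_minus \<in> besov_1_1" "(\<lambda>t. inverse (a_minus t)) \<in> besov_1_1"
      "\<And>n. n > 0 \<Longrightarrow> fourier a_minus n = 0"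
      "\<And>n. n > 0 \<Longrightarrow> fourier (\<lambda>t. inverse (a_minus t)) n = 0"
      "fourier a_minus 0 = 1"
    and a_0: "a_0 \<in> besov_1_1" "(\<lambda>t. inverse (a_0 t)) \<in> besov_1_1"
      "a_0 =\<^sub>T tilde a_0"
      "(\<lambda>t. inverse (a_0 t)) =\<^sub>T tilde (\<lambda>t. inverse (a_0 t))"
  shows
    "(\<forall>(l::nat) (k::int). l \<ge> 1 \<and> k = - 2 * int l \<longrightarrow>
        (\<lambda>N. det_P N (toeplitz a + hankel (\<lambda>t. a t * t powi k)) / G_const log_a ^ (N + l))
          \<longlonglongrightarrow> E1_plus log_a *
            det_P l (toeplitz (\<lambda>t. inverse (a_0 t)) + hankel (\<lambda>t. inverse (a_0 t))) \<and>
        (\<lambda>N. det_P N (toeplitz a - hankel (\<lambda>t. a t * t powi k)) / G_const log_a ^ (N + l))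
          \<longlonglongrightarrow> E1_minus log_a *
            det_P l (toeplitz (\<lambda>t. inverse (a_0 t)) - hankel (\<lambda>t. inverse (a_0 t)))) \<and>
     (\<forall>(l::nat) (k::int). l \<ge> 1 \<and> k = - 1 - 2 * int l \<longrightarrow>
        (\<lambda>N. det_P N (toeplitz a - hankel (\<lambda>t. a t * t powi k)) / G_const log_a ^ (N + l))
          \<longlonglongrightarrow> E2 log_a *
            det_P l (toeplitz (\<lambda>t. inverse (a_0 t))
              - hankel (\<lambda>t. inverse (a_0 t) * t powi (- 1)))) \<and>
     (\<forall>(l::nat) (k::int). l \<ge> 1 \<and> k = 1 - 2 * int l \<longrightarrow>
        (\<lambda>N. det_P N (toeplitz a + hankel (\<lambda>t. a t * t powi k)) / G_const log_a ^ (N + l))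
          \<longlonglongrightarrow> E3 log_a *
            det_P l (toeplitz (\<lambda>t. inverse (a_0 t))
              + hankel (\<lambda>t. inverse (a_0 t) * t))) \<and>
     (\<forall>(N::nat) (k::int). int N \<ge> k \<and> k \<ge> 2 \<longrightarrow>
        det_P N (toeplitz a + hankel (\<lambda>t. a t * t powi k)) = 0) \<and>
     (\<forall>(N::nat) (k::int). int N \<ge> k \<and> k \<ge> 1 \<longrightarrow>
        det_P N (toeplitz a - hankel (\<lambda>t. a t * t powi k)) = 0)"
proof (intro conjI allI impI; elim conjE)
  have am: "\<forall>n>0. fourier a_minus n = 0" using a_minus(3) by blast
  note lim = toeplitz_hankel_limit[OF a log_a factorization a_minus(1) am a_minus(5) a_0(1,2,4)]
  let ?i = "\<lambda>t. inverse (a_0 t)"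
  {
    fix l :: nat and k :: int assume l: "l \<ge> 1" and "k = - 2 * int l"
    then have k: "k = 0 - 2 * int l" by simp
    have "toeplitz ?i + hankel ?i = (\<lambda>i j. fourier ?i (int i - int j) + 1 * fourier ?i (int i + int j + 1 - 0))"
      using toeplitz_hankel_plus[of ?i 0] by simp
    then show "(\<lambda>N. det_P N (toeplitz a + hankel (\<lambda>t. a t * t powi k)) / G_const log_a ^ (N + l))
          \<longlonglongrightarrow> E1_plus log_a * det_P l (toeplitz ?i + hankel ?i)"
      using lim[of 0 1, OF _ l] unfolding toeplitz_hankel_plus k E1_plus_def by simp
    have "toeplitz ?i - hankel ?i = (\<lambda>i j. fourier ?i (int i - int j) + - 1 * fourier ?i (int i + int j + 1 - 0))"
      using toeplitz_hankel_minus[of ?i 0] by simp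
    then show "(\<lambda>N. det_P N (toeplitz a - hankel (\<lambda>t. a t * t powi k)) / G_const log_a ^ (N + l))
          \<longlonglongrightarrow> E1_minus log_a * det_P l (toeplitz ?i - hankel ?i)"
      using lim[of 0 "- 1", OF _ l] unfolding toeplitz_hankel_minus k E1_minus_def by simp
  next
    fix l :: nat and k :: int assume l: "l \<ge> 1" and k: "k = - 1 - 2 * int l"
    show "(\<lambda>N. det_P N (toeplitz a - hankel (\<lambda>t. a t * t powi k)) / G_const log_a ^ (N + l))
          \<longlonglongrightarrow> E2 log_a * det_P l (toeplitz ?i - hankel (\<lambda>t. ?i t * t powi (- 1)))"
      using lim[of "- 1" "- 1", OF _ l] unfolding toeplitz_hankel_minus k E2_def by simp
  next
    fix l :: nat and k :: int assume l: "l \<ge> 1" and k: "k = 1 - 2 * int l"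
    \<comment> \<open>The summand - log 2 in the exponent of \<open>E3\<close> is the factor 1/2
      that accounts for the doubled first column.\<close>
    have "exp (complex_of_real (ln 2)) = complex_of_real (exp (ln 2))" by (rule exp_of_real)
    then have "exp (- complex_of_real (ln 2)) = 1 / 2" by (simp add: exp_minus)
    then have ln2: "exp (- complex_of_real (ln 2) + x - y + z) = 1 / 2 * exp (1 * x - y + z)" for x y z
      using exp_add[of "- complex_of_real (ln 2)" "x - y + z"] by (simp add: algebra_simps)
    have "toeplitz ?i + hankel (\<lambda>t. ?i t * t) = (\<lambda>i j. fourier ?i (int i - int j) + 1 * fourier ?i (int i + int j + 1 - 1))"
      using toeplitz_hankel_plus[of ?i 1] by simp
    then show "(\<lambda>N. det_P N (toeplitz a + hankel (\<lambda>t. a t * t powi k)) / G_const log_a ^ (N + l))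
          \<longlonglongrightarrow> E3 log_a * det_P l (toeplitz ?i + hankel (\<lambda>t. ?i t * t))"
      using lim[of 1 1, OF _ l] unfolding toeplitz_hankel_plus k E3_def ln2 by simp
  next
    fix N :: nat and k :: int assume "int N \<ge> k" "k \<ge> 2"
    then show "det_P N (toeplitz a + hankel (\<lambda>t. a t * t powi k)) = 0"
      unfolding toeplitz_hankel_plus by (intro det_P_hankel_zero) auto
  next
    fix N :: nat and k :: int assume "int N \<ge> k" "k \<ge> 1"
    then show "det_P N (toeplitz a - hankel (\<lambda>t. a t * t powi k)) = 0"
      unfolding toeplitz_hankel_minus by (intro det_P_hankel_zero) auto
  }
qed

end
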